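(* Let $(X,\mathscr B,\mu,T)$ be a pointwise dual ergodic, conservative ergodic measure preserving transformation with $\mu$ $\sigma$-finite and $\mu(X)=+\infty$. Let $\alpha\in(0,1]$ and let $(B_n)_{n\ge0}$ be measurable sets of positive measure with $\mu(B_n)\to0$, all contained in a uniform set $Y$ whose normalizing sequence $(a_n)$ is regularly varying of index $\alpha$. Let $\gamma$ be the associated scaling function. (i) Let $\Psi,\widetilde\Psi$ be stochastic processes with values in $(\overline{\mathbb R}_+)^{\mathbb N}$. There is convergence in law under $\mu_{B_n}$, $$\gamma(\mu(B_n))\,\Phi_{B_n}\Longrightarrow\widetilde\Psi\quad\text{(for some }\widetilde\Psi),$$ if and only if there is convergence in law under every probability measure $\nu\ll\mu$, $$\gamma(\mu(B_n))\,\Phi_{B_n}\Longrightarrow\Psi\quad\text{(for some }\Psi).$$ (ii) In this case the laws of $\Psi$ and $\widetilde\Psi$ uniquely determine each other: denoting by $F^{[d]}$ and $\widetilde F^{[d]}$ the distribution functions of the first $d$ coordinates of $\Psi$ and $\widetilde\Psi$ respectively, with $\widetilde F^{[0]}:=1$, for all $d\ge1$ and all $0\le t_1\le\dots\le t_d$, $$F^{[d]}(t_1,\dots,t_d)=\alpha\int_0^{t_1}\Big(\widetilde F^{[d-1]}(t_2-t_1+x,\dots,t_d-t_1+x)-\widetilde F^{[d]}(x,t_2-t_1+x,\dots,t_d-t_1+x)\Big)(t_1-x)^{\alpha-1}\,dx .\qquad( * )$$ (iii) For $\alpha\in(0,1]$, the fractional Poisson process $\mathrm{FPP}_\alpha(\Gamma(1+\alpha))$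 is the unique fixed point of $( * )$: among the stochastic processes with values in $\mathcal W$, the process $\big(\sum_{k=1}^iX_k\big)_{i\ge1}$ with $(X_k)$ i.i.d. distributed as $H_\alpha(\Gamma(1+\alpha))$ is the only one (in law) for which $( * )$ holds with $F^{[d]}=\widetilde F^{[d]}$ equal to the distribution function of its first $d$ coordinates, for all $d\ge1$.
   Context: Transfer operator: $\widehat T:L^1(\mu)\to L^1(\mu)$ with $\int f\cdot(g\circ T)\,d\mu=\int(\widehat Tf)\cdot g\,d\mu$ for $f\in L^1(\mu),g\in L^\infty(\mu)$. The system (with $T$ preserving $\mu$) is conservative ergodic iff $\sum_{k\ge0}\widehat T^ku=+\infty$ $\mu$-a.e. for every $u\in L^1(\mu)$ with $u\ge0$, $\int u\,d\mu>0$. It is pointwise dual ergodic if there is a sequence $(a_n)$ (a normalizing sequence) with $\frac1{a_n}\sum_{k=0}^{n-1}\widehat T^ku\to\int u\,d\mu$ $\mu$-a.e. for all $u\in L^1(\mu)$. A set $Y\in\mathscr B$ with $\mu(Y)>0$ is uniform, with normalizing sequence $(a_n)$, if for some $f\in L^1(\mu)$ (taken nonnegative and of positive integral), $\frac1{a_n}\sum_{k=0}^{n-1}\widehat T^kf\to\int f\,d\mu$ in $L^\infty(\mu_Y)$, where $\mu_A:=\mu(\cdot\cap A)/\mu(A)$. $(a_n)$ regularly varying of index $\alpha$ means that $a(s):=a_{\lfloor s\rfloor}$ satisfies $a(xy)/a(x)\to y^\alpha$ as $x\to\infty$ for all $y>0$. $b$ is an asymptotic inverse of $a$: $a(b(s))\sim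 b(a(s))\sim s$ as $s\to\infty$; $\gamma(s):=1/b(1/s)$, $s>0$. Return times: $r_A^{(1)}(x)=\inf\{n\ge1:T^nx\in A\}$, $r_A^{(k+1)}(x)=\inf\{n>r_A^{(k)}(x):T^nx\in A\}$ and $\Phi_A:=(r_A^{(1)},r_A^{(2)},\dots)$, with values in $(\overline{\mathbb R}_+)^{\mathbb N}$, $\overline{\mathbb R}_+=[0,+\infty]$, with the product topology. $\mathcal W:=\{(\phi^{(i)})_{i\ge1}\in(\overline{\mathbb R}_+)^{\mathbb N}:\phi^{(i)}\le\phi^{(i+1)}\ \forall i\}$. $H_\alpha(\lambda)$ is the nonnegative random variable with $\mathbb E[e^{-sH_\alpha(\lambda)}]=\lambda/(\lambda+s^\alpha)$, $s\ge0$; $\mathrm{FPP}_\alpha(\lambda)$ is the renewal point process with i.i.d. waiting times distributed as $H_\alpha(\lambda)$, identified with its sequence of successive points. *)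

theory Defs
  imports
    "HOL-Probability.Probability"
    "HOL-Probability.Essential_Supremum"
    "HOL-Library.Landau_Symbols"
begin

definition mpt :: "'a measure \<Rightarrow> ('a \<Rightarrow> 'a) \<Rightarrow> bool" where
  "mpt M T \<longleftrightarrow> T \<in> measurable M M \<and> distr M M T = M"

text \<open>
  Elements of \<open>L\<^sup>1\<close> and \<open>L\<^sup>\<infinity>\<close> are represented by functions. The defining property of
  \<open>transfer M T f\<close> depends on \<open>f\<close> only up to null sets and, for \<open>\<sigma>\<close>-finite \<open>M\<close>, determines the
  result up to null sets.
\<close>

definition is_transfer :: "'a measure \<Rightarrow> ('a \<Rightarrow> 'a) \<Rightarrow> ('a \<Rightarrow> real) \<Rightarrow> ('a \<Rightarrow> real) \<Rightarrow> bool" where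
  "is_transfer M T f h \<longleftrightarrow> integrable M h \<and>
     (\<forall>g \<in> borel_measurable M. (\<exists>C. AE x in M. \<bar>g x\<bar> \<le> C) \<longrightarrow>
        (\<integral>x. f x * g (T x) \<partial>M) = (\<integral>x. h x * g x \<partial>M))"

definition transfer :: "'a measure \<Rightarrow> ('a \<Rightarrow> 'a) \<Rightarrow> ('a \<Rightarrow> real) \<Rightarrow> ('a \<Rightarrow> real)" where
  "transfer M T f = (SOME h. is_transfer M T f h)"

definition conservative_ergodic :: "'a measure \<Rightarrow> ('a \<Rightarrow> 'a) \<Rightarrow> bool" where
  "conservative_ergodic M T \<longleftrightarrow>
     (\<forall>u. integrable M u \<and> (AE x in M. 0 \<le> u x) \<and> 0 < (\<integral>x. u x \<partial>M) \<longrightarrow>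
        (AE x in M. (\<Sum>k. ennreal ((transfer M T ^^ k) u x)) = \<infinity>))"

definition pointwise_dual_ergodic :: "'a measure \<Rightarrow> ('a \<Rightarrow> 'a) \<Rightarrow> bool" where
  "pointwise_dual_ergodic M T \<longleftrightarrow>
     (\<exists>a :: nat \<Rightarrow> real. \<forall>u. integrable M u \<longrightarrow>
        (AE x in M. (\<lambda>n. (1 / a n) * (\<Sum>k<n. (transfer M T ^^ k) u x)) \<longlonglongrightarrow> (\<integral>y. u y \<partial>M)))"

text \<open>
  Convergence in \<open>L\<^sup>\<infinity>(\<mu>\<^sub>Y)\<close> only involves the null sets of \<open>\<mu>\<^sub>Y\<close>, so the normalisation by
  \<open>\<mu>(Y)\<close> is dropped and the essential supremum is taken over \<open>Y\<close> with respect to \<open>\<mu>\<close>.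
\<close>

definition uniform_set :: "'a measure \<Rightarrow> ('a \<Rightarrow> 'a) \<Rightarrow> (nat \<Rightarrow> real) \<Rightarrow> 'a set \<Rightarrow> bool" where
  "uniform_set M T a Y \<longleftrightarrow> Y \<in> sets M \<and> 0 < emeasure M Y \<and>
     (\<exists>f. integrable M f \<and> (AE x in M. 0 \<le> f x) \<and> 0 < (\<integral>x. f x \<partial>M) \<and>
        (\<lambda>n. esssup (restrict_space M Y)
               (\<lambda>x. ereal \<bar>(1 / a n) * (\<Sum>k<n. (transfer M T ^^ k) f x) - (\<integral>y. f y \<partial>M)\<bar>))
          \<longlonglongrightarrow> 0)"

definition floor_ext :: "(nat \<Rightarrow> real) \<Rightarrow> real \<Rightarrow> real" where
  "floor_ext a s = a (nat \<lfloor>s\<rfloor>)"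

definition regularly_varying :: "(nat \<Rightarrow> real) \<Rightarrow> real \<Rightarrow> bool" where
  "regularly_varying a \<alpha> \<longleftrightarrow>
     (\<forall>y>0. ((\<lambda>x. floor_ext a (x * y) / floor_ext a x) \<longlongrightarrow> y powr \<alpha>) at_top)"

definition asymptotic_inverse :: "(nat \<Rightarrow> real) \<Rightarrow> (real \<Rightarrow> real) \<Rightarrow> bool" where
  "asymptotic_inverse a b \<longleftrightarrow>
     (\<lambda>s. floor_ext a (b s)) \<sim>[at_top] (\<lambda>s. s) \<and> (\<lambda>s. b (floor_ext a s)) \<sim>[at_top] (\<lambda>s. s)"

definition scaling :: "(real \<Rightarrow> real) \<Rightarrow> real \<Rightarrow> real" where
  "scaling b s = 1 / b (1 / s)"

text \<open>
  The \<open>0\<close>-th return time is \<open>0\<close> by convention, so that the first one is at least \<open>1\<close>;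
  the infimum of the empty set is \<open>\<infinity>\<close>. The sequence \<open>return_seq\<close> starts with the first
  return time at index \<open>0\<close>.
\<close>

primrec return_time :: "('a \<Rightarrow> 'a) \<Rightarrow> 'a set \<Rightarrow> nat \<Rightarrow> 'a \<Rightarrow> enat" where
  "return_time T A 0 x = 0"
| "return_time T A (Suc k) x = Inf {enat n | n. return_time T A k x < enat n \<and> (T ^^ n) x \<in> A}"

definition return_seq :: "('a \<Rightarrow> 'a) \<Rightarrow> 'a set \<Rightarrow> 'a \<Rightarrow> (nat \<Rightarrow> ennreal)" where
  "return_seq T A x = (\<lambda>i. ennreal_of_enat (return_time T A (Suc i) x))"

definition scaled_seq :: "real \<Rightarrow> (nat \<Rightarrow> ennreal) \<Rightarrow> (nat \<Rightarrow> ennreal)" where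
  "scaled_seq c \<phi> = (\<lambda>i. ennreal c * \<phi> i)"

text \<open>The topology of \<^typ>\<open>nat \<Rightarrow> ennreal\<close> is the product topology.\<close>

definition process_law :: "(nat \<Rightarrow> ennreal) measure \<Rightarrow> bool" where
  "process_law P \<longleftrightarrow> prob_space P \<and> sets P = sets borel"

definition monotone_seqs :: "(nat \<Rightarrow> ennreal) set" where
  "monotone_seqs = {\<phi>. \<forall>i. \<phi> i \<le> \<phi> (Suc i)}"

definition monotone_process_law :: "(nat \<Rightarrow> ennreal) measure \<Rightarrow> bool" where
  "monotone_process_law P \<longleftrightarrow> process_law P \<and> (AE \<phi> in P. \<phi> \<in> monotone_seqs)"

definition converges_in_law ::
  "(nat \<Rightarrow> 'a measure) \<Rightarrow> (nat \<Rightarrow> 'a \<Rightarrow> 'b::topological_space) \<Rightarrow> 'b measure \<Rightarrow> bool" where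
  "converges_in_law N X P \<longleftrightarrow>
     (\<forall>f :: 'b \<Rightarrow> real. continuous_on UNIV f \<and> bounded (range f) \<longrightarrow>
        (\<lambda>n. \<integral>x. f (X n x) \<partial>N n) \<longlonglongrightarrow> (\<integral>y. f y \<partial>P))"

definition fidi_cdf :: "(nat \<Rightarrow> ennreal) measure \<Rightarrow> nat \<Rightarrow> (nat \<Rightarrow> real) \<Rightarrow> real" where
  "fidi_cdf P d t = measure P {\<phi> \<in> space P. \<forall>i<d. \<phi> i \<le> ennreal (t i)}"

text \<open>
  The relation between the hitting law \<open>P\<close> and the return law \<open>Q\<close>. The first argument
  \<open>t 0 - t 0 + x\<close> in the second term is \<open>x\<close>; for \<open>d = 1\<close> the first term is \<open>1\<close> when \<open>Q\<close> is a
  probability law.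
\<close>

definition hitting_return_relation ::
  "real \<Rightarrow> (nat \<Rightarrow> ennreal) measure \<Rightarrow> (nat \<Rightarrow> ennreal) measure \<Rightarrow> bool" where
  "hitting_return_relation \<alpha> P Q \<longleftrightarrow>
     (\<forall>d\<ge>1. \<forall>t :: nat \<Rightarrow> real. 0 \<le> t 0 \<and> (\<forall>i. Suc i < d \<longrightarrow> t i \<le> t (Suc i)) \<longrightarrow>
        fidi_cdf P d t =
          \<alpha> * (LINT x:{0..t 0}|lborel.
                 (fidi_cdf Q (d - 1) (\<lambda>i. t (Suc i) - t 0 + x)
                  - fidi_cdf Q d (\<lambda>i. t i - t 0 + x)) * (t 0 - x) powr (\<alpha> - 1)))"

definition is_waiting_law :: "real \<Rightarrow> real \<Rightarrow> real measure \<Rightarrow> bool" where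
  "is_waiting_law \<alpha> l H \<longleftrightarrow> prob_space H \<and> sets H = sets borel \<and> (AE x in H. 0 \<le> x) \<and>
     (\<forall>s\<ge>0. (\<integral>x. exp (- s * x) \<partial>H) = l / (l + s powr \<alpha>))"

definition waiting_law :: "real \<Rightarrow> real \<Rightarrow> real measure" where
  "waiting_law \<alpha> l = (THE H. is_waiting_law \<alpha> l H)"

definition FPP_law :: "real \<Rightarrow> real \<Rightarrow> (nat \<Rightarrow> ennreal) measure" where
  "FPP_law \<alpha> l =
     distr (\<Pi>\<^sub>M k\<in>(UNIV :: nat set). waiting_law \<alpha> l) borel (\<lambda>\<omega> i. \<Sum>k\<le>i. ennreal (\<omega> k))"

end

theory Submission
  imports Defs
begin

text \<open>
  The whole argument takes place on the level of one family of continuous functionals on point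
  sequences. For \<open>\<delta> 0 = 0 \<le> \<delta> 1 \<le> \<dots>\<close> let \<open>excess d \<delta> \<phi>\<close> be the maximum of the positive parts of
  \<open>\<phi> i - \<delta> i\<close> over \<open>i < d\<close>. It is at most \<open>t\<close> exactly when \<open>\<phi> i \<le> t + \<delta> i\<close> for all \<open>i < d\<close>, so the
  finite-dimensional distribution function along the line \<open>t + \<delta>\<close> is the distribution function of
  one random variable, and the expectation of \<open>exp (- s * excess d \<delta> \<phi>)\<close> is \<open>s\<close> times its Laplace
  transform in \<open>t\<close>. Since the right-hand side of the relation between hitting and return laws is a
  convolution with \<open>\<alpha> * u powr (\<alpha> - 1)\<close> along the same line, the relation is equivalent to
  \<^item> \<open>E\<^sub>P (d + 1, \<delta>, s) = \<Gamma>(1 + \<alpha>) * s powr (- \<alpha>) * (E\<^sub>Q (d, \<delta> \<circ> Suc, s) - E\<^sub>Q (d + 1, \<delta>, s))\<close>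

  for the expectations \<open>E\<close> of these functionals
  (\<open>hitting_return_relation_iff_laplace\<close>). In this form both uniqueness statements and the
  uniqueness of the fixed point are inductions on \<open>d\<close>, because the expectations determine the law of
  a nondecreasing sequence (\<open>monotone_law_eq_by_induction\<close>). The fractional Poisson process is a
  fixed point because its first waiting time contributes the independent factor
  \<open>l / (l + s powr \<alpha>)\<close>, with \<open>l = \<Gamma>(1 + \<alpha>)\<close>, to the expectation (\<open>FPP_unique_fixed_point\<close>).

  The dynamics enter through a single step of the orbit. Passing from \<open>x\<close> to \<open>T x\<close> either shifts all
  return times by one or removes the first of them, and in both cases the functional is
  multiplied by \<open>exp (- s * c)\<close>, where \<open>c\<close> is the scaling. Iterating this and moving \<open>T\<close> to the
  transfer operator expresses the hitting functional as an integral over \<open>B n\<close> of the return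
  functionals against the Abel sum of the iterates of the uniform density (\<open>renewal_identity\<close>). By
  uniformity and regular variation this Abel sum, multiplied by the measure of \<open>B n\<close>, tends
  uniformly on \<open>Y\<close> to the constant \<open>\<Gamma>(1 + \<alpha>) * s powr (- \<alpha>)\<close> times the integral of that density
  (\<open>abelian_limit\<close>, \<open>hitting_integral_estimate\<close>). Hence limits of the hitting and return laws
  along a common subsequence are related.

  Subsequential limits always exist because the sequence space is compact
  (\<open>process_law_compactness\<close>), and the uniqueness statements upgrade subsequences to the whole
  sequence. Finally, the limit under the uniform density is the limit under every absolutely
  continuous initial law: a filling scheme moves one initial density to another along the orbits
  of a conservative ergodic map, and the hitting functionals are asymptotically invariant
  (\<open>asymptotically_invariant_integral\<close>).
\<close>

section \<open>Laplace functionals of point sequences\<close>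

text \<open>
  The Laplace kernel on \<open>[0, \<infinity>]\<close>; for \<open>s > 0\<close> the value at \<open>\<top>\<close> makes it continuous.
\<close>
definition lap :: "real \<Rightarrow> ennreal \<Rightarrow> real" where
  "lap s x = (if x = \<top> then 0 else exp (- s * enn2real x))"

text \<open>
  The truncated subtraction on \<open>ennreal\<close> takes the positive part, and the empty supremum is \<open>0\<close>, so
  that \<open>excess 0 \<delta> = 0\<close>.
\<close>
definition excess :: "nat \<Rightarrow> (nat \<Rightarrow> real) \<Rightarrow> (nat \<Rightarrow> ennreal) \<Rightarrow> ennreal" where
  "excess d \<delta> \<phi> = (SUP i\<in>{..<d}. \<phi> i - ennreal (\<delta> i))"

lemma lap_ennreal: "t \<ge> 0 \<Longrightarrow> lap s (ennreal t) = exp (- s * t)"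
  by (simp add: lap_def)

lemma lap_top [simp]: "lap s \<top> = 0"
  by (simp add: lap_def)

lemma lap_0 [simp]: "lap s 0 = 1"
  by (simp add: lap_def)

lemma lap_nonneg [simp]: "0 \<le> lap s x"
  by (simp add: lap_def)

lemma lap_le_1 [simp]: "0 \<le> s \<Longrightarrow> lap s x \<le> 1"
  by (simp add: lap_def)

lemma lap_antimono: "0 \<le> s \<Longrightarrow> x \<le> y \<Longrightarrow> lap s y \<le> lap s x"
  by (auto simp: lap_def top_unique intro!: mult_left_mono enn2real_mono simp: less_top)

lemma lap_add: "lap s (x + y) = lap s x * lap s y"
  by (cases x; cases y)
     (auto simp: lap_def exp_add [symmetric] algebra_simps simp flip: ennreal_plus)

lemma lap_ennreal_add: "t \<ge> 0 \<Longrightarrow> lap s (ennreal t + x) = exp (- s * t) * lap s x"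
  by (simp add: lap_add lap_ennreal)

lemma continuous_on_lap:
  assumes s: "s > 0"
  shows "continuous_on UNIV (lap s)"
proof -
  have "(lap s \<longlongrightarrow> lap s x) (at x)" for x
  proof (cases "x = \<top>")
    case True
    show ?thesis unfolding True lap_top
    proof (rule order_tendstoI)
      fix e :: real assume "e < 0"
      then show "eventually (\<lambda>y. e < lap s y) (at \<top>)"
        by (intro always_eventually allI) (metis lap_nonneg less_le_trans)
    next
      fix e :: real assume e: "0 < e"
      define K where "K = max 0 (- ln e / s) + 1"
      have K: "K \<ge> 0" "- ln e / s < K" by (auto simp: K_def)
      have "- s * K < ln e" using K(2) s by (simp add: field_simps)
      then have Ke: "exp (- s * K) < e" using e by (metis exp_less_mono exp_ln)
      have "eventually (\<lambda>y. ennreal K < y) (at \<top>)"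
        by (rule order_tendstoD(1)[OF tendsto_ident_at]) simp
      then show "eventually (\<lambda>y. lap s y < e) (at \<top>)"
      proof eventually_elim
        case (elim y)
        have "lap s y \<le> lap s (ennreal K)" using s elim by (intro lap_antimono) auto
        with Ke K show ?case by (simp add: lap_ennreal)
      qed
    qed
  next
    case False
    then obtain l where l: "x = ennreal l" "l \<ge> 0" by (cases x) auto
    have "((\<lambda>y. y) \<longlongrightarrow> ennreal l) (at x)" by (simp add: l)
    from tendsto_enn2real[OF this l(2)] have "(enn2real \<longlongrightarrow> l) (at x)" .
    then have "((\<lambda>y. exp (- s * enn2real y)) \<longlongrightarrow> exp (- s * l)) (at x)"
      by (intro tendsto_exp tendsto_mult tendsto_const)
    moreover have "eventually (\<lambda>y. y < \<top>) (at x)"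
      by (rule order_tendstoD(2)[OF tendsto_ident_at]) (simp add: l)
    then have "eventually (\<lambda>y. exp (- s * enn2real y) = lap s y) (at x)"
      by eventually_elim (auto simp: lap_def)
    ultimately show ?thesis
      using Lim_transform_eventually l by (fastforce simp: lap_ennreal)
  qed
  then show ?thesis by (simp add: continuous_on_def)
qed

lemma borel_measurable_lap [measurable]: "s > 0 \<Longrightarrow> lap s \<in> borel_measurable borel"
  by (rule borel_measurable_continuous_onI[OF continuous_on_lap])

lemma excess_0 [simp]: "excess 0 \<delta> \<phi> = 0"
  by (simp add: excess_def bot_ennreal)

lemma excess_Suc: "excess (Suc d) \<delta> \<phi> = sup (\<phi> d - ennreal (\<delta> d)) (excess d \<delta> \<phi>)"
  by (simp add: excess_def lessThan_Suc)

lemma continuous_on_coordinate: "continuous_on UNIV (\<lambda>\<phi>::nat \<Rightarrow> ennreal. \<phi> i)"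
  by (rule continuous_on_product_coordinates)

lemma continuous_on_minus_ennreal: "continuous_on UNIV (\<lambda>x::ennreal. x - ennreal c)"
proof -
  have "((\<lambda>x. x - ennreal c) \<longlongrightarrow> x - ennreal c) (at x)" for x
  proof (cases "x = \<top>")
    case False
    then show ?thesis by (intro tendsto_diff_ennreal tendsto_ident_at tendsto_const) auto
  next
    case True
    show ?thesis unfolding True ennreal_top_minus
    proof (rule order_tendstoI)
      fix a :: ennreal assume a: "a < \<top>"
      then have "a + ennreal c < \<top>" by simp
      from order_tendstoD(1)[OF tendsto_ident_at this]
      show "eventually (\<lambda>y. a < y - ennreal c) (at \<top>)"
        by eventually_elim
          (metis add.commute ennreal_minus_le_iff ennreal_neq_top leD not_le_imp_less)
    qed auto
  qed
  then show ?thesis by (simp add: continuous_on_def)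
qed

lemma continuous_on_excess: "continuous_on UNIV (excess d \<delta>)"
proof (induction d)
  case 0
  have "excess 0 \<delta> = (\<lambda>_. 0)" by auto
  then show ?case by simp
next
  case (Suc d)
  have "excess (Suc d) \<delta> = (\<lambda>\<phi>. max (\<phi> d - ennreal (\<delta> d)) (excess d \<delta> \<phi>))"
    by (auto simp: excess_Suc sup_max)
  moreover have "continuous_on UNIV (\<lambda>\<phi>::nat \<Rightarrow> ennreal. \<phi> d - ennreal (\<delta> d))"
    by (rule continuous_on_compose2[OF continuous_on_minus_ennreal continuous_on_coordinate]) auto
  ultimately show ?case using Suc by (simp add: continuous_on_max)
qed

lemma borel_measurable_excess [measurable]: "excess d \<delta> \<in> borel_measurable borel"
  by (rule borel_measurable_continuous_onI[OF continuous_on_excess])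

lemma continuous_on_lap_excess: "s > 0 \<Longrightarrow> continuous_on UNIV (\<lambda>\<phi>. lap s (excess d \<delta> \<phi>))"
  by (rule continuous_on_compose2[OF continuous_on_lap continuous_on_excess]) auto

lemma excess_le_iff:
  assumes "0 \<le> t" "\<And>i. i < d \<Longrightarrow> 0 \<le> \<delta> i"
  shows "excess d \<delta> \<phi> \<le> ennreal t \<longleftrightarrow> (\<forall>i<d. \<phi> i \<le> ennreal (t + \<delta> i))"
proof -
  have "\<phi> i - ennreal (\<delta> i) \<le> ennreal t \<longleftrightarrow> \<phi> i \<le> ennreal (t + \<delta> i)" if "i < d" for i
    using assms that by (auto simp: ennreal_minus_le_iff ennreal_plus add.commute)
  then show ?thesis by (auto simp: excess_def SUP_le_iff)
qed

lemma fidi_cdf_eq_excess: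
  assumes "0 \<le> t" "\<And>i. i < d \<Longrightarrow> 0 \<le> \<delta> i"
  shows "fidi_cdf P d (\<lambda>i. t + \<delta> i) = measure P {\<phi> \<in> space P. excess d \<delta> \<phi> \<le> ennreal t}"
  unfolding fidi_cdf_def using assms by (simp add: excess_le_iff)

lemma ennreal_add_diff_eq_sup: "c \<noteq> \<top> \<Longrightarrow> c + (x - y) = sup (c + x - y) (c::ennreal)"
  by (cases c; cases x; cases y)
     (auto simp: sup_max max_def ennreal_minus top_add simp flip: ennreal_plus, auto simp: ennreal_neg top_unique)

lemma SUP_sup_const:
  fixes c :: "'b::complete_lattice"
  shows "I \<noteq> {} \<Longrightarrow> (SUP i\<in>I. sup (f i) c) = sup (SUP i\<in>I. f i) c"
  by (intro antisym SUP_least sup_least) (auto intro: SUP_upper2 le_supI1 SUP_upper)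

text \<open>
  A common delay \<open>c\<close> passes through the maximum of positive parts: the term with \<open>i = 0\<close> has
  \<open>\<delta> 0 = 0\<close>, so the maximum is at least \<open>c\<close> and the truncations at \<open>0\<close> and at \<open>c\<close> agree.
\<close>
lemma excess_shift:
  assumes "\<delta> 0 = 0"
  shows "excess (Suc d) \<delta> (\<lambda>i. c + \<phi> i) = c + excess (Suc d) \<delta> \<phi>"
proof (cases "c = \<top>")
  case True
  have "\<top> - ennreal (\<delta> 0) \<le> excess (Suc d) \<delta> (\<lambda>i. \<top> + \<phi> i)"
    unfolding excess_def by (rule SUP_upper2[of 0]) auto
  then show ?thesis by (simp add: True top_unique)
next
  case False
  have c0: "c \<le> excess (Suc d) \<delta> (\<lambda>i. c + \<phi> i)"
    unfolding excess_def by (rule SUP_upper2[of 0]) (auto simp: assms)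
  have "c + excess (Suc d) \<delta> \<phi> = (SUP i\<in>{..<Suc d}. c + (\<phi> i - ennreal (\<delta> i)))"
    unfolding excess_def by (rule ennreal_SUP_add_right) auto
  also have "\<dots> = sup (SUP i\<in>{..<Suc d}. c + \<phi> i - ennreal (\<delta> i)) c"
    by (subst ennreal_add_diff_eq_sup[OF False], rule SUP_sup_const) (auto simp: lessThan_Suc)
  also have "\<dots> = excess (Suc d) \<delta> (\<lambda>i. c + \<phi> i)"
    using c0 by (simp add: excess_def sup_absorb1)
  finally show ?thesis by simp
qed

text \<open>
  A sequence that starts at time \<open>c\<close> and then renews. The first point contributes exactly \<open>c\<close>, which
  is also the value below which the later terms are truncated after the shift.
\<close>
lemma excess_case_nat:
  assumes "\<delta> 0 = 0"
  shows "excess (Suc d) \<delta> (case_nat c (\<lambda>i. c + \<phi> i)) = c + excess d (\<lambda>i. \<delta> (Suc i)) \<phi>"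
proof (cases "c = \<top>")
  case True
  have "\<top> - ennreal (\<delta> 0) \<le> excess (Suc d) \<delta> (case_nat \<top> (\<lambda>i. \<top> + \<phi> i))"
    unfolding excess_def by (rule SUP_upper2[of 0]) auto
  then show ?thesis by (simp add: True top_unique)
next
  case False
  have e: "excess (Suc d) \<delta> (case_nat c (\<lambda>i. c + \<phi> i))
      = sup c (SUP i\<in>{..<d}. c + \<phi> i - ennreal (\<delta> (Suc i)))"
    by (simp add: excess_def lessThan_Suc_eq_insert_0 image_image assms)
  show ?thesis
  proof (cases "d = 0")
    case True then show ?thesis using e by (simp add: bot_ennreal sup_absorb1)
  next
    case d: False
    then have ne: "{..<d} \<noteq> {}" by auto
    have "c + excess d (\<lambda>i. \<delta> (Suc i)) \<phi> = (SUP i\<in>{..<d}. c + (\<phi> i - ennreal (\<delta> (Suc i))))"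
      unfolding excess_def by (rule ennreal_SUP_add_right[OF ne])
    also have "\<dots> = sup (SUP i\<in>{..<d}. c + \<phi> i - ennreal (\<delta> (Suc i))) c"
      by (subst ennreal_add_diff_eq_sup[OF False], rule SUP_sup_const[OF ne])
    finally show ?thesis using e by (simp add: sup_commute)
  qed
qed

section \<open>Laplace transforms and distribution functions\<close>

lemma nn_integral_exp_tail:
  fixes z s :: real assumes "s > 0"
  shows "(\<integral>\<^sup>+t. ennreal (s * exp (- s * t)) * indicator {z..} t \<partial>lborel) = ennreal (exp (- s * z))"
proof -
  have "(\<integral>\<^sup>+t. ennreal (s * exp (- s * t)) * indicator {z..} t \<partial>lborel) = ennreal (0 - (- exp (- s * z)))"
  proof (rule nn_integral_FTC_atLeast)
    show "(\<lambda>x. s * exp (- s * x)) \<in> borel_measurable borel" by measurable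
    show "((\<lambda>x. - exp (- s * x)) has_real_derivative s * exp (- s * x)) (at x)" for x
      by (auto intro!: derivative_eq_intros)
    show "0 \<le> s * exp (- s * x)" for x using assms by simp
    have "((\<lambda>x. exp (- (s * x))) \<longlongrightarrow> 0) at_top"
      by (rule filterlim_compose[OF exp_at_bot])
         (use assms in \<open>simp add: filterlim_uminus_at_bot filterlim_ident filterlim_tendsto_pos_mult_at_top[OF tendsto_const]\<close>)
    from tendsto_minus[OF this] show "((\<lambda>x. - exp (- s * x)) \<longlongrightarrow> 0) at_top" by simp
  qed
  then show ?thesis by simp
qed

lemma lap_eq_nn_integral:
  assumes "s > 0"
  shows "ennreal (lap s z) =
    (\<integral>\<^sup>+t. ennreal (s * exp (- s * t)) * indicator {0..} t * indicator {t. z \<le> ennreal t} t \<partial>lborel)"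
proof (cases z)
  case (real r)
  have "(indicator {0..} t * indicator {t. z \<le> ennreal t} t :: ennreal) = indicator {r..} t" for t
    using real by (auto simp: indicator_def)
  then show ?thesis
    using real nn_integral_exp_tail[OF assms, of r] by (simp add: mult.assoc lap_ennreal)
next
  case top
  then show ?thesis by (simp add: top_unique)
qed

text \<open>
  Integrate \<open>exp (- s * z)\<close>, written as the integral of \<open>s * exp (- s * t)\<close> over \<open>t \<ge> z\<close>, and exchange
  the integrals.
\<close>
lemma laplace_of_distribution_function:
  assumes "prob_space N" and [measurable]: "Z \<in> borel_measurable N" and s: "s > 0"
  shows "ennreal (\<integral>x. lap s (Z x) \<partial>N) =
    (\<integral>\<^sup>+t. ennreal (s * exp (- s * t)) * indicator {0..} t *
        ennreal (measure N {x \<in> space N. Z x \<le> ennreal t}) \<partial>lborel)"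
proof -
  interpret prob_space N by fact
  interpret pair_sigma_finite N lborel ..
  note [measurable] = borel_measurable_lap[OF s]
  have [measurable]: "{w \<in> space (N \<Otimes>\<^sub>M lborel). Z (fst w) \<le> ennreal (snd w)} \<in> sets (N \<Otimes>\<^sub>M lborel)"
    by measurable
  have i: "indicator {t. z \<le> ennreal t} t = (indicator {z. z \<le> ennreal t} z :: ennreal)" for z t
    by (simp add: indicator_def)
  have "ennreal (\<integral>x. lap s (Z x) \<partial>N) = (\<integral>\<^sup>+x. ennreal (lap s (Z x)) \<partial>N)"
    by (rule nn_integral_eq_integral[symmetric])
       (auto intro!: integrable_const_bound[where B=1] simp: s less_imp_le)
  also have "\<dots> = (\<integral>\<^sup>+x. \<integral>\<^sup>+t. ennreal (s * exp (- s * t)) * indicator {0..} t *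
      indicator {w \<in> space (N \<Otimes>\<^sub>M lborel). Z (fst w) \<le> ennreal (snd w)} (x, t) \<partial>lborel \<partial>N)"
    by (rule nn_integral_cong, subst lap_eq_nn_integral[OF s])
       (auto intro!: nn_integral_cong simp: indicator_def space_pair_measure)
  also have "\<dots> = (\<integral>\<^sup>+t. \<integral>\<^sup>+x. ennreal (s * exp (- s * t)) * indicator {0..} t *
      indicator {w \<in> space (N \<Otimes>\<^sub>M lborel). Z (fst w) \<le> ennreal (snd w)} (x, t) \<partial>N \<partial>lborel)"
    by (rule Fubini'[symmetric]) (unfold split_def prod.collapse, measurable)
  also have "\<dots> = (\<integral>\<^sup>+t. ennreal (s * exp (- s * t)) * indicator {0..} t *
        ennreal (measure N {x \<in> space N. Z x \<le> ennreal t}) \<partial>lborel)"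
  proof (rule nn_integral_cong)
    fix t :: real
    have "(\<integral>\<^sup>+x. ennreal (s * exp (- s * t)) * indicator {0..} t *
      indicator {w \<in> space (N \<Otimes>\<^sub>M lborel). Z (fst w) \<le> ennreal (snd w)} (x, t) \<partial>N)
      = (\<integral>\<^sup>+x. ennreal (s * exp (- s * t)) * indicator {0..} t *
      indicator {x \<in> space N. Z x \<le> ennreal t} x \<partial>N)"
      by (auto intro!: nn_integral_cong simp: indicator_def space_pair_measure)
    also have "\<dots> = ennreal (s * exp (- s * t)) * indicator {0..} t * emeasure N {x \<in> space N. Z x \<le> ennreal t}"
      by (rule nn_integral_cmult_indicator) measurable
    finally show "(\<integral>\<^sup>+x. ennreal (s * exp (- s * t)) * indicator {0..} t *
      indicator {w \<in> space (N \<Otimes>\<^sub>M lborel). Z (fst w) \<le> ennreal (snd w)} (x, t) \<partial>N)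
      = ennreal (s * exp (- s * t)) * indicator {0..} t * ennreal (measure N {x \<in> space N. Z x \<le> ennreal t})"
      by (simp add: emeasure_eq_measure)
  qed
  finally show ?thesis .
qed

text \<open>
  If the Laplace transform vanishes at all positive integers, then by Weierstrass approximation in
  the variable \<open>v = exp (- t)\<close> the function integrates to zero against every \<open>g (exp (- t)) * exp (- t)\<close>
  with continuous \<open>g\<close>. A positive value of \<open>h\<close> persists to the right of that point and contradicts
  this for a bump \<open>g\<close>.
\<close>
lemma laplace_unique_aux:
  fixes h :: "real \<Rightarrow> real"
  assumes [measurable]: "h \<in> borel_measurable borel"
    and right: "\<And>t. 0 \<le> t \<Longrightarrow> (h \<longlongrightarrow> h t) (at_right t)"
    and int: "integrable lborel (\<lambda>t. indicator {0..} t * exp (- t) * h t)"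
    and zero: "\<And>k::nat. 1 \<le> k \<Longrightarrow> (\<integral>t. indicator {0..} t * exp (- real k * t) * h t \<partial>lborel) = 0"
    and "0 \<le> t"
  shows "h t \<le> 0"
proof (rule ccontr)
  let ?w = "\<lambda>t. indicator {0..} t * exp (- t) * h t :: real"
  have bounded: "integrable lborel (\<lambda>t. g (exp (- t)) * ?w t)"
    if [measurable]: "g \<in> borel_measurable borel" and g: "\<And>v. 0 \<le> v \<Longrightarrow> v \<le> 1 \<Longrightarrow> \<bar>g v\<bar> \<le> C"
    for g :: "real \<Rightarrow> real" and C
  proof (rule Bochner_Integration.integrable_bound[of _ "\<lambda>t. C * ?w t"])
    show "integrable lborel (\<lambda>t. C * ?w t)" by (intro integrable_mult_right int)
    have "C \<ge> 0" using g[of 0] by auto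
    then show "AE t in lborel. norm (g (exp (- t)) * ?w t) \<le> norm (C * ?w t)"
      using g by (intro always_eventually allI) (auto simp: indicator_def abs_mult intro!: mult_right_mono)
  qed measurable
  have poly: "(\<integral>t. (\<Sum>i\<le>n. c i * exp (- t) ^ i) * ?w t \<partial>lborel) = 0" for c :: "nat \<Rightarrow> real" and n
  proof -
    have e: "exp (- real (Suc i) * t) = exp (- t) ^ i * exp (- t)" for i and t :: real
      by (simp add: exp_of_nat_mult [symmetric] exp_add [symmetric] algebra_simps)
    have pw: "c i * exp (- t) ^ i * ?w t = c i * (indicator {0..} t * exp (- real (Suc i) * t) * h t)" for i t
      unfolding e by (simp only: mult_ac)
    have "(\<integral>t. (\<Sum>i\<le>n. c i * exp (- t) ^ i) * ?w t \<partial>lborel)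
      = (\<integral>t. (\<Sum>i\<le>n. c i * (indicator {0..} t * exp (- real (Suc i) * t) * h t)) \<partial>lborel)"
      by (simp only: sum_distrib_right pw)
    also have "\<dots> = (\<Sum>i\<le>n. (\<integral>t. c i * (indicator {0..} t * exp (- real (Suc i) * t) * h t) \<partial>lborel))"
    proof (rule Bochner_Integration.integral_sum)
      fix i
      have "integrable lborel (\<lambda>t. c i * ((\<lambda>v. v ^ i) (exp (- t)) * ?w t))"
        by (intro integrable_mult_right bounded[where C=1]) (auto simp: power_le_one)
      also have "(\<lambda>t. c i * ((\<lambda>v. v ^ i) (exp (- t)) * ?w t))
          = (\<lambda>t. c i * (indicator {0..} t * exp (- real (Suc i) * t) * h t))"
        unfolding e by (simp only: mult_ac)
      finally show "integrable lborel (\<lambda>t. c i * (indicator {0..} t * exp (- real (Suc i) * t) * h t))" .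
    qed
    also have "\<dots> = (\<Sum>i\<le>n. c i * 0)"
      by (intro sum.cong refl, subst integral_mult_right_zero, subst zero) auto
    also have "\<dots> = 0" by simp
    finally show ?thesis .
  qed
  have cont: "(\<integral>t. g (exp (- t)) * ?w t \<partial>lborel) = 0" if g: "continuous_on UNIV g" for g :: "real \<Rightarrow> real"
  proof -
    have [measurable]: "g \<in> borel_measurable borel" by (rule borel_measurable_continuous_onI[OF g])
    have c01: "continuous_on {0..1} g" by (rule continuous_on_subset[OF g]) auto
    have "bounded (g ` {0..1})" using c01 by (intro compact_imp_bounded compact_continuous_image) auto
    then obtain C where "\<forall>y\<in>g ` {0..1}. norm y \<le> C" unfolding bounded_iff by blast
    then have C: "\<And>v. 0 \<le> v \<Longrightarrow> v \<le> 1 \<Longrightarrow> \<bar>g v\<bar> \<le> C" by auto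
    let ?I = "\<integral>t. \<bar>?w t\<bar> \<partial>lborel"
    have I: "0 \<le> ?I" by simp
    have bd: "\<bar>\<integral>t. g (exp (- t)) * ?w t \<partial>lborel\<bar> \<le> e * ?I" if e: "e > 0" for e
    proof -
      obtain p where p: "real_polynomial_function p" "\<And>v. v \<in> {0..1} \<Longrightarrow> \<bar>g v - p v\<bar> < e"
        using Stone_Weierstrass_real_polynomial_function[OF _ c01 e] by auto
      obtain c n where pc: "p = (\<lambda>x. \<Sum>i\<le>n. c i * x^i)" using p(1) real_polynomial_function_iff_sum by auto
      have [measurable]: "p \<in> borel_measurable borel" unfolding pc by measurable
      have gp: "integrable lborel (\<lambda>t. (g (exp (- t)) - p (exp (- t))) * ?w t)"
        by (rule bounded[of "\<lambda>v. g v - p v" e]) (use p(2) in \<open>auto intro: less_imp_le\<close>)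
      have g1: "integrable lborel (\<lambda>t. g (exp (- t)) * ?w t)"
        by (rule bounded[of g C]) (use C in auto)
      have p1: "integrable lborel (\<lambda>t. p (exp (- t)) * ?w t)"
        using Bochner_Integration.integrable_diff[OF g1 gp] by (simp add: algebra_simps)
      have "(\<integral>t. g (exp (- t)) * ?w t \<partial>lborel) =
          (\<integral>t. (g (exp (- t)) - p (exp (- t))) * ?w t \<partial>lborel) + (\<integral>t. p (exp (- t)) * ?w t \<partial>lborel)"
        by (subst Bochner_Integration.integral_add[OF gp p1, symmetric]) (simp add: algebra_simps)
      also have "(\<integral>t. p (exp (- t)) * ?w t \<partial>lborel) = 0" unfolding pc by (rule poly)
      finally have "\<bar>\<integral>t. g (exp (- t)) * ?w t \<partial>lborel\<bar>
          = \<bar>\<integral>t. (g (exp (- t)) - p (exp (- t))) * ?w t \<partial>lborel\<bar>" by simp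
      also have "\<dots> \<le> (\<integral>t. \<bar>(g (exp (- t)) - p (exp (- t))) * ?w t\<bar> \<partial>lborel)"
        by (rule integral_abs_bound)
      also have "\<dots> \<le> (\<integral>t. e * \<bar>?w t\<bar> \<partial>lborel)"
      proof (rule integral_mono)
        fix t
        show "\<bar>(g (exp (- t)) - p (exp (- t))) * ?w t\<bar> \<le> e * \<bar>?w t\<bar>"
          using p(2)[of "exp (- t)"] by (auto simp: abs_mult indicator_def intro!: mult_right_mono)
      qed (use gp int in auto)
      finally show ?thesis by simp
    qed
    have "(\<lambda>n. inverse (real (Suc n)) * ?I) \<longlonglongrightarrow> 0 * ?I"
      by (intro tendsto_mult LIMSEQ_inverse_real_of_nat tendsto_const)
    then have "\<bar>\<integral>t. g (exp (- t)) * ?w t \<partial>lborel\<bar> \<le> 0 * ?I"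
      by (rule LIMSEQ_le_const) (intro exI[of _ 0] allI impI bd, simp)
    then show ?thesis by simp
  qed
  assume "\<not> h t \<le> 0"
  then have "h t > 0" by simp
  then have "eventually (\<lambda>u. h u > 0) (at_right t)"
    using order_tendstoD(1)[OF right[OF \<open>0 \<le> t\<close>]] by blast
  then obtain b where b: "b > t" "\<And>u. t < u \<Longrightarrow> u < b \<Longrightarrow> h u > 0"
    unfolding eventually_at_right_field by auto
  \<comment> \<open>A bump in the variable v = exp (- t), positive exactly on the image of the
    interval from t to b.\<close>
  define g where "g v = max 0 ((v - exp (- b)) * (exp (- t) - v))" for v :: real
  have "continuous_on UNIV g" unfolding g_def by (intro continuous_intros)
  from cont[OF this] have i0: "(\<integral>u. g (exp (- u)) * ?w u \<partial>lborel) = 0" .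
  have [measurable]: "g \<in> borel_measurable borel" unfolding g_def by measurable
  have gpos: "g (exp (- u)) > 0" if "t < u" "u < b" for u
    using that by (simp add: g_def)
  have gzero: "g (exp (- u)) = 0" if "\<not> (t < u \<and> u < b)" for u
  proof -
    have "u \<le> t \<or> b \<le> u" using that by auto
    then have "(exp (- u) - exp (- b)) * (exp (- t) - exp (- u)) \<le> 0"
    proof
      assume "u \<le> t"
      then show ?thesis using b(1) by (intro mult_nonneg_nonpos) auto
    next
      assume "b \<le> u"
      then show ?thesis using b(1) by (intro mult_nonpos_nonneg) auto
    qed
    then show ?thesis by (simp add: g_def)
  qed
  have nn: "0 \<le> g (exp (- u)) * ?w u" for u
    using gpos gzero b(2) \<open>0 \<le> t\<close> by (cases "t < u \<and> u < b") (auto simp: indicator_def less_imp_le)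
  have "continuous_on {0..1} g" unfolding g_def by (intro continuous_intros)
  then have "bounded (g ` {0..1})" by (intro compact_imp_bounded compact_continuous_image) auto
  then obtain C where "\<forall>y\<in>g ` {0..1}. norm y \<le> C" unfolding bounded_iff by blast
  then have C: "\<And>v. 0 \<le> v \<Longrightarrow> v \<le> 1 \<Longrightarrow> \<bar>g v\<bar> \<le> C" by auto
  have "integrable lborel (\<lambda>u. g (exp (- u)) * ?w u)"
    by (rule bounded[of g C]) (use C in auto)
  then have "AE u in lborel. g (exp (- u)) * ?w u = 0"
    using integral_nonneg_eq_0_iff_AE[of lborel "\<lambda>u. g (exp (- u)) * ?w u"] nn i0 by auto
  then have "AE u in lborel. u \<notin> {t<..<b}"
  proof eventually_elim
    case (elim u)
    show ?case
    proof
      assume u: "u \<in> {t<..<b}"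
      then have "0 < g (exp (- u))" "0 < h u" "0 \<le> u" using gpos[of u] b(2)[of u] \<open>0 \<le> t\<close> by auto
      with elim show False by simp
    qed
  qed
  moreover have "{u \<in> space lborel. \<not> u \<notin> {t<..<b}} = {t<..<b}" by auto
  ultimately have "emeasure lborel {t<..<b} = 0"
    by (subst (asm) AE_iff_measurable[where N="{t<..<b}"]) auto
  with b(1) show False by simp
qed

lemma laplace_unique:
  fixes F G :: "real \<Rightarrow> real"
  assumes [measurable]: "F \<in> borel_measurable borel" "G \<in> borel_measurable borel"
    and nonneg: "\<And>t. 0 \<le> t \<Longrightarrow> 0 \<le> F t" "\<And>t. 0 \<le> t \<Longrightarrow> 0 \<le> G t"
    and right: "\<And>t. 0 \<le> t \<Longrightarrow> (F \<longlongrightarrow> F t) (at_right t)" "\<And>t. 0 \<le> t \<Longrightarrow> (G \<longlongrightarrow> G t) (at_right t)"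
    and eq: "\<And>k::nat. 1 \<le> k \<Longrightarrow>
        (\<integral>\<^sup>+t. ennreal (real k * exp (- real k * t)) * indicator {0..} t * ennreal (F t) \<partial>lborel) =
        (\<integral>\<^sup>+t. ennreal (real k * exp (- real k * t)) * indicator {0..} t * ennreal (G t) \<partial>lborel)"
    and fin: "(\<integral>\<^sup>+t. ennreal (exp (- t)) * indicator {0..} t * ennreal (F t) \<partial>lborel) < \<infinity>"
    and t: "0 \<le> t"
  shows "F t = G t"
proof -
  have conv: "(\<integral>\<^sup>+t. ennreal (real k * exp (- real k * t)) * indicator {0..} t * ennreal (H t) \<partial>lborel)
      = ennreal (real k) * (\<integral>\<^sup>+t. ennreal (indicator {0..} t * exp (- real k * t) * H t) \<partial>lborel)"
    if "H \<in> borel_measurable borel" and "\<And>t. 0 \<le> t \<Longrightarrow> 0 \<le> H t" for H and k :: nat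
  proof -
    note [measurable] = that(1)
    have "ennreal (real k * exp (- real k * t)) * indicator {0..} t * ennreal (H t)
      = ennreal (real k) * ennreal (indicator {0..} t * exp (- real k * t) * H t)" for t
      using that(2)[of t] by (cases "0 \<le> t") (simp_all add: ennreal_mult mult.assoc)
    then show ?thesis by (simp only:) (rule nn_integral_cmult, measurable)
  qed
  have eq': "(\<integral>\<^sup>+t. ennreal (indicator {0..} t * exp (- real k * t) * F t) \<partial>lborel)
     = (\<integral>\<^sup>+t. ennreal (indicator {0..} t * exp (- real k * t) * G t) \<partial>lborel)" if "1 \<le> k" for k :: nat
  proof -
    have "ennreal (real k) * (\<integral>\<^sup>+t. ennreal (indicator {0..} t * exp (- real k * t) * F t) \<partial>lborel)
       = (\<integral>\<^sup>+t. ennreal (real k * exp (- real k * t)) * indicator {0..} t * ennreal (F t) \<partial>lborel)"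
      by (rule conv[symmetric]) (use assms(1) nonneg in auto)
    also have "\<dots> = (\<integral>\<^sup>+t. ennreal (real k * exp (- real k * t)) * indicator {0..} t * ennreal (G t) \<partial>lborel)"
      by (rule eq[OF that])
    also have "\<dots> = ennreal (real k) * (\<integral>\<^sup>+t. ennreal (indicator {0..} t * exp (- real k * t) * G t) \<partial>lborel)"
      by (rule conv) (use assms(2) nonneg in auto)
    finally show ?thesis using that by (simp add: ennreal_mult_cancel_left)
  qed
  have fin1: "(\<integral>\<^sup>+t. ennreal (indicator {0..} t * exp (- t) * F t) \<partial>lborel) < \<infinity>"
  proof -
    have "ennreal (indicator {0..} t * exp (- t) * F t) = ennreal (exp (- t)) * indicator {0..} t * ennreal (F t)" for t
      using nonneg(1)[of t] by (cases "0 \<le> t") (simp_all add: ennreal_mult)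
    then show ?thesis using fin by simp
  qed
  have intgr: "integrable lborel (\<lambda>t. indicator {0..} t * exp (- real k * t) * H t)"
    if k: "1 \<le> k" and H [measurable]: "H \<in> borel_measurable borel" and "\<And>t. 0 \<le> t \<Longrightarrow> 0 \<le> H t"
     and Hf: "(\<integral>\<^sup>+t. ennreal (indicator {0..} t * exp (- t) * H t) \<partial>lborel) < \<infinity>" for H and k :: nat
  proof (rule integrableI_nonneg)
    have "indicator {0..} t * exp (- real k * t) * H t \<le> indicator {0..} t * exp (- t) * H t" for t
    proof (cases "0 \<le> t")
      case True
      then have "1 * t \<le> real k * t" using k by (intro mult_right_mono) auto
      with True that(3)[OF True] show ?thesis by (simp add: mult_right_mono)
    qed simp
    then have "(\<integral>\<^sup>+t. ennreal (indicator {0..} t * exp (- real k * t) * H t) \<partial>lborel)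
      \<le> (\<integral>\<^sup>+t. ennreal (indicator {0..} t * exp (- t) * H t) \<partial>lborel)"
      by (intro nn_integral_mono ennreal_leI)
    then show "(\<integral>\<^sup>+t. ennreal (indicator {0..} t * exp (- real k * t) * H t) \<partial>lborel) < \<infinity>"
      using Hf by (rule le_less_trans)
    show "AE t in lborel. 0 \<le> indicator {0..} t * exp (- real k * t) * H t"
      using that(3) by (simp add: indicator_def)
  qed measurable
  have fin2: "(\<integral>\<^sup>+t. ennreal (indicator {0..} t * exp (- t) * G t) \<partial>lborel) < \<infinity>"
    using eq'[of 1] fin1 by simp
  have IF: "integrable lborel (\<lambda>t. indicator {0..} t * exp (- real k * t) * F t)" if "1 \<le> k" for k :: nat
    by (rule intgr[OF that]) (use nonneg fin1 in auto)
  have IG: "integrable lborel (\<lambda>t. indicator {0..} t * exp (- real k * t) * G t)" if "1 \<le> k" for k :: nat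
    by (rule intgr[OF that]) (use nonneg fin2 in auto)
  have FG: "(\<integral>t. indicator {0..} t * exp (- real k * t) * F t \<partial>lborel)
      = (\<integral>t. indicator {0..} t * exp (- real k * t) * G t \<partial>lborel)" if "1 \<le> k" for k :: nat
  proof -
    have "(\<integral>t. indicator {0..} t * exp (- real k * t) * F t \<partial>lborel)
        = enn2real (\<integral>\<^sup>+t. ennreal (indicator {0..} t * exp (- real k * t) * F t) \<partial>lborel)"
      by (rule integral_eq_nn_integral) (measurable, simp add: nonneg indicator_def)
    also have "\<dots> = enn2real (\<integral>\<^sup>+t. ennreal (indicator {0..} t * exp (- real k * t) * G t) \<partial>lborel)"
      by (simp only: eq'[OF that])
    also have "\<dots> = (\<integral>t. indicator {0..} t * exp (- real k * t) * G t \<partial>lborel)"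
      by (rule integral_eq_nn_integral[symmetric]) (measurable, simp add: nonneg indicator_def)
    finally show ?thesis .
  qed
  have "F t - G t \<le> 0"
  proof (rule laplace_unique_aux[where h = "\<lambda>t. F t - G t"])
    show "integrable lborel (\<lambda>t. indicator {0..} t * exp (- t) * (F t - G t))"
      using Bochner_Integration.integrable_diff[OF IF[of 1] IG[of 1]]
      by (simp add: right_diff_distrib)
    show "(\<integral>t. indicator {0..} t * exp (- real k * t) * (F t - G t) \<partial>lborel) = 0" if "1 \<le> k" for k :: nat
      using Bochner_Integration.integral_diff[OF IF[OF that] IG[OF that]] FG[OF that]
      by (simp add: right_diff_distrib)
    show "((\<lambda>t. F t - G t) \<longlongrightarrow> F u - G u) (at_right u)" if "0 \<le> u" for u
      using right that by (intro tendsto_diff) auto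
  qed (use t in auto)
  moreover have "G t - F t \<le> 0"
  proof (rule laplace_unique_aux[where h = "\<lambda>t. G t - F t"])
    show "integrable lborel (\<lambda>t. indicator {0..} t * exp (- t) * (G t - F t))"
      using Bochner_Integration.integrable_diff[OF IG[of 1] IF[of 1]]
      by (simp add: right_diff_distrib)
    show "(\<integral>t. indicator {0..} t * exp (- real k * t) * (G t - F t) \<partial>lborel) = 0" if "1 \<le> k" for k :: nat
      using Bochner_Integration.integral_diff[OF IG[OF that] IF[OF that]] FG[OF that]
      by (simp add: right_diff_distrib)
    show "((\<lambda>t. G t - F t) \<longlongrightarrow> G u - F u) (at_right u)" if "0 \<le> u" for u
      using right that by (intro tendsto_diff) auto
  qed (use t in auto)
  ultimately show ?thesis by simp
qed

lemma distribution_function_right_continuous: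
  assumes "prob_space N" and [measurable]: "Z \<in> borel_measurable N" and t: "0 \<le> t"
  shows "((\<lambda>t. measure N {x \<in> space N. Z x \<le> ennreal t}) \<longlongrightarrow> measure N {x \<in> space N. Z x \<le> ennreal t}) (at_right t)"
proof -
  interpret prob_space N by fact
  show ?thesis unfolding tendsto_at_iff_sequentially o_def
  proof (intro allI impI)
    fix X assume X: "\<forall>i. X i \<in> {t<..} - {t}" "X \<longlonglongrightarrow> t"
    have "(\<lambda>i. \<integral>x. indicator {x \<in> space N. Z x \<le> ennreal (X i)} x \<partial>N)
        \<longlonglongrightarrow> (\<integral>x. indicator {x \<in> space N. Z x \<le> ennreal t} x \<partial>N :: real)"
    proof (rule integral_dominated_convergence[where w="\<lambda>_. 1"])
      show "AE x in N. (\<lambda>i. indicator {x \<in> space N. Z x \<le> ennreal (X i)} x :: real)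
          \<longlonglongrightarrow> indicator {x \<in> space N. Z x \<le> ennreal t} x"
      proof (rule AE_I2)
        fix x assume x: "x \<in> space N"
        show "(\<lambda>i. indicator {x \<in> space N. Z x \<le> ennreal (X i)} x :: real)
          \<longlonglongrightarrow> indicator {x \<in> space N. Z x \<le> ennreal t} x"
        proof (cases "Z x \<le> ennreal t")
          case True
          then have "Z x \<le> ennreal (X i)" for i
            using X(1)[rule_format, of i] by (auto elim!: order_trans intro!: ennreal_leI)
          with True x show ?thesis by simp
        next
          case False
          have "(\<lambda>i. ennreal (X i)) \<longlonglongrightarrow> ennreal t" using X(2) by (rule tendsto_ennrealI)
          from order_tendstoD(2)[OF this, of "Z x"] False
          have "eventually (\<lambda>i. ennreal (X i) < Z x) sequentially" by auto
          then have "eventually (\<lambda>i. indicator {x \<in> space N. Z x \<le> ennreal (X i)} x = (0::real)) sequentially"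
            by eventually_elim (auto simp: not_le)
          then show ?thesis using False by (auto intro: tendsto_eventually)
        qed
      qed
    qed auto
    then show "(\<lambda>i. measure N {x \<in> space N. Z x \<le> ennreal (X i)}) \<longlonglongrightarrow> measure N {x \<in> space N. Z x \<le> ennreal t}"
      by (simp add: Collect_conj_eq)
  qed
qed

lemma borel_measurable_distribution_function:
  assumes "prob_space N" and [measurable]: "Z \<in> borel_measurable N"
  shows "(\<lambda>t. measure N {x \<in> space N. Z x \<le> ennreal t}) \<in> borel_measurable borel"
proof -
  interpret prob_space N by fact
  have "mono (\<lambda>t. measure N {x \<in> space N. Z x \<le> ennreal t})"
    by (intro monoI finite_measure_mono) (auto intro: order_trans ennreal_leI)
  then show ?thesis by (rule borel_measurable_mono)
qed

text \<open>
  The values of the Laplace transform at positive integers already determine the distribution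
  function on the half-line; an atom at infinity is allowed.
\<close>
lemma distribution_function_unique:
  assumes N: "prob_space N" and Z[measurable]: "Z \<in> borel_measurable N"
    and N': "prob_space N'" and Z'[measurable]: "Z' \<in> borel_measurable N'"
    and eq: "\<And>k::nat. 1 \<le> k \<Longrightarrow> (\<integral>x. lap (real k) (Z x) \<partial>N) = (\<integral>x. lap (real k) (Z' x) \<partial>N')"
    and t: "0 \<le> t"
  shows "measure N {x \<in> space N. Z x \<le> ennreal t} = measure N' {x \<in> space N'. Z' x \<le> ennreal t}"
proof (rule laplace_unique[where F = "\<lambda>t. measure N {x \<in> space N. Z x \<le> ennreal t}"
      and G = "\<lambda>t. measure N' {x \<in> space N'. Z' x \<le> ennreal t}"])
  show "(\<integral>\<^sup>+t. ennreal (exp (- t)) * indicator {0..} t *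
      ennreal (measure N {x \<in> space N. Z x \<le> ennreal t}) \<partial>lborel) < \<infinity>"
    using laplace_of_distribution_function[OF N Z, of 1, symmetric] by simp
  fix k :: nat assume k: "1 \<le> k"
  then have "real k > 0" by simp
  from laplace_of_distribution_function[OF N Z this] laplace_of_distribution_function[OF N' Z' this] eq[OF k]
  show "(\<integral>\<^sup>+t. ennreal (real k * exp (- real k * t)) * indicator {0..} t *
          ennreal (measure N {x \<in> space N. Z x \<le> ennreal t}) \<partial>lborel) =
        (\<integral>\<^sup>+t. ennreal (real k * exp (- real k * t)) * indicator {0..} t *
          ennreal (measure N' {x \<in> space N'. Z' x \<le> ennreal t}) \<partial>lborel)"
    by simp
qed (simp_all add: t distribution_function_right_continuous[OF N Z]
      distribution_function_right_continuous[OF N' Z']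
      borel_measurable_distribution_function[OF N Z] borel_measurable_distribution_function[OF N' Z'])

section \<open>The fractional integral\<close>

text \<open>
  Up to the factor \<open>\<Gamma>(1 + \<alpha>)\<close> this is the Riemann--Liouville integral of order \<open>\<alpha>\<close>, the operator on
  the right-hand side of the relation between hitting and return laws.
\<close>
definition fractional_integral :: "real \<Rightarrow> (real \<Rightarrow> real) \<Rightarrow> real \<Rightarrow> real" where
  "fractional_integral \<alpha> G t = \<alpha> * (LINT x:{0..t}|lborel. G x * (t - x) powr (\<alpha> - 1))"

lemma nn_integral_powr_kernel:
  assumes "0 < \<alpha>" "0 \<le> K"
  shows "(\<integral>\<^sup>+u. ennreal (indicator {0..K} u * u powr (\<alpha> - 1)) \<partial>lborel) = ennreal (K powr \<alpha> / \<alpha>)"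
  using nn_integral_has_integral_lebesgue[OF _ has_integral_powr_from_0[of "\<alpha> - 1" K]] assms by simp

lemma integrable_powr_kernel:
  assumes "0 < \<alpha>" "0 \<le> K"
  shows "integrable lborel (\<lambda>u. indicator {0..K} u * u powr (\<alpha> - 1) :: real)"
  by (rule integrableI_nonneg) (auto simp: nn_integral_powr_kernel assms)

lemma fractional_integral_reflect:
  "fractional_integral \<alpha> G t = \<alpha> * (\<integral>u. indicator {0..t} u * (G (t - u) * u powr (\<alpha> - 1)) \<partial>lborel)"
  unfolding fractional_integral_def set_lebesgue_integral_def
  by (subst lborel_integral_real_affine[where c="-1" and t=t])
     (auto simp: indicator_def intro!: Bochner_Integration.integral_cong)

text \<open>
  After the reflection \<open>u = t - x\<close> the singular factor no longer depends on \<open>t\<close> and serves as an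
  integrable bound, so right-continuity passes from \<open>G\<close> to its fractional integral.
\<close>
lemma fractional_integral_right_continuous:
  fixes G :: "real \<Rightarrow> real"
  assumes \<alpha>: "0 < \<alpha>" and [measurable]: "G \<in> borel_measurable borel"
    and bnd: "\<And>x. \<bar>G x\<bar> \<le> 1"
    and right: "\<And>t. 0 \<le> t \<Longrightarrow> (G \<longlongrightarrow> G t) (at_right t)"
    and t: "0 \<le> t"
  shows "(fractional_integral \<alpha> G \<longlongrightarrow> fractional_integral \<alpha> G t) (at_right t)"
  unfolding tendsto_at_iff_sequentially o_def
proof (intro allI impI)
  fix X assume X: "\<forall>i. X i \<in> {t<..} - {t}" "X \<longlonglongrightarrow> t"
  have "bounded (range X)" using X(2) by (intro convergent_imp_bounded) (auto simp: convergent_def)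
  then obtain K where "\<forall>y\<in>range X. norm y \<le> K" unfolding bounded_iff by blast
  then have K: "X i \<le> K" for i by (auto simp: abs_le_iff)
  have K0: "0 \<le> K" using K[of 0] X(1)[rule_format, of 0] t by auto
  have "(\<lambda>i. \<integral>u. indicator {0..X i} u * (G (X i - u) * u powr (\<alpha> - 1)) \<partial>lborel)
     \<longlonglongrightarrow> (\<integral>u. indicator {0..t} u * (G (t - u) * u powr (\<alpha> - 1)) \<partial>lborel)"
  proof (rule integral_dominated_convergence[where w="\<lambda>u. indicator {0..K} u * u powr (\<alpha> - 1)"])
    show "integrable lborel (\<lambda>u. indicator {0..K} u * u powr (\<alpha> - 1) :: real)"
      using \<alpha> K0 by (rule integrable_powr_kernel)
    show "AE u in lborel. norm (indicator {0..X i} u * (G (X i - u) * u powr (\<alpha> - 1)))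
        \<le> indicator {0..K} u * u powr (\<alpha> - 1)" for i
    proof (intro always_eventually allI)
      fix u
      have "\<bar>G (X i - u)\<bar> * u powr (\<alpha> - 1) \<le> 1 * u powr (\<alpha> - 1)" using bnd by (intro mult_right_mono) auto
      then show "norm (indicator {0..X i} u * (G (X i - u) * u powr (\<alpha> - 1)))
        \<le> indicator {0..K} u * u powr (\<alpha> - 1)"
        using K[of i] by (auto simp: indicator_def abs_mult)
    qed
    show "AE u in lborel. (\<lambda>i. indicator {0..X i} u * (G (X i - u) * u powr (\<alpha> - 1)))
        \<longlonglongrightarrow> indicator {0..t} u * (G (t - u) * u powr (\<alpha> - 1))"
    proof (intro always_eventually allI)
      fix u
      consider "u < 0" | "0 \<le> u" "u \<le> t" | "t < u" by linarith
      then show "(\<lambda>i. indicator {0..X i} u * (G (X i - u) * u powr (\<alpha> - 1)))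
        \<longlonglongrightarrow> indicator {0..t} u * (G (t - u) * u powr (\<alpha> - 1))"
      proof cases
        case 1 then show ?thesis by simp
      next
        case 2
        have "(\<lambda>i. X i - u) \<longlonglongrightarrow> t - u" using X(2) by (intro tendsto_diff tendsto_const)
        moreover have "\<forall>i. X i - u \<in> {t - u<..} - {t - u}" using X(1) by auto
        ultimately have "(\<lambda>i. G (X i - u)) \<longlonglongrightarrow> G (t - u)"
          using right[of "t - u", unfolded tendsto_at_iff_sequentially] 2 by (auto simp: o_def)
        then have "(\<lambda>i. G (X i - u) * u powr (\<alpha> - 1)) \<longlonglongrightarrow> G (t - u) * u powr (\<alpha> - 1)"
          by (intro tendsto_mult tendsto_const)
        moreover have "indicator {0..X i} u = (1::real)" for i
          using X(1)[rule_format, of i] 2 by (auto simp: indicator_def)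
        ultimately show ?thesis using 2 by simp
      next
        case 3
        from order_tendstoD(2)[OF X(2) this]
        have "eventually (\<lambda>i. indicator {0..X i} u * (G (X i - u) * u powr (\<alpha> - 1)) = 0) sequentially"
          by eventually_elim simp
        then show ?thesis using 3 by (auto intro: tendsto_eventually)
      qed
    qed
  qed measurable
  then show "(\<lambda>i. fractional_integral \<alpha> G (X i)) \<longlonglongrightarrow> fractional_integral \<alpha> G t"
    unfolding fractional_integral_reflect by (intro tendsto_mult tendsto_const)
qed

lemma ennreal_fractional_integral:
  assumes \<alpha>: "0 < \<alpha>" and [measurable]: "G \<in> borel_measurable borel"
    and bnd: "\<And>x. 0 \<le> G x" "\<And>x. G x \<le> 1"
  shows "0 \<le> fractional_integral \<alpha> G t"
    and "ennreal (fractional_integral \<alpha> G t) = (\<integral>\<^sup>+x. ennreal (\<alpha> * (indicator {0..t} x * (G x * (t - x) powr (\<alpha> - 1)))) \<partial>lborel)"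
proof -
  have i0: "integrable lborel (\<lambda>x. indicator {0..t} x * (t - x) powr (\<alpha> - 1) :: real)"
  proof (cases "0 \<le> t")
    case True
    from lborel_integrable_real_affine[OF integrable_powr_kernel[OF \<alpha> True], of "-1" t]
    show ?thesis by (rule Bochner_Integration.integrable_cong[THEN iffD1, rotated -1])
        (auto simp: indicator_def)
  next
    case False then show ?thesis by simp
  qed
  have i1: "integrable lborel (\<lambda>x. indicator {0..t} x * (G x * (t - x) powr (\<alpha> - 1)) :: real)"
  proof (rule Bochner_Integration.integrable_bound[OF i0])
    show "AE x in lborel. norm (indicator {0..t} x * (G x * (t - x) powr (\<alpha> - 1)))
        \<le> norm (indicator {0..t} x * (t - x) powr (\<alpha> - 1))"
    proof (intro always_eventually allI)
      fix x
      have "G x * (t - x) powr (\<alpha> - 1) \<le> 1 * (t - x) powr (\<alpha> - 1)" using bnd by (intro mult_right_mono) auto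
      then show "norm (indicator {0..t} x * (G x * (t - x) powr (\<alpha> - 1)))
        \<le> norm (indicator {0..t} x * (t - x) powr (\<alpha> - 1))"
        using bnd(1)[of x] by (auto simp: indicator_def abs_mult)
    qed
  qed measurable
  have "fractional_integral \<alpha> G t = (\<integral>x. \<alpha> * (indicator {0..t} x * (G x * (t - x) powr (\<alpha> - 1))) \<partial>lborel)"
    unfolding fractional_integral_def set_lebesgue_integral_def by simp
  moreover have nn: "0 \<le> \<alpha> * (indicator {0..t} x * (G x * (t - x) powr (\<alpha> - 1)))" for x
    using \<alpha> bnd by simp
  ultimately have e: "fractional_integral \<alpha> G t = (\<integral>x. \<alpha> * (indicator {0..t} x * (G x * (t - x) powr (\<alpha> - 1))) \<partial>lborel)"
    by simp
  show "0 \<le> fractional_integral \<alpha> G t" unfolding e using nn by (intro Bochner_Integration.integral_nonneg) auto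
  show "ennreal (fractional_integral \<alpha> G t) = (\<integral>\<^sup>+x. ennreal (\<alpha> * (indicator {0..t} x * (G x * (t - x) powr (\<alpha> - 1)))) \<partial>lborel)"
    unfolding e using i1 nn by (intro nn_integral_eq_integral[symmetric] integrable_mult_right) auto
qed

lemma laplace_powr_kernel:
  fixes s \<alpha> z :: real
  assumes \<alpha>: "0 < \<alpha>" and s: "0 < s"
  shows "(\<integral>\<^sup>+t. ennreal (indicator {z..} t * (exp (- s * t) * (\<alpha> * (t - z) powr (\<alpha> - 1)))) \<partial>lborel)
    = ennreal (Gamma (1 + \<alpha>) * s powr (- \<alpha>) * exp (- s * z))"
proof -
  have "(\<integral>\<^sup>+t. ennreal (indicator {z..} t * (exp (- s * t) * (\<alpha> * (t - z) powr (\<alpha> - 1)))) \<partial>lborel)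
    = ennreal (1 / s) * (\<integral>\<^sup>+v. ennreal (indicator {z..} (z + (1 / s) * v) *
        (exp (- s * (z + (1 / s) * v)) * (\<alpha> * (z + (1 / s) * v - z) powr (\<alpha> - 1)))) \<partial>lborel)"
    using s by (subst nn_integral_real_affine[where c="1 / s" and t=z]) auto
  also have "\<dots> = ennreal (1 / s) * (\<integral>\<^sup>+v. ennreal (exp (- s * z) * \<alpha> * s powr (1 - \<alpha>)) *
       ennreal (indicator {0..} v * v powr (\<alpha> - 1) / exp v) \<partial>lborel)"
  proof (intro arg_cong2[where f="(*)"] refl nn_integral_cong)
    fix v :: real
    show "ennreal (indicator {z..} (z + (1 / s) * v) *
        (exp (- s * (z + (1 / s) * v)) * (\<alpha> * (z + (1 / s) * v - z) powr (\<alpha> - 1))))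
      = ennreal (exp (- s * z) * \<alpha> * s powr (1 - \<alpha>)) * ennreal (indicator {0..} v * v powr (\<alpha> - 1) / exp v)"
    proof (cases "0 \<le> v")
      case False
      then have "indicator {z..} (z + (1 / s) * v) = (0::real)"
        using s by (simp add: indicator_def zero_le_divide_iff)
      with False show ?thesis by simp
    next
      case True
      have e: "exp (- s * (z + (1 / s) * v)) = exp (- s * z) * (1 / exp v)"
        using s by (simp add: exp_add [symmetric] exp_minus [symmetric] field_simps)
      have p: "(z + (1 / s) * v - z) powr (\<alpha> - 1) = s powr (1 - \<alpha>) * v powr (\<alpha> - 1)"
        using s True by (simp add: powr_divide powr_diff field_simps)
      show ?thesis using True s \<alpha> unfolding e p
        by (subst ennreal_mult[symmetric]) (auto simp: indicator_def mult_ac)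
    qed
  qed
  also have "\<dots> = ennreal (1 / s) * (ennreal (exp (- s * z) * \<alpha> * s powr (1 - \<alpha>)) * ennreal (Gamma \<alpha>))"
    by (subst nn_integral_cmult) (simp_all add: Gamma_conv_nn_integral_real[OF \<alpha>])
  also have "\<dots> = ennreal ((1 / s) * (exp (- s * z) * \<alpha> * s powr (1 - \<alpha>) * Gamma \<alpha>))"
    using s \<alpha> Gamma_real_pos[OF \<alpha>] by (simp add: ennreal_mult[symmetric] less_imp_le)
  also have "(1 / s) * (exp (- s * z) * \<alpha> * s powr (1 - \<alpha>) * Gamma \<alpha>)
      = Gamma (1 + \<alpha>) * s powr (- \<alpha>) * exp (- s * z)"
    using s \<alpha> Gamma_plus1[of \<alpha>] by (auto simp: powr_diff powr_minus add.commute field_simps nonpos_Ints_def)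
  finally show ?thesis .
qed

text \<open>
  The Laplace transform turns the convolution with \<open>\<alpha> * u powr (\<alpha> - 1)\<close> into multiplication by its
  transform \<open>\<Gamma>(1 + \<alpha>) * s powr (- \<alpha>)\<close>.
\<close>
lemma laplace_fractional_integral:
  assumes \<alpha>: "0 < \<alpha>" and s: "0 < s" and [measurable]: "G \<in> borel_measurable borel"
    and bnd: "\<And>x. 0 \<le> G x" "\<And>x. G x \<le> 1"
  shows "(\<integral>\<^sup>+t. ennreal (s * exp (- s * t)) * indicator {0..} t * ennreal (fractional_integral \<alpha> G t) \<partial>lborel)
    = ennreal (Gamma (1 + \<alpha>) * s powr (- \<alpha>)) *
      (\<integral>\<^sup>+x. ennreal (s * exp (- s * x)) * indicator {0..} x * ennreal (G x) \<partial>lborel)"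
proof -
  let ?h = "\<lambda>t x. ennreal (s * exp (- s * t) * (\<alpha> * (indicator {0..} x * indicator {x..} t * (G x * (t - x) powr (\<alpha> - 1)))))"
  have [measurable]: "(\<lambda>w::real \<times> real. indicator {fst w..} (snd w) :: real) \<in> borel_measurable (lborel \<Otimes>\<^sub>M lborel)"
    unfolding indicator_def atLeast_iff by measurable
  have "(\<integral>\<^sup>+t. ennreal (s * exp (- s * t)) * indicator {0..} t * ennreal (fractional_integral \<alpha> G t) \<partial>lborel)
     = (\<integral>\<^sup>+t. \<integral>\<^sup>+x. ?h t x \<partial>lborel \<partial>lborel)"
  proof (rule nn_integral_cong)
    fix t :: real
    have "ennreal (s * exp (- s * t)) * indicator {0..} t * ennreal (fractional_integral \<alpha> G t)
      = (\<integral>\<^sup>+x. ennreal (s * exp (- s * t)) * indicator {0..} t *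
           ennreal (\<alpha> * (indicator {0..t} x * (G x * (t - x) powr (\<alpha> - 1)))) \<partial>lborel)"
      unfolding ennreal_fractional_integral(2)[OF \<alpha> assms(3) bnd] by (rule nn_integral_cmult[symmetric]) measurable
    also have "\<dots> = (\<integral>\<^sup>+x. ?h t x \<partial>lborel)"
      using s \<alpha> bnd by (intro nn_integral_cong) (auto simp: indicator_def ennreal_mult[symmetric])
    finally show "ennreal (s * exp (- s * t)) * indicator {0..} t * ennreal (fractional_integral \<alpha> G t)
      = (\<integral>\<^sup>+x. ?h t x \<partial>lborel)" .
  qed
  also have "\<dots> = (\<integral>\<^sup>+x. \<integral>\<^sup>+t. ?h t x \<partial>lborel \<partial>lborel)"
    by (rule lborel_pair.Fubini') (unfold split_def, measurable)
  also have "\<dots> = (\<integral>\<^sup>+x. ennreal (Gamma (1 + \<alpha>) * s powr (- \<alpha>)) *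
       (ennreal (s * exp (- s * x)) * indicator {0..} x * ennreal (G x)) \<partial>lborel)"
  proof (rule nn_integral_cong)
    fix x :: real
    have G0: "0 < Gamma (1 + \<alpha>)" using \<alpha> by (intro Gamma_real_pos) simp
    have "(\<integral>\<^sup>+t. ?h t x \<partial>lborel) = (\<integral>\<^sup>+t. ennreal (s * indicator {0..} x * G x) *
        ennreal (indicator {x..} t * (exp (- s * t) * (\<alpha> * (t - x) powr (\<alpha> - 1)))) \<partial>lborel)"
      using s \<alpha> bnd by (intro nn_integral_cong) (auto simp: indicator_def ennreal_mult[symmetric] mult_ac)
    also have "\<dots> = ennreal (s * indicator {0..} x * G x) *
        ennreal (Gamma (1 + \<alpha>) * s powr (- \<alpha>) * exp (- s * x))"
      by (subst nn_integral_cmult, measurable) (simp only: laplace_powr_kernel[OF \<alpha> s])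
    also have "\<dots> = ennreal (Gamma (1 + \<alpha>) * s powr (- \<alpha>)) *
       (ennreal (s * exp (- s * x)) * indicator {0..} x * ennreal (G x))"
      using s \<alpha> bnd G0 by (cases "0 \<le> x") (auto simp: ennreal_mult[symmetric] mult_ac)
    finally show "(\<integral>\<^sup>+t. ?h t x \<partial>lborel) = ennreal (Gamma (1 + \<alpha>) * s powr (- \<alpha>)) *
       (ennreal (s * exp (- s * x)) * indicator {0..} x * ennreal (G x))" .
  qed
  also have "\<dots> = ennreal (Gamma (1 + \<alpha>) * s powr (- \<alpha>)) *
      (\<integral>\<^sup>+x. ennreal (s * exp (- s * x)) * indicator {0..} x * ennreal (G x) \<partial>lborel)"
    by (rule nn_integral_cmult) measurable
  finally show ?thesis .
qed

section \<open>The hitting-return relation in Laplace form\<close>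

text \<open>
  Increments of an admissible time vector: \<open>t\<close> is admissible for the first \<open>d + 1\<close> points exactly when
  \<open>t i = t 0 + \<delta> i\<close> with \<open>t 0 \<ge> 0\<close> and such a \<open>\<delta>\<close>.
\<close>
definition spread :: "nat \<Rightarrow> (nat \<Rightarrow> real) \<Rightarrow> bool" where
  "spread d \<delta> \<longleftrightarrow> \<delta> 0 = 0 \<and> (\<forall>i<d. \<delta> i \<le> \<delta> (Suc i))"

abbreviation lap_excess :: "(nat \<Rightarrow> ennreal) measure \<Rightarrow> nat \<Rightarrow> (nat \<Rightarrow> real) \<Rightarrow> real \<Rightarrow> real" where
  "lap_excess P d \<delta> s \<equiv> (\<integral>\<phi>. lap s (excess d \<delta> \<phi>) \<partial>P)"

definition laplace_relation :: "real \<Rightarrow> (nat \<Rightarrow> ennreal) measure \<Rightarrow> (nat \<Rightarrow> ennreal) measure \<Rightarrow> bool" where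
  "laplace_relation \<alpha> P Q \<longleftrightarrow> (\<forall>d \<delta> s. spread d \<delta> \<and> 0 < s \<longrightarrow>
     lap_excess P (Suc d) \<delta> s = Gamma (1 + \<alpha>) * s powr (- \<alpha>) *
       (lap_excess Q d (\<lambda>i. \<delta> (Suc i)) s - lap_excess Q (Suc d) \<delta> s))"

lemma spread_nonneg: assumes "spread d \<delta>" "i < Suc d" shows "0 \<le> \<delta> i"
  using assms(2)
proof (induction i)
  case 0 then show ?case using assms by (simp add: spread_def)
next
  case (Suc i)
  then show ?case using assms(1) unfolding spread_def by (metis Suc_lessD Suc_less_SucD order_trans)
qed

lemma process_lawD:
  assumes "process_law P"
  shows "prob_space P" "sets P = sets borel" "space P = UNIV"
  using assms sets_eq_imp_space_eq[of P borel] by (auto simp: process_law_def)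

lemma measurable_excess_law [measurable]: "process_law P \<Longrightarrow> excess d \<delta> \<in> borel_measurable P"
  using borel_measurable_excess process_lawD(2) by (metis measurable_cong_sets)

text \<open>
  This makes the difference of distribution functions in the relation nonnegative: it is the
  probability that the \<open>d\<close> bounds hold for the shifted increments but the \<open>d + 1\<close> bounds fail.
\<close>
lemma excess_mono_shift:
  assumes "spread d \<delta>"
  shows "excess d (\<lambda>i. \<delta> (Suc i)) \<phi> \<le> excess (Suc d) \<delta> \<phi>"
  unfolding excess_def
proof (rule SUP_mono)
  fix i assume i: "i \<in> {..<d}"
  with assms have "\<delta> i \<le> \<delta> (Suc i)" by (auto simp: spread_def)
  then show "\<exists>j\<in>{..<Suc d}. \<phi> i - ennreal (\<delta> (Suc i)) \<le> \<phi> j - ennreal (\<delta> j)"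
    using i by (intro bexI[of _ i] ennreal_mono_minus) (auto intro: ennreal_leI)
qed

definition excess_cdf :: "(nat \<Rightarrow> ennreal) measure \<Rightarrow> nat \<Rightarrow> (nat \<Rightarrow> real) \<Rightarrow> real \<Rightarrow> real" where
  "excess_cdf P d \<delta> t = measure P {\<phi> \<in> space P. excess d \<delta> \<phi> \<le> ennreal t}"

lemma excess_cdf_fidi:
  assumes "0 \<le> t" "\<And>i. i < d \<Longrightarrow> 0 \<le> \<delta> i"
  shows "excess_cdf P d \<delta> t = fidi_cdf P d (\<lambda>i. t + \<delta> i)"
  unfolding excess_cdf_def using fidi_cdf_eq_excess[OF assms] by simp

lemma lap_excess_eq:
  assumes "process_law P" "0 < s"
  shows "ennreal (lap_excess P d \<delta> s) =
    (\<integral>\<^sup>+t. ennreal (s * exp (- s * t)) * indicator {0..} t * ennreal (excess_cdf P d \<delta> t) \<partial>lborel)"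
  unfolding excess_cdf_def using assms by (intro laplace_of_distribution_function) (auto simp: process_lawD)

lemma lap_excess_bounds:
  assumes "process_law P" "0 < s"
  shows "0 \<le> lap_excess P d \<delta> s" "lap_excess P d \<delta> s \<le> 1"
proof -
  interpret prob_space P using assms by (simp add: process_lawD)
  show "0 \<le> lap_excess P d \<delta> s" by simp
  have "lap_excess P d \<delta> s \<le> (\<integral>\<phi>. 1 \<partial>P)" using assms(2) by (intro integral_mono') auto
  then show "lap_excess P d \<delta> s \<le> 1" by (simp add: prob_space)
qed

lemma excess_cdf_props:
  assumes "process_law P"
  shows "excess_cdf P d \<delta> \<in> borel_measurable borel" "0 \<le> excess_cdf P d \<delta> t" "excess_cdf P d \<delta> t \<le> 1"
    and "0 \<le> t \<Longrightarrow> (excess_cdf P d \<delta> \<longlongrightarrow> excess_cdf P d \<delta> t) (at_right t)"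
proof -
  interpret prob_space P using assms by (simp add: process_lawD)
  show "excess_cdf P d \<delta> \<in> borel_measurable borel"
    unfolding excess_cdf_def using assms by (intro borel_measurable_distribution_function) (auto simp: process_lawD)
  show "0 \<le> excess_cdf P d \<delta> t" "excess_cdf P d \<delta> t \<le> 1" by (auto simp: excess_cdf_def)
  show "(excess_cdf P d \<delta> \<longlongrightarrow> excess_cdf P d \<delta> t) (at_right t)" if "0 \<le> t"
    unfolding excess_cdf_def using assms that
    by (intro distribution_function_right_continuous) (auto simp: process_lawD)
qed

lemma excess_cdf_unique:
  assumes "process_law P" "process_law P'"
    and "\<And>k::nat. 1 \<le> k \<Longrightarrow> lap_excess P d \<delta> (real k) = lap_excess P' d \<delta> (real k)" and "0 \<le> t"
  shows "excess_cdf P d \<delta> t = excess_cdf P' d \<delta> t"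
  unfolding excess_cdf_def using assms by (intro distribution_function_unique) (auto simp: process_lawD)

text \<open>
  For fixed increments both sides are right-continuous functions of the first time, so they agree
  everywhere as soon as their Laplace transforms agree.
\<close>
lemma relation_at_iff:
  assumes P: "process_law P" and Q: "process_law Q" and \<alpha>: "0 < \<alpha>" and sp: "spread d \<delta>"
  defines "G \<equiv> \<lambda>x. excess_cdf Q d (\<lambda>i. \<delta> (Suc i)) x - excess_cdf Q (Suc d) \<delta> x"
  shows "(\<forall>t\<ge>0. excess_cdf P (Suc d) \<delta> t = fractional_integral \<alpha> G t) \<longleftrightarrow>
    (\<forall>s>0. lap_excess P (Suc d) \<delta> s = Gamma (1 + \<alpha>) * s powr (- \<alpha>) *
       (lap_excess Q d (\<lambda>i. \<delta> (Suc i)) s - lap_excess Q (Suc d) \<delta> s))"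
    (is "?A \<longleftrightarrow> ?B")
proof -
  interpret Q: prob_space Q using Q by (simp add: process_lawD)
  let ?G1 = "excess_cdf Q d (\<lambda>i. \<delta> (Suc i))" and ?G2 = "excess_cdf Q (Suc d) \<delta>"
  let ?\<kappa> = "\<lambda>s. Gamma (1 + \<alpha>) * s powr (- \<alpha>)"
  let ?E = "\<lambda>s. lap_excess Q d (\<lambda>i. \<delta> (Suc i)) s - lap_excess Q (Suc d) \<delta> s"
  note [measurable] = excess_cdf_props(1)[OF Q] excess_cdf_props(1)[OF P] measurable_excess_law[OF Q]
  have le: "?G2 x \<le> ?G1 x" for x
    unfolding excess_cdf_def
    by (intro Q.finite_measure_mono) (auto intro: order_trans[OF excess_mono_shift[OF sp]])
  have G0: "0 \<le> G x" for x using le by (simp add: G_def)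
  have G1: "G x \<le> 1" for x
    using excess_cdf_props(3)[OF Q, of d "\<lambda>i. \<delta> (Suc i)" x] excess_cdf_props(2)[OF Q, of "Suc d" \<delta> x] by (simp add: G_def)
  have [measurable]: "G \<in> borel_measurable borel" unfolding G_def by measurable
  have Gr: "(G \<longlongrightarrow> G t) (at_right t)" if "0 \<le> t" for t
    unfolding G_def by (intro tendsto_diff excess_cdf_props(4)[OF Q that])
  have E0: "0 \<le> ?E s" and GE: "(\<integral>\<^sup>+x. ennreal (s * exp (- s * x)) * indicator {0..} x * ennreal (G x) \<partial>lborel) = ennreal (?E s)"
    if s: "0 < s" for s
  proof -
    let ?w = "\<lambda>x. ennreal (s * exp (- s * x)) * indicator {0..} x"
    have "ennreal (lap_excess Q d (\<lambda>i. \<delta> (Suc i)) s) = (\<integral>\<^sup>+x. ?w x * ennreal (G x) + ?w x * ennreal (?G2 x) \<partial>lborel)"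
      unfolding lap_excess_eq[OF Q s]
    proof (rule nn_integral_cong)
      fix x :: real
      have "?G1 x = G x + ?G2 x" by (simp add: G_def)
      then show "?w x * ennreal (?G1 x) = ?w x * ennreal (G x) + ?w x * ennreal (?G2 x)"
        using G0 excess_cdf_props(2)[OF Q] by (simp add: distrib_left)
    qed
    also have "\<dots> = (\<integral>\<^sup>+x. ?w x * ennreal (G x) \<partial>lborel) + ennreal (lap_excess Q (Suc d) \<delta> s)"
      unfolding lap_excess_eq[OF Q s] by (rule nn_integral_add) measurable
    finally have e: "ennreal (lap_excess Q d (\<lambda>i. \<delta> (Suc i)) s)
      = (\<integral>\<^sup>+x. ?w x * ennreal (G x) \<partial>lborel) + ennreal (lap_excess Q (Suc d) \<delta> s)" .
    have "(\<integral>\<^sup>+x. ?w x * ennreal (G x) \<partial>lborel) \<le> ennreal (lap_excess Q d (\<lambda>i. \<delta> (Suc i)) s)"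
      unfolding e by simp
    then have "(\<integral>\<^sup>+x. ?w x * ennreal (G x) \<partial>lborel) < \<top>"
      by (rule le_less_trans) simp
    then obtain g where g: "(\<integral>\<^sup>+x. ?w x * ennreal (G x) \<partial>lborel) = ennreal g" "0 \<le> g"
      by (cases "\<integral>\<^sup>+x. ?w x * ennreal (G x) \<partial>lborel") auto
    from e have "lap_excess Q d (\<lambda>i. \<delta> (Suc i)) s = g + lap_excess Q (Suc d) \<delta> s"
      unfolding g(1) using g(2) lap_excess_bounds(1)[OF Q s]
      by (simp add: ennreal_plus[symmetric] ennreal_inj del: ennreal_plus)
    then show "0 \<le> ?E s" "(\<integral>\<^sup>+x. ?w x * ennreal (G x) \<partial>lborel) = ennreal (?E s)"
      using g by auto
  qed
  have \<kappa>: "0 < ?\<kappa> s" if "0 < s" for s using \<alpha> that by (simp add: Gamma_real_pos)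
  have R: "(\<integral>\<^sup>+t. ennreal (s * exp (- s * t)) * indicator {0..} t * ennreal (fractional_integral \<alpha> G t) \<partial>lborel)
      = ennreal (?\<kappa> s * ?E s)" if s: "0 < s" for s
    using laplace_fractional_integral[OF \<alpha> s _ G0 G1] GE[OF s] E0[OF s] \<kappa>[OF s] by (simp add: ennreal_mult)
  have Rr: "(fractional_integral \<alpha> G \<longlongrightarrow> fractional_integral \<alpha> G t) (at_right t)" if "0 \<le> t" for t
  proof (rule fractional_integral_right_continuous[OF \<alpha> _ _ Gr that])
    show "\<bar>G x\<bar> \<le> 1" for x using G0[of x] G1[of x] by linarith
  qed measurable
  have Rm: "fractional_integral \<alpha> G \<in> borel_measurable borel"
  proof -
    have "(\<lambda>t. fractional_integral \<alpha> G t) \<in> borel_measurable borel"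
      unfolding fractional_integral_def set_lebesgue_integral_def indicator_def atLeastAtMost_iff by measurable
    then show ?thesis .
  qed
  show ?thesis
  proof
    assume ?A
    show ?B
    proof (intro allI impI)
      fix s :: real assume s: "0 < s"
      have "ennreal (lap_excess P (Suc d) \<delta> s) =
        (\<integral>\<^sup>+t. ennreal (s * exp (- s * t)) * indicator {0..} t * ennreal (fractional_integral \<alpha> G t) \<partial>lborel)"
        unfolding lap_excess_eq[OF P s]
        by (rule nn_integral_cong) (use \<open>?A\<close> in \<open>simp split: split_indicator\<close>)
      then show "lap_excess P (Suc d) \<delta> s = ?\<kappa> s * ?E s"
        unfolding R[OF s] using lap_excess_bounds(1)[OF P s] E0[OF s] \<kappa>[OF s] by (subst (asm) ennreal_inj) auto
    qed
  next
    assume B: ?B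
    show ?A
    proof (intro allI impI)
      fix t :: real assume t: "0 \<le> t"
      show "excess_cdf P (Suc d) \<delta> t = fractional_integral \<alpha> G t"
      proof (rule laplace_unique[OF excess_cdf_props(1)[OF P] Rm _ _ excess_cdf_props(4)[OF P] Rr _ _ t])
        fix k :: nat assume "1 \<le> k"
        then have s: "0 < real k" by simp
        show "(\<integral>\<^sup>+t. ennreal (real k * exp (- real k * t)) * indicator {0..} t * ennreal (excess_cdf P (Suc d) \<delta> t) \<partial>lborel)
          = (\<integral>\<^sup>+t. ennreal (real k * exp (- real k * t)) * indicator {0..} t * ennreal (fractional_integral \<alpha> G t) \<partial>lborel)"
          unfolding R[OF s] lap_excess_eq[OF P s, symmetric] using B s by simp
      next
        show "(\<integral>\<^sup>+t. ennreal (exp (- t)) * indicator {0..} t * ennreal (excess_cdf P (Suc d) \<delta> t) \<partial>lborel) < \<infinity>"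
          using lap_excess_eq[OF P, of 1 "Suc d" \<delta>, symmetric] by simp
      qed (auto intro: excess_cdf_props(2)[OF P] ennreal_fractional_integral(1)[OF \<alpha> _ G0 G1])
    qed
  qed
qed

text \<open>
  A time vector is split into its first entry, the variable of the Laplace transform, and its
  increments, which stay fixed.
\<close>
lemma hitting_return_relation_iff_laplace:
  assumes P: "process_law P" and Q: "process_law Q" and \<alpha>: "0 < \<alpha>"
  shows "hitting_return_relation \<alpha> P Q \<longleftrightarrow> laplace_relation \<alpha> P Q"
proof -
  let ?G = "\<lambda>d \<delta> x. excess_cdf Q d (\<lambda>i. \<delta> (Suc i)) x - excess_cdf Q (Suc d) \<delta> x"
  have *: "hitting_return_relation \<alpha> P Q \<longleftrightarrow>
    (\<forall>d \<delta>. spread d \<delta> \<longrightarrow> (\<forall>t\<ge>0. excess_cdf P (Suc d) \<delta> t = fractional_integral \<alpha> (?G d \<delta>) t))"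
    (is "?A \<longleftrightarrow> ?B")
  proof -
    have K: "excess_cdf P (Suc d) \<delta> (t 0) = fidi_cdf P (Suc d) t \<and>
        fractional_integral \<alpha> (?G d \<delta>) (t 0) = \<alpha> * (LINT x:{0..t 0}|lborel.
           (fidi_cdf Q d (\<lambda>i. t (Suc i) - t 0 + x) - fidi_cdf Q (Suc d) (\<lambda>i. t i - t 0 + x)) * (t 0 - x) powr (\<alpha> - 1))"
      if sp: "spread d \<delta>" and t: "0 \<le> t 0" "\<And>i. t i = t 0 + \<delta> i" for d \<delta> and t :: "nat \<Rightarrow> real"
    proof
      have nn: "0 \<le> \<delta> i" if "i < Suc d" for i using spread_nonneg[OF sp that] .
      have "(\<lambda>i. t 0 + \<delta> i) = t" by (rule ext) (rule t(2)[symmetric])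
      then show "excess_cdf P (Suc d) \<delta> (t 0) = fidi_cdf P (Suc d) t"
        using excess_cdf_fidi[OF t(1) nn] by simp
      have e: "?G d \<delta> x = fidi_cdf Q d (\<lambda>i. t (Suc i) - t 0 + x) - fidi_cdf Q (Suc d) (\<lambda>i. t i - t 0 + x)"
        if x: "0 \<le> x" for x
      proof -
        have tt: "t i - t 0 + x = x + \<delta> i" for i using t(2)[of i] by simp
        have "(\<lambda>i. t (Suc i) - t 0 + x) = (\<lambda>i. x + \<delta> (Suc i))" "(\<lambda>i. t i - t 0 + x) = (\<lambda>i. x + \<delta> i)"
          by (simp_all only: tt)
        then show ?thesis
          using excess_cdf_fidi[OF x, of d "\<lambda>i. \<delta> (Suc i)" Q] excess_cdf_fidi[OF x, of "Suc d" \<delta> Q] nn by simp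
      qed
      show "fractional_integral \<alpha> (?G d \<delta>) (t 0) = \<alpha> * (LINT x:{0..t 0}|lborel.
           (fidi_cdf Q d (\<lambda>i. t (Suc i) - t 0 + x) - fidi_cdf Q (Suc d) (\<lambda>i. t i - t 0 + x)) * (t 0 - x) powr (\<alpha> - 1))"
        unfolding fractional_integral_def set_lebesgue_integral_def
        by (intro arg_cong2[where f="(*)"] refl Bochner_Integration.integral_cong)
           (use e in \<open>auto split: split_indicator\<close>)
    qed
    show ?thesis
    proof
      assume A: ?A
      show ?B
      proof (intro allI impI)
        fix d \<delta> and t :: real assume sp: "spread d \<delta>" and t: "0 \<le> t"
        have d0: "\<delta> 0 = 0" using sp by (simp add: spread_def)
        let ?t = "\<lambda>i. t + \<delta> i"
        have "0 \<le> ?t 0 \<and> (\<forall>i. Suc i < Suc d \<longrightarrow> ?t i \<le> ?t (Suc i))"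
          using t sp by (auto simp: spread_def)
        with A[unfolded hitting_return_relation_def, rule_format, of "Suc d" ?t]
        show "excess_cdf P (Suc d) \<delta> t = fractional_integral \<alpha> (?G d \<delta>) t"
          using K[OF sp, of ?t] t d0 by simp
      qed
    next
      assume B: ?B
      show ?A unfolding hitting_return_relation_def
      proof (intro allI impI)
        fix d and t :: "nat \<Rightarrow> real"
        assume d: "1 \<le> d" and t: "0 \<le> t 0 \<and> (\<forall>i. Suc i < d \<longrightarrow> t i \<le> t (Suc i))"
        then obtain d' where d': "d = Suc d'" by (cases d) auto
        let ?\<delta> = "\<lambda>i. t i - t 0"
        have sp: "spread d' ?\<delta>" using t d' by (auto simp: spread_def)
        show "fidi_cdf P d t = \<alpha> * (LINT x:{0..t 0}|lborel.
                 (fidi_cdf Q (d - 1) (\<lambda>i. t (Suc i) - t 0 + x)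
                  - fidi_cdf Q d (\<lambda>i. t i - t 0 + x)) * (t 0 - x) powr (\<alpha> - 1))"
          using K[OF sp, of t] B[rule_format, OF sp, of "t 0"] t d' by simp
      qed
    qed
  qed
  show ?thesis unfolding * laplace_relation_def
    using relation_at_iff[OF P Q \<alpha>] by blast
qed

section \<open>Laws of nondecreasing sequences\<close>

lemma fidi_cdf_0: "process_law P \<Longrightarrow> fidi_cdf P 0 t = 1"
  using prob_space.prob_space[of P] by (simp add: fidi_cdf_def process_lawD)

lemma borel_fun_ennreal_eq:
  "sets (borel :: (nat \<Rightarrow> ennreal) measure) = sigma_sets UNIV {{\<phi>. \<forall>i<d. \<phi> i \<le> y i} | d y. True}"
    (is "_ = sigma_sets UNIV ?C")
proof
  let ?S = "sigma UNIV ?C"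
  have sS: "sets ?S = sigma_sets UNIV ?C" "space ?S = UNIV" by auto
  have "(\<lambda>\<phi>. \<phi>) \<in> measurable ?S (borel :: (nat \<Rightarrow> ennreal) measure)"
  proof (rule measurable_coordinatewise_then_product)
    fix i :: nat
    show "(\<lambda>\<phi>. \<phi> i) \<in> borel_measurable ?S"
    proof (rule borel_measurableI_le)
      fix y :: ennreal
      have "{\<phi>. \<phi> i \<le> y} = {\<phi>. \<forall>j<Suc i. \<phi> j \<le> (if j = i then y else \<top>)}"
        by (auto simp: less_Suc_eq)
      also have "\<dots> \<in> ?C"
        by (rule CollectI, rule exI[of _ "Suc i"], rule exI[of _ "\<lambda>j. if j = i then y else \<top>"]) simp
      finally show "{\<phi> \<in> space ?S. \<phi> i \<le> y} \<in> sets ?S" by simp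
    qed
  qed
  then show "sets (borel :: (nat \<Rightarrow> ennreal) measure) \<subseteq> sigma_sets UNIV ?C"
    unfolding measurable_def by (auto simp: sS)
  have "?C \<subseteq> sets borel"
  proof safe
    fix d y
    have "closed {\<phi> :: nat \<Rightarrow> ennreal. \<forall>i<d. \<phi> i \<le> y i}"
      by (intro closed_Collect_all closed_Collect_imp open_Collect_const closed_Collect_le
          continuous_on_coordinate continuous_on_const)
    then show "{\<phi>. \<forall>i<d. \<phi> i \<le> y i} \<in> sets borel" by auto
  qed
  then show "sigma_sets UNIV ?C \<subseteq> sets (borel :: (nat \<Rightarrow> ennreal) measure)"
    using sets.sigma_sets_subset[of ?C borel] by simp
qed

text \<open>
  The boxes \<open>{\<phi>. \<forall>i<d. \<phi> i \<le> y i}\<close> with bounds in \<open>[0, \<infinity>]\<close> are stable under intersections and generate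
  the Borel sets. On nondecreasing sequences such a box is unchanged when every bound is replaced by
  the minimum of all later bounds, and infinite bounds can then only occur at the end, where they may
  be dropped. What remains is a box with finite nondecreasing bounds.
\<close>
lemma monotone_law_eqI:
  assumes P: "monotone_process_law P" and Q: "monotone_process_law Q"
    and eq: "\<And>d t. 0 \<le> t 0 \<Longrightarrow> (\<And>i. Suc i < d \<Longrightarrow> t i \<le> t (Suc i)) \<Longrightarrow> fidi_cdf P d t = fidi_cdf Q d t"
  shows "P = Q"
proof -
  let ?C = "{{\<phi> :: nat \<Rightarrow> ennreal. \<forall>i<d. \<phi> i \<le> y i} | d y. True}"
  have pP: "process_law P" and pQ: "process_law Q" using P Q by (auto simp: monotone_process_law_def)
  interpret P: prob_space P using pP by (simp add: process_lawD)
  interpret Q: prob_space Q using pQ by (simp add: process_lawD)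
  note spc = process_lawD(2,3)[OF pP] process_lawD(2,3)[OF pQ]
  have CB: "{\<phi>. \<forall>i<d. \<phi> i \<le> y i} \<in> sets borel" for d :: nat and y :: "nat \<Rightarrow> ennreal"
    unfolding borel_fun_ennreal_eq by (rule sigma_sets.Basic) auto
  show ?thesis
  proof (rule measure_eqI_generator_eq[where E="?C" and \<Omega>=UNIV and A="\<lambda>_. UNIV"])
    show "Int_stable ?C"
    proof (rule Int_stableI)
      fix A B assume "A \<in> ?C" "B \<in> ?C"
      then obtain d y e z where A: "A = {\<phi>. \<forall>i<d. \<phi> i \<le> y i}" and B: "B = {\<phi>. \<forall>i<e. \<phi> i \<le> z i}" by auto
      have "A \<inter> B = {\<phi>. \<forall>i<max d e. \<phi> i \<le> inf (if i < d then y i else \<top>) (if i < e then z i else \<top>)}"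
        unfolding A B by (fastforce simp: less_max_iff_disj)
      then show "A \<inter> B \<in> ?C"
        by (intro CollectI) (rule exI, rule exI, rule conjI[OF _ TrueI])
    qed
    show "range (\<lambda>_. UNIV) \<subseteq> ?C" by (auto intro!: exI[of _ 0])
    fix X assume "X \<in> ?C"
    then obtain d y where X: "X = {\<phi>. \<forall>i<d. \<phi> i \<le> y i}" by auto
    \<comment> \<open>The running minimum from the right; past the last finite bound it is
      infinite.\<close>
    define z where "z i = Inf (y ` {i..<d})" for i
    have zmono: "z i \<le> z j" if "i \<le> j" for i j unfolding z_def using that by (intro INF_superset_mono) auto
    define e where "e = (LEAST i. z i = \<top>)"
    have zd: "z d = \<top>" by (simp add: z_def)
    have ze: "z e = \<top>" unfolding e_def by (rule LeastI[of _ d]) (rule zd)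
    have ed: "e \<le> d" unfolding e_def by (rule Least_le) (rule zd)
    have zfin: "z i \<noteq> \<top>" if "i < e" for i using that not_less_Least unfolding e_def by blast
    define t where "t i = enn2real (z i)" for i
    have tz: "ennreal (t i) = z i" if "i < e" for i using zfin[OF that] by (simp add: t_def less_top)
    have iff: "(\<forall>i<d. \<phi> i \<le> y i) \<longleftrightarrow> (\<forall>i<e. \<phi> i \<le> ennreal (t i))" if m: "\<phi> \<in> monotone_seqs" for \<phi>
    proof -
      have \<phi>: "mono \<phi>" using m by (auto simp: monotone_seqs_def intro: incseq_SucI)
      have "(\<forall>i<d. \<phi> i \<le> y i) \<longleftrightarrow> (\<forall>i<d. \<phi> i \<le> z i)"
      proof (intro iffI allI impI)
        fix i assume "\<forall>i<d. \<phi> i \<le> y i" "i < d"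
        then show "\<phi> i \<le> z i" unfolding z_def
          by (intro INF_greatest) (auto intro: order_trans[OF monoD[OF \<phi>]])
      next
        fix i assume a: "\<forall>i<d. \<phi> i \<le> z i" and "i < d"
        then have "z i \<le> y i" unfolding z_def by (intro INF_lower) auto
        with a \<open>i < d\<close> show "\<phi> i \<le> y i" by (meson order_trans)
      qed
      also have "\<dots> \<longleftrightarrow> (\<forall>i<e. \<phi> i \<le> z i)"
      proof (intro iffI allI impI)
        fix i assume a: "\<forall>i<e. \<phi> i \<le> z i" and "i < d"
        show "\<phi> i \<le> z i"
        proof (cases "i < e")
          case False
          then have "z i = \<top>" using zmono[of e i] ze by (simp add: top_unique)
          then show ?thesis by simp
        qed (use a in auto)
      qed (use ed in auto)
      also have "\<dots> \<longleftrightarrow> (\<forall>i<e. \<phi> i \<le> ennreal (t i))" using tz by auto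
      finally show ?thesis .
    qed
    have pr: "emeasure R X = ennreal (fidi_cdf R e t)" if R: "monotone_process_law R" for R
    proof -
      have pR: "process_law R" and AE: "AE \<phi> in R. \<phi> \<in> monotone_seqs" using R by (auto simp: monotone_process_law_def)
      interpret R: prob_space R using pR by (simp add: process_lawD)
      have "emeasure R X = emeasure R {\<phi>. \<forall>i<e. \<phi> i \<le> ennreal (t i)}"
        unfolding X
        by (rule emeasure_eq_AE) (use AE iff CB in \<open>auto simp: process_lawD[OF pR]\<close>)
      then show ?thesis by (simp add: fidi_cdf_def R.emeasure_eq_measure process_lawD[OF pR])
    qed
    have "fidi_cdf P e t = fidi_cdf Q e t"
    proof (rule eq)
      show "0 \<le> t 0" by (simp add: t_def)
      fix i assume "Suc i < e"
      then show "t i \<le> t (Suc i)" unfolding t_def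
        using zmono[of i "Suc i"] zfin[of "Suc i"] by (intro enn2real_mono) (auto simp: less_top)
    qed
    then show "emeasure P X = emeasure Q X" using pr[OF P] pr[OF Q] by simp
  qed (auto simp: spc borel_fun_ennreal_eq P.emeasure_space_1)
qed

text \<open>
  Expectations of the functionals in dimension \<open>d\<close> with arbitrary increments are determined by the
  distribution functions in dimension \<open>d\<close>; this is why the hypothesis for \<open>\<delta> \<circ> Suc\<close>, whose first
  increment need not vanish, is available in the induction.
\<close>
lemma monotone_law_eq_by_induction:
  assumes P: "monotone_process_law P" and Q: "monotone_process_law Q"
    and step: "\<And>d \<delta>. spread d \<delta> \<Longrightarrow>
      (\<And>s. 0 < s \<Longrightarrow> lap_excess P d (\<lambda>i. \<delta> (Suc i)) s = lap_excess Q d (\<lambda>i. \<delta> (Suc i)) s) \<Longrightarrow>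
      (\<And>s. 0 < s \<Longrightarrow> lap_excess P (Suc d) \<delta> s = lap_excess Q (Suc d) \<delta> s)"
  shows "P = Q"
proof (rule monotone_law_eqI[OF P Q])
  have pP: "process_law P" and pQ: "process_law Q" using P Q by (auto simp: monotone_process_law_def)
  show "fidi_cdf P d t = fidi_cdf Q d t" if "0 \<le> t 0" "\<And>i. Suc i < d \<Longrightarrow> t i \<le> t (Suc i)" for d t
    using that
  proof (induction d arbitrary: t)
    case 0 then show ?case by (simp add: fidi_cdf_0 pP pQ)
  next
    case (Suc d)
    let ?\<delta> = "\<lambda>i. t i - t 0"
    have sp: "spread d ?\<delta>" using Suc.prems by (auto simp: spread_def)
    have nn: "0 \<le> ?\<delta> i" if "i < Suc d" for i using spread_nonneg[OF sp that] by simp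
    have cdf: "excess_cdf P d (\<lambda>i. ?\<delta> (Suc i)) u = excess_cdf Q d (\<lambda>i. ?\<delta> (Suc i)) u" if u: "0 \<le> u" for u
    proof (cases "d = 0")
      case True
      then show ?thesis using excess_cdf_fidi[OF u, of d "\<lambda>i. ?\<delta> (Suc i)"] by (simp add: fidi_cdf_0 pP pQ)
    next
      case False
      have "fidi_cdf P d (\<lambda>i. u + ?\<delta> (Suc i)) = fidi_cdf Q d (\<lambda>i. u + ?\<delta> (Suc i))"
      proof (rule Suc.IH)
        show "0 \<le> u + ?\<delta> (Suc 0)" using nn[of "Suc 0"] u False by simp
        show "u + ?\<delta> (Suc i) \<le> u + ?\<delta> (Suc (Suc i))" if "Suc i < d" for i
          using Suc.prems(2)[of "Suc i"] that by simp
      qed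
      then show ?thesis using excess_cdf_fidi[OF u, of d "\<lambda>i. ?\<delta> (Suc i)"] nn by simp
    qed
    have "lap_excess P d (\<lambda>i. ?\<delta> (Suc i)) s = lap_excess Q d (\<lambda>i. ?\<delta> (Suc i)) s" if s: "0 < s" for s
    proof -
      have "ennreal (lap_excess P d (\<lambda>i. ?\<delta> (Suc i)) s) = ennreal (lap_excess Q d (\<lambda>i. ?\<delta> (Suc i)) s)"
        unfolding lap_excess_eq[OF pP s] lap_excess_eq[OF pQ s]
        by (rule nn_integral_cong) (use cdf in \<open>simp split: split_indicator\<close>)
      then show ?thesis using lap_excess_bounds(1)[OF pP s] lap_excess_bounds(1)[OF pQ s] by (simp add: ennreal_inj)
    qed
    from step[OF sp this] have "excess_cdf P (Suc d) ?\<delta> (t 0) = excess_cdf Q (Suc d) ?\<delta> (t 0)"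
      using Suc.prems(1) by (intro excess_cdf_unique pP pQ) auto
    then show ?case
      using excess_cdf_fidi[of "t 0" "Suc d" ?\<delta>] Suc.prems(1) nn by simp
  qed
qed

lemma laplace_relation_unique_hitting:
  assumes "monotone_process_law P" "monotone_process_law P'" "laplace_relation \<alpha> P Q" "laplace_relation \<alpha> P' Q"
  shows "P = P'"
  by (rule monotone_law_eq_by_induction[OF assms(1,2)]) (use assms(3,4) in \<open>simp add: laplace_relation_def\<close>)

text \<open>
  The relation can be solved for the expectation in dimension \<open>d + 1\<close> under the return law, since its
  factor \<open>\<Gamma>(1 + \<alpha>) * s powr (- \<alpha>)\<close> is positive.
\<close>
lemma laplace_relation_unique_return:
  assumes "monotone_process_law Q" "monotone_process_law Q'" "laplace_relation \<alpha> P Q" "laplace_relation \<alpha> P Q'"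
    and \<alpha>: "0 < \<alpha>"
  shows "Q = Q'"
proof (rule monotone_law_eq_by_induction[OF assms(1,2)])
  fix d \<delta> and s :: real
  assume sp: "spread d \<delta>" and s: "0 < s"
    and IH: "\<And>s. 0 < s \<Longrightarrow> lap_excess Q d (\<lambda>i. \<delta> (Suc i)) s = lap_excess Q' d (\<lambda>i. \<delta> (Suc i)) s"
  have "0 < Gamma (1 + \<alpha>) * s powr (- \<alpha>)" using \<alpha> s by (simp add: Gamma_real_pos)
  moreover have "Gamma (1 + \<alpha>) * s powr (- \<alpha>) * (lap_excess Q d (\<lambda>i. \<delta> (Suc i)) s - lap_excess Q (Suc d) \<delta> s)
     = Gamma (1 + \<alpha>) * s powr (- \<alpha>) * (lap_excess Q' d (\<lambda>i. \<delta> (Suc i)) s - lap_excess Q' (Suc d) \<delta> s)"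
    using assms(3,4) sp s unfolding laplace_relation_def by metis
  ultimately show "lap_excess Q (Suc d) \<delta> s = lap_excess Q' (Suc d) \<delta> s"
    using IH[OF s] by (metis diff_left_imp_eq less_irrefl mult_left_cancel)
qed

lemma laplace_relation_unique_fixed:
  assumes "monotone_process_law P" "monotone_process_law P'" "laplace_relation \<alpha> P P" "laplace_relation \<alpha> P' P'"
    and \<alpha>: "0 < \<alpha>"
  shows "P = P'"
proof (rule monotone_law_eq_by_induction[OF assms(1,2)])
  fix d \<delta> and s :: real
  assume sp: "spread d \<delta>" and s: "0 < s"
    and IH: "\<And>s. 0 < s \<Longrightarrow> lap_excess P d (\<lambda>i. \<delta> (Suc i)) s = lap_excess P' d (\<lambda>i. \<delta> (Suc i)) s"
  define \<kappa> where "\<kappa> = Gamma (1 + \<alpha>) * s powr (- \<alpha>)"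
  have \<kappa>: "0 < \<kappa>" using \<alpha> s by (simp add: Gamma_real_pos \<kappa>_def)
  have "lap_excess P (Suc d) \<delta> s * (1 + \<kappa>) = \<kappa> * lap_excess P d (\<lambda>i. \<delta> (Suc i)) s"
    using assms(3) sp s unfolding laplace_relation_def \<kappa>_def[symmetric] by (simp add: algebra_simps \<kappa>_def)
  moreover have "lap_excess P' (Suc d) \<delta> s * (1 + \<kappa>) = \<kappa> * lap_excess P' d (\<lambda>i. \<delta> (Suc i)) s"
    using assms(4) sp s unfolding laplace_relation_def \<kappa>_def[symmetric] by (simp add: algebra_simps \<kappa>_def)
  ultimately have "lap_excess P (Suc d) \<delta> s * (1 + \<kappa>) = lap_excess P' (Suc d) \<delta> s * (1 + \<kappa>)"
    using IH[OF s] by simp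
  then show "lap_excess P (Suc d) \<delta> s = lap_excess P' (Suc d) \<delta> s" using \<kappa> by simp
qed

section \<open>Compactness of laws on the sequence space\<close>

text \<open>
  The digit of weight \<open>2 ^ (- (j + 1))\<close>; for \<open>0 \<le> v < 1\<close> these digits sum to \<open>v\<close>.
\<close>
definition binary_digit :: "real \<Rightarrow> nat \<Rightarrow> real" where
  "binary_digit v j = real_of_int (\<lfloor>2 ^ Suc j * v\<rfloor> mod 2)"

lemma binary_digit_01: "binary_digit v j \<in> {0, 1}"
proof -
  have "\<lfloor>2 ^ Suc j * v\<rfloor> mod 2 = 0 \<or> \<lfloor>2 ^ Suc j * v\<rfloor> mod 2 = 1" by presburger
  then show ?thesis by (auto simp: binary_digit_def)
qed

lemma binary_digit_partial_sum:
  assumes "0 \<le> v" "v < 1"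
  shows "(\<Sum>j<n. binary_digit v j / 2 ^ Suc j) = real_of_int \<lfloor>2 ^ n * v\<rfloor> / 2 ^ n"
proof (induction n)
  case 0
  have "\<lfloor>v\<rfloor> = 0" using assms by (simp add: floor_eq_iff)
  then show ?case by simp
next
  case (Suc n)
  let ?x = "\<lfloor>2 ^ Suc n * v\<rfloor>"
  have "?x div 2 = \<lfloor>2 ^ n * v\<rfloor>"
    using floor_divide_real_eq_div[of 2 "2 ^ Suc n * v"] by simp
  then have "?x = 2 * \<lfloor>2 ^ n * v\<rfloor> + ?x mod 2" by presburger
  then have "real_of_int ?x = 2 * real_of_int \<lfloor>2 ^ n * v\<rfloor> + binary_digit v n"
    unfolding binary_digit_def by (metis of_int_add of_int_mult of_int_numeral)
  then show ?case using Suc by (simp add: field_simps)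
qed

lemma binary_digit_sums:
  assumes v: "0 \<le> v" "v < 1"
  shows "(\<lambda>j. binary_digit v j / 2 ^ Suc j) sums v"
  unfolding sums_def binary_digit_partial_sum[OF v]
proof (rule tendsto_sandwich[where f="\<lambda>n. v - (1/2) ^ n" and h="\<lambda>n. v"])
  show "eventually (\<lambda>n. v - (1/2) ^ n \<le> real_of_int \<lfloor>2 ^ n * v\<rfloor> / 2 ^ n) sequentially"
  proof (intro always_eventually allI)
    fix n
    have "2 ^ n * v - 1 \<le> real_of_int \<lfloor>2 ^ n * v\<rfloor>" by linarith
    then have "(2 ^ n * v - 1) / 2 ^ n \<le> real_of_int \<lfloor>2 ^ n * v\<rfloor> / 2 ^ n" by (intro divide_right_mono) auto
    then show "v - (1/2) ^ n \<le> real_of_int \<lfloor>2 ^ n * v\<rfloor> / 2 ^ n" by (simp add: diff_divide_distrib power_divide)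
  qed
  show "eventually (\<lambda>n. real_of_int \<lfloor>2 ^ n * v\<rfloor> / 2 ^ n \<le> v) sequentially"
    by (intro always_eventually allI) (simp add: divide_le_eq mult.commute)
  show "(\<lambda>n. v - (1/2) ^ n) \<longlonglongrightarrow> v"
    using tendsto_diff[OF tendsto_const LIMSEQ_power_zero[of "1/2::real"], of v] by simp
qed simp

text \<open>
  Schoenberg's device for space-filling curves: a continuous function of period 2 that vanishes on
  \<open>[0, 1/3]\<close> and equals 1 on \<open>[2/3, 1]\<close>. Evaluated at \<open>3 ^ k\<close> times a point of the Cantor set it
  returns half the ternary digit of weight \<open>3 ^ (- (k + 1))\<close>.
\<close>
definition wave :: "real \<Rightarrow> real" where
  "wave t = max 0 (min 1 (1 / 2 - cos (pi * t)))"

definition cantor_point :: "(nat \<Rightarrow> real) \<Rightarrow> real" where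
  "cantor_point e = (\<Sum>k. 2 * e k / 3 ^ Suc k)"

lemma cantor_sums: "(\<lambda>k. 2 / 3 ^ Suc k :: real) sums 1"
  using sums_mult[OF geometric_sums[of "1/3::real"], of "2/3"] by (simp add: power_divide)

lemma cantor_summable:
  assumes "\<And>k. e k \<in> {0, 1::real}"
  shows "summable (\<lambda>k. 2 * e k / 3 ^ Suc k)"
proof (rule summable_comparison_test'[OF sums_summable[OF cantor_sums], of 0])
  fix k show "norm (2 * e k / 3 ^ Suc k) \<le> 2 / 3 ^ Suc k" using assms[of k] by auto
qed

lemma cantor_bounds:
  assumes "\<And>k. e k \<in> {0, 1::real}"
  shows "0 \<le> cantor_point e" "cantor_point e \<le> 1"
proof -
  have e: "0 \<le> e k" "e k \<le> 1" for k using assms[of k] by auto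
  show "0 \<le> cantor_point e"
    unfolding cantor_point_def by (intro suminf_nonneg cantor_summable assms) (simp add: e)
  have "cantor_point e \<le> (\<Sum>k. 2 / 3 ^ Suc k :: real)"
    unfolding cantor_point_def
    by (intro suminf_le cantor_summable assms sums_summable[OF cantor_sums]) (simp add: e divide_right_mono)
  then show "cantor_point e \<le> 1" using sums_unique[OF cantor_sums] by simp
qed

lemma cantor_step:
  assumes "\<And>k. e k \<in> {0, 1::real}"
  shows "3 * cantor_point e = cantor_point (\<lambda>k. e (Suc k)) + 2 * e 0"
proof -
  have "cantor_point e = (\<Sum>k. 2 * e (Suc k) / 3 ^ Suc (Suc k)) + 2 * e 0 / 3"
    unfolding cantor_point_def using suminf_split_head[OF cantor_summable[of e, OF assms]] by simp
  also have "(\<Sum>k. 2 * e (Suc k) / 3 ^ Suc (Suc k)) = (\<Sum>k. (1/3) * (2 * e (Suc k) / 3 ^ Suc k))"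
    by simp
  also have "\<dots> = (1/3) * cantor_point (\<lambda>k. e (Suc k))"
    unfolding cantor_point_def by (intro suminf_mult cantor_summable assms)
  finally show ?thesis by simp
qed

lemma wave_periodic: "wave (t + 2 * real m) = wave t"
proof -
  have "cos (pi * (t + 2 * real m)) = cos (pi * t + 2 * real m * pi)" by (simp add: algebra_simps)
  also have "\<dots> = cos (pi * t)" by (simp only: cos_add cos_2npi sin_2npi mult_1_right mult_zero_right diff_zero)
  finally show ?thesis by (simp add: wave_def)
qed

lemma wave_cantor_0:
  assumes e: "\<And>k. e k \<in> {0, 1::real}"
  shows "wave (cantor_point e) = e 0"
proof -
  let ?c = "cantor_point e" and ?d = "cantor_point (\<lambda>k. e (Suc k))"
  have d: "0 \<le> ?d" "?d \<le> 1" using cantor_bounds[of "\<lambda>k. e (Suc k)"] e by auto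
  have c: "3 * ?c = ?d + 2 * e 0" by (rule cantor_step[OF e])
  from e[of 0] consider "e 0 = 0" | "e 0 = 1" by auto
  then show ?thesis
  proof cases
    case 1
    then have "0 \<le> ?c" "?c \<le> 1/3" using c d by auto
    then have "pi * ?c \<le> pi / 3" "0 \<le> pi * ?c"
      using mult_left_mono[of ?c "1/3" pi] by auto
    then have "cos (pi / 3) \<le> cos (pi * ?c)" by (intro cos_monotone_0_pi_le) auto
    then show ?thesis using 1 by (simp add: wave_def cos_60)
  next
    case 2
    then have "2/3 \<le> ?c" "?c \<le> 1" using c d by auto
    then have "pi * (1 - ?c) \<le> pi / 3" "0 \<le> pi * (1 - ?c)"
      using mult_left_mono[of "1 - ?c" "1/3" pi] by auto
    then have "cos (pi / 3) \<le> cos (pi * (1 - ?c))" by (intro cos_monotone_0_pi_le) auto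
    moreover have "cos (pi * (1 - ?c)) = - cos (pi * ?c)"
      by (simp add: right_diff_distrib)
    ultimately show ?thesis using 2 by (simp add: wave_def cos_60)
  qed
qed

lemma wave_cantor:
  assumes "\<And>k. e k \<in> {0, 1::real}"
  shows "wave (3 ^ k * cantor_point e) = e k"
  using assms
proof (induction k arbitrary: e)
  case 0 then show ?case using wave_cantor_0[of e] by simp
next
  case (Suc k)
  obtain m :: nat where m: "e 0 = real m" using Suc.prems[of 0] by (auto intro: that[of 0] that[of 1])
  have "3 ^ Suc k * cantor_point e = 3 ^ k * (3 * cantor_point e)" by simp
  also have "\<dots> = 3 ^ k * cantor_point (\<lambda>k. e (Suc k)) + 2 * real (3 ^ k * m)"
    unfolding cantor_step[OF Suc.prems] m by (simp add: algebra_simps)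
  finally have "wave (3 ^ Suc k * cantor_point e) = wave (3 ^ k * cantor_point (\<lambda>k. e (Suc k)))"
    by (simp only: wave_periodic)
  then show ?case using Suc.IH[of "\<lambda>k. e (Suc k)"] Suc.prems by simp
qed

text \<open>
  A continuous map of the line onto the sequence space, together with a Borel section \<open>encode\<close>. The
  \<open>i\<close>-th coordinate is sent to \<open>[0, 1]\<close> by \<open>x \<mapsto> 1 / (1 + x)\<close> and then divided by 2, so that also the value
  1, attained at \<open>x = 0\<close>, has a binary expansion with the digits above; the digits of all coordinates
  are interleaved along \<open>prod_encode\<close>.
\<close>
definition decode :: "real \<Rightarrow> nat \<Rightarrow> ennreal" where
  "decode x i = inverse (ennreal (2 * (\<Sum>j. wave (3 ^ prod_encode (i, j) * x) / 2 ^ Suc j))) - 1"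

definition encode :: "(nat \<Rightarrow> ennreal) \<Rightarrow> real" where
  "encode \<phi> = cantor_point (\<lambda>k. binary_digit (enn2real (inverse (1 + \<phi> (fst (prod_decode k)))) / 2) (snd (prod_decode k)))"

lemma encode_bounds: "0 \<le> encode \<phi>" "encode \<phi> \<le> 1"
  unfolding encode_def using cantor_bounds binary_digit_01 by (metis (no_types, lifting))+

lemma decode_encode: "decode (encode \<phi>) = \<phi>"
proof
  fix i
  let ?v = "inverse (1 + \<phi> i)"
  have v1: "?v \<le> 1" 
    by (cases "\<phi> i") (auto simp: inverse_ennreal inverse_le_1_iff simp flip: ennreal_1 ennreal_plus)
  then have vr: "ennreal (enn2real ?v) = ?v" by (intro ennreal_enn2real) (auto simp: less_top[symmetric] top_unique)
  have v2: "0 \<le> enn2real ?v" "enn2real ?v \<le> 1" using enn2real_mono[OF v1] by auto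
  have w: "wave (3 ^ k * encode \<phi>) = binary_digit (enn2real (inverse (1 + \<phi> (fst (prod_decode k)))) / 2) (snd (prod_decode k))" for k
    unfolding encode_def by (rule wave_cantor) (rule binary_digit_01)
  have "(\<Sum>j. wave (3 ^ prod_encode (i, j) * encode \<phi>) / 2 ^ Suc j) = enn2real ?v / 2"
    using binary_digit_sums[of "enn2real ?v / 2"] v2 by (simp add: w sums_iff)
  then have "2 * (\<Sum>j. wave (3 ^ prod_encode (i, j) * encode \<phi>) / 2 ^ Suc j) = enn2real ?v" by linarith
  then have "decode (encode \<phi>) i = inverse ?v - 1"
    unfolding decode_def by (simp only: vr)
  also have "inverse ?v = 1 + \<phi> i"
    by (cases "\<phi> i") (auto simp: inverse_ennreal simp flip: ennreal_1 ennreal_plus)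
  finally show "decode (encode \<phi>) i = \<phi> i" by simp
qed

lemma continuous_on_decode: "continuous_on UNIV decode"
proof (rule continuous_on_coordinatewise_then_product)
  fix i
  let ?f = "\<lambda>j x. wave (3 ^ prod_encode (i, j) * x) / 2 ^ Suc j"
  have w01: "0 \<le> wave x" "wave x \<le> 1" for x by (auto simp: wave_def)
  have cw: "continuous_on UNIV (?f j)" for j
    unfolding wave_def by (intro continuous_intros) auto
  have h: "summable (\<lambda>j. 1 / 2 ^ Suc j :: real)"
    using sums_summable[OF power_half_series] by (simp add: power_divide)
  have "uniform_limit UNIV (\<lambda>n x. \<Sum>j<n. ?f j x) (\<lambda>x. \<Sum>j. ?f j x) sequentially"
    by (rule Weierstrass_m_test[OF _ h]) (simp add: w01 divide_right_mono)
  then have "continuous_on UNIV (\<lambda>x. \<Sum>j. ?f j x)"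
    by (rule uniform_limit_theorem[rotated]) (simp, intro always_eventually allI continuous_on_sum cw)
  then have "continuous_on UNIV (\<lambda>x. inverse (ennreal (2 * (\<Sum>j. ?f j x))))"
    by (intro continuous_on_inverse_ennreal continuous_on_ennreal continuous_on_mult continuous_on_const)
  from continuous_on_compose2[OF continuous_on_minus_ennreal[of 1] this]
  show "continuous_on UNIV (\<lambda>x. decode x i)"
    unfolding decode_def by simp
qed

lemma borel_measurable_encode [measurable]: "encode \<in> borel_measurable borel"
proof -
  have c: "(\<lambda>\<phi>::nat \<Rightarrow> ennreal. \<phi> i) \<in> borel_measurable borel" for i
    by (rule borel_measurable_continuous_onI[OF continuous_on_coordinate])
  note [measurable] = c
  have [measurable]: "(\<lambda>v. binary_digit v j) \<in> borel_measurable borel" for j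
    unfolding binary_digit_def by measurable
  show ?thesis unfolding encode_def[abs_def] cantor_point_def by measurable
qed

text \<open>
  Every law on the sequence space is the image under \<open>decode\<close> of a law on \<open>[0, 1]\<close>. Helly's selection
  theorem on the line gives a convergent subsequence there, and continuity of \<open>decode\<close> transports the
  limit.
\<close>
lemma process_law_compactness:
  fixes N :: "nat \<Rightarrow> 'a measure"
  assumes N: "\<And>n. prob_space (N n)" and X: "\<And>n. X n \<in> borel_measurable (N n)"
  shows "\<exists>r P. strict_mono r \<and> process_law P \<and> converges_in_law (\<lambda>n. N (r n)) (\<lambda>n. X (r n)) P"
proof -
  define \<mu> where "\<mu> n = distr (N n) borel (\<lambda>x. encode (X n x))" for n
  have m[measurable]: "(\<lambda>x. encode (X n x)) \<in> borel_measurable (N n)" for n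
    using X by (rule measurable_compose) (rule borel_measurable_encode)
  have rd: "real_distribution (\<mu> n)" for n
  proof -
    interpret prob_space "N n" by (rule N)
    show ?thesis unfolding \<mu>_def by (rule real_distribution_distr) (rule m)
  qed
  have tight: "tight \<mu>"
    unfolding tight_def
  proof (intro conjI allI impI)
    fix e :: real assume e: "0 < e"
    have "measure (\<mu> n) {-1<..1} = 1" for n
    proof -
      interpret prob_space "N n" by (rule N)
      have "(\<lambda>x. encode (X n x)) -` {-1<..1} \<inter> space (N n) = space (N n)"
      proof -
        have "encode \<phi> \<in> {-1<..1}" for \<phi> using encode_bounds[of \<phi>] by simp
        then show ?thesis by auto
      qed
      then show ?thesis unfolding \<mu>_def by (subst measure_distr) (auto simp: prob_space)
    qed
    then show "\<exists>a b. a < b \<and> (\<forall>n. 1 - e < measure (\<mu> n) {a<..b})"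
      using e by (intro exI[of _ "-1"] exI[of _ 1]) auto
  qed (rule rd)
  from tight_imp_convergent_subsubsequence[OF tight strict_mono_id]
  obtain r L where r: "strict_mono r" and L: "real_distribution L" "weak_conv_m (\<mu> \<circ> id \<circ> r) L" by blast
  interpret L: real_distribution L by (rule L(1))
  have dm: "decode \<in> borel_measurable borel"
    by (rule borel_measurable_continuous_onI[OF continuous_on_decode])
  have dmL: "decode \<in> measurable L borel" using dm by simp
  define P where "P = distr L borel decode"
  have P: "process_law P" unfolding process_law_def P_def
    using L.prob_space_distr[OF dmL] by simp
  have "converges_in_law (\<lambda>n. N (r n)) (\<lambda>n. X (r n)) P"
    unfolding converges_in_law_def
  proof (intro allI impI)
    fix f :: "(nat \<Rightarrow> ennreal) \<Rightarrow> real"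
    assume f: "continuous_on UNIV f \<and> bounded (range f)"
    then obtain C where C: "\<And>\<phi>. norm (f \<phi>) \<le> C" unfolding bounded_iff by blast
    have fm: "f \<in> borel_measurable borel" using f borel_measurable_continuous_onI by blast
    let ?g = "\<lambda>x. f (decode x)"
    have g: "continuous_on UNIV ?g"
      using f by (intro continuous_on_compose2[OF _ continuous_on_decode]) auto
    have "(\<lambda>n. integral\<^sup>L ((\<mu> \<circ> id \<circ> r) n) ?g) \<longlonglongrightarrow> integral\<^sup>L L ?g"
    proof (rule weak_conv_imp_integral_bdd_continuous_conv[OF _ L(1) L(2)])
      show "isCont ?g x" for x using g by (simp add: continuous_on_eq_continuous_at)
      show "norm (?g x) \<le> C" for x by (rule C)
      show "real_distribution ((\<mu> \<circ> id \<circ> r) n)" for n by (simp add: rd)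
    qed
    moreover have "integral\<^sup>L ((\<mu> \<circ> id \<circ> r) n) ?g = (\<integral>x. f (X (r n) x) \<partial>N (r n))" for n
      unfolding \<mu>_def o_def id_def
      by (subst integral_distr[OF m]) (auto simp: decode_encode intro: measurable_compose[OF dm fm])
    moreover have "integral\<^sup>L L ?g = (\<integral>\<phi>. f \<phi> \<partial>P)"
      unfolding P_def by (rule integral_distr[symmetric, OF dmL fm])
    ultimately show "(\<lambda>n. \<integral>x. f (X (r n) x) \<partial>N (r n)) \<longlonglongrightarrow> (\<integral>\<phi>. f \<phi> \<partial>P)" by simp
  qed
  with r P show ?thesis by blast
qed

section \<open>Convergence in law\<close>

lemma converges_in_law_subseq:
  fixes X :: "nat \<Rightarrow> 'a \<Rightarrow> 'b::topological_space"
  assumes "converges_in_law N X P" "strict_mono r"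
  shows "converges_in_law (\<lambda>n. N (r n)) (\<lambda>n. X (r n)) P"
  unfolding converges_in_law_def
proof (intro allI impI)
  fix f :: "'b \<Rightarrow> real" assume f: "continuous_on UNIV f \<and> bounded (range f)"
  then have "(\<lambda>n. \<integral>x. f (X n x) \<partial>N n) \<longlonglongrightarrow> (\<integral>y. f y \<partial>P)"
    using assms(1) unfolding converges_in_law_def by blast
  from LIMSEQ_subseq_LIMSEQ[OF this assms(2)]
  show "(\<lambda>n. \<integral>x. f (X (r n) x) \<partial>N (r n)) \<longlonglongrightarrow> (\<integral>y. f y \<partial>P)" by (simp add: o_def)
qed

lemma converges_in_law_shift:
  "converges_in_law (\<lambda>n. N (n + k)) (\<lambda>n. X (n + k)) P \<longleftrightarrow> converges_in_law N X P"
  unfolding converges_in_law_def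
  using LIMSEQ_ignore_initial_segment[of "\<lambda>n. \<integral>x. f (X n x) \<partial>N n" for f]
    LIMSEQ_offset[of "\<lambda>n. \<integral>x. f (X n x) \<partial>N n" k for f] by blast

text \<open>
  A subsequence that stays away from the limit would itself have a convergent subsequence by
  compactness, and the limit of the latter would be \<open>P\<close>.
\<close>
lemma converges_in_law_if_unique_limit:
  assumes N: "\<And>n. prob_space (N n)" and X: "\<And>n. X n \<in> borel_measurable (N n)"
    and unique: "\<And>r Q. strict_mono r \<Longrightarrow> process_law Q \<Longrightarrow>
        converges_in_law (\<lambda>n. N (r n)) (\<lambda>n. X (r n)) Q \<Longrightarrow> Q = P"
  shows "converges_in_law N X P"
  unfolding converges_in_law_def
proof (intro allI impI)
  fix f :: "(nat \<Rightarrow> ennreal) \<Rightarrow> real" assume f: "continuous_on UNIV f \<and> bounded (range f)"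
  let ?a = "\<lambda>n. \<integral>x. f (X n x) \<partial>N n" and ?l = "\<integral>y. f y \<partial>P"
  show "?a \<longlonglongrightarrow> ?l"
  proof (rule ccontr)
    assume "\<not> ?a \<longlonglongrightarrow> ?l"
    then obtain e where e: "0 < e" "\<not> eventually (\<lambda>n. dist (?a n) ?l < e) sequentially"
      unfolding tendsto_iff by blast
    then have "infinite {n. \<not> dist (?a n) ?l < e}"
      by (simp add: frequently_cofinite[symmetric] cofinite_eq_sequentially frequently_def)
    then obtain r :: "nat \<Rightarrow> nat" where r: "strict_mono r" "\<And>n. \<not> dist (?a (r n)) ?l < e"
      using infinite_enumerate by blast
    from process_law_compactness[of "\<lambda>n. N (r n)" "\<lambda>n. X (r n)"] N X
    obtain q Q where q: "strict_mono q" and Q: "process_law Q"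
      and c: "converges_in_law (\<lambda>n. N (r (q n))) (\<lambda>n. X (r (q n))) Q" by blast
    have "Q = P"
      using unique[of "r \<circ> q" Q] strict_mono_o[OF r(1) q] Q c by (simp add: o_def)
    with c f have "(\<lambda>n. ?a (r (q n))) \<longlonglongrightarrow> ?l" unfolding converges_in_law_def by blast
    from tendstoD[OF this e(1)] have "\<exists>n. dist (?a (r (q n))) ?l < e"
      by (meson eventually_sequentially order_refl)
    with r(2) show False by blast
  qed
qed

lemma converges_in_law_lap_excess:
  assumes "converges_in_law N X P" "0 < s"
  shows "(\<lambda>n. \<integral>x. lap s (excess d \<delta> (X n x)) \<partial>N n) \<longlonglongrightarrow> lap_excess P d \<delta> s"
proof -
  have "bounded (range (\<lambda>\<phi>. lap s (excess d \<delta> \<phi>)))"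
    unfolding bounded_iff using assms(2) by (intro exI[of _ 1]) auto
  then show ?thesis using assms continuous_on_lap_excess[OF assms(2)] unfolding converges_in_law_def by blast
qed

text \<open>
  The defect \<open>max 0 (exp (- \<phi> (Suc i)) - exp (- \<phi> i))\<close> is continuous and vanishes precisely when
  \<open>\<phi> i \<le> \<phi> (Suc i)\<close>; its expectation passes to the limit.
\<close>
lemma limit_law_monotone:
  assumes conv: "converges_in_law N X P" and P: "process_law P"
    and mono: "\<And>n x. X n x \<in> monotone_seqs"
  shows "monotone_process_law P"
proof -
  interpret prob_space P using P by (simp add: process_lawD)
  have "AE \<phi> in P. \<phi> i \<le> \<phi> (Suc i)" for i
  proof -
    let ?f = "\<lambda>\<phi>::nat \<Rightarrow> ennreal. max 0 (lap 1 (\<phi> (Suc i)) - lap 1 (\<phi> i))"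
    have c: "continuous_on UNIV ?f"
      by (intro continuous_on_max continuous_on_diff continuous_on_const
          continuous_on_compose2[OF continuous_on_lap continuous_on_coordinate]) auto
    have b: "norm (?f \<phi>) \<le> 1" for \<phi>
      using lap_le_1[of 1 "\<phi> (Suc i)"] lap_nonneg[of 1 "\<phi> i"] by (simp del: lap_nonneg lap_le_1)
    then have "bounded (range ?f)" unfolding bounded_iff by blast
    with c conv have l: "(\<lambda>n. \<integral>x. ?f (X n x) \<partial>N n) \<longlonglongrightarrow> (\<integral>\<phi>. ?f \<phi> \<partial>P)"
      unfolding converges_in_law_def by blast
    have "?f (X n x) = 0" for n x
      using mono[of n x] lap_antimono[of 1 "X n x i" "X n x (Suc i)"] by (auto simp: monotone_seqs_def)
    with l have z: "(\<integral>\<phi>. ?f \<phi> \<partial>P) = 0" by (simp add: LIMSEQ_const_iff)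
    have fm: "?f \<in> borel_measurable P"
      using borel_measurable_continuous_onI[OF c] process_lawD(2)[OF P] by (metis measurable_cong_sets)
    have "integrable P ?f" using fm b by (intro integrable_const_bound[where B=1]) auto
    then have "AE \<phi> in P. ?f \<phi> = 0" using z by (subst (asm) integral_nonneg_eq_0_iff_AE) auto
    then show ?thesis
    proof eventually_elim
      case (elim \<phi>)
      then have le: "lap 1 (\<phi> (Suc i)) \<le> lap 1 (\<phi> i)" by simp
      show ?case
      proof (rule ccontr)
        assume "\<not> \<phi> i \<le> \<phi> (Suc i)"
        then have lt: "\<phi> (Suc i) < \<phi> i" by simp
        then have "lap 1 (\<phi> i) < lap 1 (\<phi> (Suc i))"
          by (cases "\<phi> i"; cases "\<phi> (Suc i)") (auto simp: lap_ennreal ennreal_less_iff)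
        with le show False by simp
      qed
    qed
  qed
  then have "AE \<phi> in P. \<forall>i. \<phi> i \<le> \<phi> (Suc i)" by (simp add: AE_all_countable)
  with P show ?thesis by (simp add: monotone_process_law_def monotone_seqs_def)
qed

section \<open>Mittag-Leffler waiting times\<close>

text \<open>
  The Taylor coefficients of \<open>(1 - z) powr \<alpha>\<close>. For \<open>0 < \<alpha> \<le> 1\<close> those of index
  \<open>k \<ge> 1\<close> are nonpositive, and their negatives are the weights of the Sibuya distribution.
\<close>
definition powr_coeff :: "real \<Rightarrow> nat \<Rightarrow> real" where
  "powr_coeff \<alpha> k = pochhammer (- \<alpha>) k / fact k"

lemma powr_coeff_0 [simp]: "powr_coeff \<alpha> 0 = 1" by (simp add: powr_coeff_def)

lemma powr_coeff_nonpos: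
  assumes "0 < \<alpha>" "\<alpha> \<le> 1"
  shows "powr_coeff \<alpha> (Suc k) \<le> 0"
proof -
  have "pochhammer (- \<alpha>) (Suc k) \<le> 0"
  proof (induction k)
    case 0 then show ?case using assms by simp
  next
    case (Suc k)
    have "pochhammer (- \<alpha>) (Suc (Suc k)) = pochhammer (- \<alpha>) (Suc k) * (- \<alpha> + real (Suc k))"
      by (rule pochhammer_Suc)
    also have "\<dots> \<le> 0" using Suc assms by (intro mult_nonpos_nonneg) auto
    finally show ?case .
  qed
  then show ?thesis by (simp add: powr_coeff_def divide_le_0_iff)
qed

lemma powr_coeff_sums:
  assumes "0 \<le> z" "z < (1::real)"
  shows "(\<lambda>k. powr_coeff \<alpha> k * z ^ k) sums ((1 - z) powr \<alpha>)"
proof -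
  have "(\<lambda>k. (\<alpha> gchoose k) * (- z) ^ k) sums ((1 + - z) powr \<alpha>)"
    using assms by (intro gen_binomial_real) auto
  moreover have "(\<alpha> gchoose k) * (- z) ^ k = powr_coeff \<alpha> k * z ^ k" for k
  proof -
    have "(-1::real) ^ k * (- z) ^ k = z ^ k" by (simp add: power_mult_distrib [symmetric])
    then show ?thesis by (simp add: gbinomial_pochhammer powr_coeff_def)
  qed
  ultimately show ?thesis by simp
qed

lemma powr_coeff_abs_summable:
  assumes \<alpha>: "0 < \<alpha>" "\<alpha> \<le> 1" and z: "0 \<le> z" "z < (1::real)"
  shows "summable (\<lambda>k. norm (powr_coeff \<alpha> k * z ^ k))"
proof -
  have "norm (powr_coeff \<alpha> k * z ^ k) = (if k = 0 then 2 else 0) - powr_coeff \<alpha> k * z ^ k" for k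
  proof (cases k)
    case (Suc j)
    have "powr_coeff \<alpha> (Suc j) * z ^ Suc j \<le> 0" using powr_coeff_nonpos[OF \<alpha>, of j] z by (intro mult_nonpos_nonneg) auto
    then show ?thesis using Suc by simp
  qed simp
  moreover have "summable (\<lambda>k. (if k = 0 then 2 else 0) - powr_coeff \<alpha> k * z ^ k)"
    by (intro summable_diff sums_summable[OF powr_coeff_sums[OF z]] summable_finite[of "{0}"]) auto
  ultimately show ?thesis by simp
qed

lemma powr_coeff_partial_sum:
  assumes \<alpha>: "0 < \<alpha>" "\<alpha> \<le> 1"
  shows "(\<Sum>k=1..n. - powr_coeff \<alpha> k) \<le> 1"
proof -
  let ?z = "\<lambda>m. 1 - inverse (real (Suc m))"
  have "(\<lambda>m. \<Sum>k=1..n. - powr_coeff \<alpha> k * ?z m ^ k) \<longlonglongrightarrow> (\<Sum>k=1..n. - powr_coeff \<alpha> k * (1 - 0) ^ k)"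
    by (intro tendsto_intros LIMSEQ_inverse_real_of_nat)
  moreover have "(\<Sum>k=1..n. - powr_coeff \<alpha> k * ?z m ^ k) \<le> 1" for m
  proof -
    let ?w = "?z m"
    have z: "0 \<le> ?w" "?w < 1" by (auto simp: inverse_eq_divide)
    have nn: "0 \<le> - powr_coeff \<alpha> (Suc k) * ?w ^ Suc k" for k
      using powr_coeff_nonpos[OF \<alpha>, of k] z by (intro mult_nonneg_nonneg zero_le_power) auto
    have s: "(\<lambda>k. powr_coeff \<alpha> (Suc k) * ?w ^ Suc k) sums ((1 - ?w) powr \<alpha> - 1)"
      using powr_coeff_sums[OF z, of \<alpha>] sums_Suc_iff[of "\<lambda>k. powr_coeff \<alpha> k * ?w ^ k"] by simp
    have s': "(\<lambda>k. - powr_coeff \<alpha> (Suc k) * ?w ^ Suc k) sums (1 - (1 - ?w) powr \<alpha>)"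
      using sums_minus[OF s] by simp
    have "(\<Sum>k=1..n. - powr_coeff \<alpha> k * ?w ^ k) = (\<Sum>k<n. - powr_coeff \<alpha> (Suc k) * ?w ^ Suc k)"
      by (rule sum.reindex_bij_witness[of _ Suc "\<lambda>k. k - 1"]) auto
    also have "\<dots> \<le> 1 - (1 - ?w) powr \<alpha>"
      using sum_le_suminf[OF sums_summable[OF s'], of "{..<n}"] nn sums_unique[OF s'] by simp
    also have "\<dots> \<le> 1" by simp
    finally show ?thesis .
  qed
  ultimately have "(\<Sum>k=1..n. - powr_coeff \<alpha> k * (1 - 0) ^ k) \<le> 1"
    by (intro LIMSEQ_le_const2[OF _ exI[of _ 0]]) auto
  then show ?thesis by simp
qed

text \<open>
  The law of a geometric sum of Sibuya variables. Its weights are the coefficients \<open>c\<close> of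
  \<open>q / (q + (1 - z) powr \<alpha>)\<close>; comparing coefficients gives a recursion with nonnegative terms, which
  yields \<open>0 \<le> c k \<le> 1\<close>. The total mass is the limit of the generating function as \<open>z\<close> tends to 1.
\<close>
lemma discrete_waiting_law:
  assumes \<alpha>: "0 < \<alpha>" "\<alpha> \<le> 1" and q: "0 < q"
  obtains c :: "nat \<Rightarrow> real" where "\<And>k. 0 \<le> c k" "c sums 1"
    "\<And>z. 0 \<le> z \<Longrightarrow> z < 1 \<Longrightarrow> (\<lambda>k. c k * z ^ k) sums (q / (q + (1 - z) powr \<alpha>))"
proof -
  \<comment> \<open>D is the power series of q + (1 - z) powr \<alpha>, and C is q divided by
    it.\<close>
  define D where "D = fps_const q + Abs_fps (powr_coeff \<alpha>)"
  define C where "C = fps_const q * inverse D"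
  define c where "c k = fps_nth C k" for k
  have D0: "fps_nth D 0 = q + 1" and DS: "fps_nth D (Suc k) = powr_coeff \<alpha> (Suc k)" for k
    by (simp_all add: D_def)
  have CD: "C * D = fps_const q"
    unfolding C_def using inverse_mult_eq_1[of D] D0 q by (simp add: mult.assoc)
  have conv: "(\<Sum>i\<le>n. c i * fps_nth D (n - i)) = (if n = 0 then q else 0)" for n
    using arg_cong[OF CD, of "\<lambda>f. fps_nth f n"] unfolding fps_mult_nth c_def
    by (simp add: atLeast0AtMost)
  have c0: "c 0 = q / (q + 1)" using conv[of 0] D0 q by (simp add: field_simps)
  have rec: "c n * (q + 1) = (\<Sum>i<n. c i * - powr_coeff \<alpha> (n - i))" if "0 < n" for n
  proof -
    have "(\<Sum>i<n. c i * fps_nth D (n - i)) + c n * (q + 1) = 0"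
      using conv[of n] that by (simp add: lessThan_Suc_atMost[symmetric] D0)
    moreover have "(\<Sum>i<n. c i * fps_nth D (n - i)) = (\<Sum>i<n. c i * powr_coeff \<alpha> (n - i))"
      by (intro sum.cong refl) (metis DS Suc_diff_Suc lessThan_iff)
    ultimately show ?thesis by (simp add: sum_negf)
  qed
  have w: "0 \<le> - powr_coeff \<alpha> (n - i)" if "i < n" for i n
    using powr_coeff_nonpos[OF \<alpha>, of "n - Suc i"] that by (simp add: Suc_diff_Suc)
  have c_bounds: "0 \<le> c n \<and> c n \<le> 1" for n
  proof (induction n rule: less_induct)
    case (less n)
    show ?case
    proof (cases "n = 0")
      case True then show ?thesis using c0 q by simp
    next
      case False
      then have n: "0 < n" by simp
      have lo: "0 \<le> c n * (q + 1)" unfolding rec[OF n]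
        using less w by (intro sum_nonneg mult_nonneg_nonneg) auto
      have "c n * (q + 1) \<le> (\<Sum>i<n. 1 * - powr_coeff \<alpha> (n - i))" unfolding rec[OF n]
        using less w by (intro sum_mono mult_right_mono) auto
      also have "\<dots> = (\<Sum>k=1..n. - powr_coeff \<alpha> k)"
        by (rule sum.reindex_bij_witness[of _ "\<lambda>k. n - k" "\<lambda>i. n - i"]) auto
      also have "\<dots> \<le> 1" by (rule powr_coeff_partial_sum[OF \<alpha>])
      finally have hi: "c n * (q + 1) \<le> 1" .
      have "0 \<le> c n" using lo q by (simp add: zero_le_mult_iff)
      moreover have "c n \<le> c n * (q + 1)" using \<open>0 \<le> c n\<close> q by (simp add: algebra_simps)
      ultimately show ?thesis using hi by simp
    qed
  qed
  have G: "(\<lambda>k. c k * z ^ k) sums (q / (q + (1 - z) powr \<alpha>))" if z: "0 \<le> z" "z < 1" for z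
  proof -
    have a: "summable (\<lambda>k. norm (c k * z ^ k))"
    proof (rule summable_comparison_test'[of "\<lambda>k. z ^ k" 0])
      show "summable (\<lambda>k. z ^ k)" using z by (intro summable_geometric) auto
      show "norm (norm (c k * z ^ k)) \<le> z ^ k" for k
        using c_bounds[of k] z by (simp add: abs_mult mult_left_le_one_le)
    qed
    have Ds: "(\<lambda>k. fps_nth D k * z ^ k) sums (q + (1 - z) powr \<alpha>)"
    proof -
      have "(\<lambda>k. (if k = 0 then q else 0) + powr_coeff \<alpha> k * z ^ k) sums (q + (1 - z) powr \<alpha>)"
        using sums_add[OF sums_single[of 0 "\<lambda>_. q"] powr_coeff_sums[OF z, of \<alpha>]] by simp
      moreover have "(if k = 0 then q else 0) + powr_coeff \<alpha> k * z ^ k = fps_nth D k * z ^ k" for k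
        by (cases k) (auto simp: D0 DS)
      ultimately show ?thesis by simp
    qed
    have b: "summable (\<lambda>k. norm (fps_nth D k * z ^ k))"
    proof (rule summable_comparison_test'[of "\<lambda>k. (if k = 0 then q else 0) + norm (powr_coeff \<alpha> k * z ^ k)" 0])
      show "summable (\<lambda>k. (if k = 0 then q else 0) + norm (powr_coeff \<alpha> k * z ^ k))"
        by (intro summable_add powr_coeff_abs_summable[OF \<alpha> z] summable_finite[of "{0}"]) auto
      show "norm (norm (fps_nth D k * z ^ k)) \<le> (if k = 0 then q else 0) + norm (powr_coeff \<alpha> k * z ^ k)" for k
        using q by (cases k) (auto simp: D0 DS)
    qed
    have "(\<lambda>k. \<Sum>i\<le>k. (c i * z ^ i) * (fps_nth D (k - i) * z ^ (k - i)))
        sums ((\<Sum>k. c k * z ^ k) * (\<Sum>k. fps_nth D k * z ^ k))"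
      by (rule Cauchy_product_sums[OF a b])
    moreover have "(\<Sum>i\<le>k. (c i * z ^ i) * (fps_nth D (k - i) * z ^ (k - i))) = (if k = 0 then q else 0)" for k
    proof -
      have "(\<Sum>i\<le>k. (c i * z ^ i) * (fps_nth D (k - i) * z ^ (k - i)))
        = (\<Sum>i\<le>k. z ^ k * (c i * fps_nth D (k - i)))"
        by (intro sum.cong refl) (simp add: power_add [symmetric] mult_ac)
      also have "\<dots> = z ^ k * (if k = 0 then q else 0)"
        by (simp only: sum_distrib_left [symmetric] conv)
      finally show ?thesis by simp
    qed
    ultimately have "(\<lambda>k. if k = 0 then q else 0) sums ((\<Sum>k. c k * z ^ k) * (q + (1 - z) powr \<alpha>))"
      using sums_unique[OF Ds] by simp
    then have "(\<Sum>k. c k * z ^ k) * (q + (1 - z) powr \<alpha>) = q"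
      using sums_single[of 0 "\<lambda>_. q"] sums_unique2 by blast
    moreover have "0 < q + (1 - z) powr \<alpha>" using q z by (intro add_pos_nonneg) auto
    ultimately have "(\<Sum>k. c k * z ^ k) = q / (q + (1 - z) powr \<alpha>)"
      by (simp add: field_simps)
    then show ?thesis using summable_sums[OF summable_norm_cancel[OF a]] by simp
  qed
  let ?z = "\<lambda>m. 1 - inverse (real (Suc m))"
  have z: "0 \<le> ?z m" "?z m < 1" for m by (auto simp: inverse_eq_divide)
  have part: "(\<Sum>k<n. c k) \<le> 1" for n
  proof -
    have "(\<lambda>m. \<Sum>k<n. c k * ?z m ^ k) \<longlonglongrightarrow> (\<Sum>k<n. c k * (1 - 0) ^ k)"
      by (intro tendsto_intros LIMSEQ_inverse_real_of_nat)
    moreover have "(\<Sum>k<n. c k * ?z m ^ k) \<le> 1" for m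
    proof -
      have "(\<Sum>k<n. c k * ?z m ^ k) \<le> q / (q + (1 - ?z m) powr \<alpha>)"
        using sum_le_suminf[OF sums_summable[OF G[OF z, of m]], of "{..<n}"] sums_unique[OF G[OF z, of m]]
          c_bounds z(1)[of m] by simp
      also have "\<dots> \<le> 1" using q by (simp add: divide_le_eq_1 add_pos_nonneg)
      finally show ?thesis .
    qed
    ultimately have "(\<Sum>k<n. c k * (1 - 0) ^ k) \<le> 1"
      by (intro LIMSEQ_le_const2[OF _ exI[of _ 0]]) auto
    then show ?thesis by simp
  qed
  have sc: "summable c" by (rule summableI_nonneg_bounded[OF _ part]) (use c_bounds in auto)
  have "suminf c \<le> 1" by (rule suminf_le_const[OF sc part])
  moreover have "1 \<le> suminf c"
  proof -
    have "(\<lambda>m. q / (q + (1 - ?z m) powr \<alpha>)) \<longlonglongrightarrow> q / (q + 0)"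
    proof (intro tendsto_intros)
      have "(\<lambda>m. inverse (real (Suc m)) powr \<alpha>) \<longlonglongrightarrow> 0 powr \<alpha>"
        by (rule tendsto_powr'[OF LIMSEQ_inverse_real_of_nat tendsto_const]) (use \<alpha> in auto)
      then show "(\<lambda>m. (1 - ?z m) powr \<alpha>) \<longlonglongrightarrow> 0" by simp
    qed (use q in auto)
    moreover have "q / (q + (1 - ?z m) powr \<alpha>) \<le> suminf c" for m
    proof -
      have "(\<Sum>k. c k * ?z m ^ k) \<le> suminf c"
        by (rule suminf_le[OF _ sums_summable[OF G[OF z]] sc])
           (use c_bounds z(1)[of m] z(2)[of m] in \<open>auto intro!: mult_right_le_one_le power_le_one\<close>)
      then show ?thesis using sums_unique[OF G[OF z, of m]] by simp
    qed
    ultimately have "q / (q + 0) \<le> suminf c"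
      by (intro LIMSEQ_le_const2[OF _ exI[of _ 0]]) auto
    then show ?thesis using q by simp
  qed
  ultimately have "c sums 1" using sc by (simp add: sums_iff)
  then show ?thesis using that[of c] c_bounds G by blast
qed

lemma discrete_law_integral:
  fixes f :: "nat \<Rightarrow> real"
  assumes c: "\<And>k. 0 \<le> c k" "c sums 1" and f: "\<And>k. 0 \<le> f k" "\<And>k. f k \<le> 1"
  defines "N \<equiv> density (count_space UNIV) (\<lambda>k. ennreal (c k))"
  shows "prob_space N" "(\<integral>k. f k \<partial>N) = (\<Sum>k. c k * f k)"
proof -
  have sc: "summable c" using c(2) by (rule sums_summable)
  show "prob_space N"
  proof
    have "emeasure N (space N) = (\<Sum>k. ennreal (c k))"
      by (simp add: N_def emeasure_density nn_integral_count_space_nat)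
    also have "\<dots> = ennreal (suminf c)" by (rule suminf_ennreal2[OF c(1) sc])
    finally show "emeasure N (space N) = 1" using sums_unique[OF c(2)] by simp
  qed
  have "(\<integral>k. f k \<partial>N) = (\<integral>k. c k * f k \<partial>count_space UNIV)"
    unfolding N_def using c(1) by (subst integral_density) auto
  also have "\<dots> = (\<Sum>k. c k * f k)"
  proof (rule integral_count_space_nat)
    have "summable (\<lambda>k. norm (c k * f k))"
      by (rule summable_comparison_test'[OF sc, of 0]) (use c(1) f in \<open>auto intro!: mult_left_le\<close>)
    then show "integrable (count_space UNIV) (\<lambda>k. c k * f k)" by (simp add: integrable_count_space_nat_iff)
  qed
  finally show "(\<integral>k. f k \<partial>N) = (\<Sum>k. c k * f k)" .
qed

text \<open>
  Rescale the discrete laws by \<open>1 / m\<close> with \<open>q = l / m powr \<alpha>\<close>. The generating function at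
  \<open>z = exp (- s / m)\<close> is \<open>l / (l + (m * (1 - z)) powr \<alpha>)\<close>, which tends to \<open>l / (l + s powr \<alpha>)\<close>. A
  subsequential limit exists in \<open>[0, \<infinity>]\<close>; it has no mass at infinity because its Laplace transform
  tends to 1 as \<open>s\<close> tends to 0.
\<close>
lemma waiting_law_exists:
  assumes \<alpha>: "0 < \<alpha>" "\<alpha> \<le> 1" and l: "0 < l"
  shows "\<exists>H. is_waiting_law \<alpha> l H"
proof -
  let ?q = "\<lambda>n. l * inverse (real (Suc n)) powr \<alpha>"
  have "\<exists>c :: nat \<Rightarrow> real. (\<forall>k. 0 \<le> c k) \<and> c sums 1 \<and>
      (\<forall>z. 0 \<le> z \<longrightarrow> z < 1 \<longrightarrow> (\<lambda>k. c k * z ^ k) sums (?q n / (?q n + (1 - z) powr \<alpha>)))" for n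
  proof -
    have "0 < ?q n" using l by simp
    from discrete_waiting_law[OF \<alpha> this] show ?thesis by metis
  qed
  then obtain c :: "nat \<Rightarrow> nat \<Rightarrow> real" where c: "\<And>n k. 0 \<le> c n k" "\<And>n. c n sums 1"
    "\<And>n z. 0 \<le> z \<Longrightarrow> z < 1 \<Longrightarrow> (\<lambda>k. c n k * z ^ k) sums (?q n / (?q n + (1 - z) powr \<alpha>))"
    by metis
  define N where "N n = density (count_space UNIV) (\<lambda>k. ennreal (c n k))" for n
  \<comment> \<open>Constant sequences: the compactness result is applied to the single
    coordinate 0.\<close>
  define X where "X n k = (\<lambda>i::nat. ennreal (real k * inverse (real (Suc n))))" for n k
  have pN: "prob_space (N n)" for n
    unfolding N_def using discrete_law_integral(1)[OF c(1,2), of "\<lambda>_. 1"] by simp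
  have "\<exists>r P. strict_mono r \<and> process_law P \<and> converges_in_law (\<lambda>n. N (r n)) (\<lambda>n. X (r n)) P"
    by (rule process_law_compactness[OF pN]) (simp add: N_def)
  then obtain r P where r: "strict_mono r" and P: "process_law P"
    and conv: "converges_in_law (\<lambda>n. N (r n)) (\<lambda>n. X (r n)) P" by blast
  interpret P: prob_space P using P by (simp add: process_lawD)
  have m0[measurable]: "(\<lambda>\<phi>. \<phi> 0) \<in> borel_measurable P"
    using borel_measurable_continuous_onI[OF continuous_on_coordinate[of 0]] process_lawD(2)[OF P]
    by (metis measurable_cong_sets)
  have lap: "(\<integral>\<phi>. lap s (\<phi> 0) \<partial>P) = l / (l + s powr \<alpha>)" if s: "0 < s" for s
  proof -
    let ?m = "\<lambda>n. inverse (real (Suc n))"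
    have "bounded (range (\<lambda>\<phi>::nat \<Rightarrow> ennreal. lap s (\<phi> 0)))"
      unfolding bounded_iff using s by (intro exI[of _ 1]) auto
    moreover have "continuous_on UNIV (\<lambda>\<phi>::nat \<Rightarrow> ennreal. lap s (\<phi> 0))"
      by (rule continuous_on_compose2[OF continuous_on_lap[OF s] continuous_on_coordinate]) auto
    ultimately have A: "(\<lambda>n. \<integral>k. lap s (X (r n) k 0) \<partial>N (r n)) \<longlonglongrightarrow> (\<integral>\<phi>. lap s (\<phi> 0) \<partial>P)"
      using conv unfolding converges_in_law_def by blast
    have val: "(\<integral>k. lap s (X n k 0) \<partial>N n) = l / (l + ((1 - exp (- (s * ?m n))) / ?m n) powr \<alpha>)" for n
    proof -
      let ?z = "exp (- (s * ?m n))"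
      have z: "0 \<le> ?z" "?z < 1" using s by auto
      have "(\<integral>k. lap s (X n k 0) \<partial>N n) = (\<Sum>k. c n k * lap s (X n k 0))"
        unfolding N_def using s by (intro discrete_law_integral(2) c) auto
      also have "\<dots> = (\<Sum>k. c n k * ?z ^ k)"
        by (intro suminf_cong) (simp add: X_def lap_ennreal exp_of_nat_mult [symmetric] mult_ac)
      also have "\<dots> = ?q n / (?q n + (1 - ?z) powr \<alpha>)"
        using c(3)[OF z, of n] by (simp add: sums_iff)
      also have "\<dots> = l / (l + ((1 - ?z) / ?m n) powr \<alpha>)"
      proof -
        have "0 < ?m n powr \<alpha>" by simp
        moreover have "((1 - ?z) / ?m n) powr \<alpha> = (1 - ?z) powr \<alpha> / ?m n powr \<alpha>"
          by (rule powr_divide)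
        moreover have "a * w / (a * w + u) = a / (a + u / w)" if "0 < w" for a w u :: real
          using that by (simp add: add_divide_distrib[symmetric] divide_simps)
        ultimately show ?thesis by metis
      qed
      finally show ?thesis .
    qed
    have B: "(\<lambda>n. l / (l + ((1 - exp (- (s * ?m (r n)))) / ?m (r n)) powr \<alpha>)) \<longlonglongrightarrow> l / (l + s powr \<alpha>)"
    proof (intro tendsto_intros)
      have "((\<lambda>x. 1 - exp (- (s * x))) has_real_derivative s) (at 0)"
        by (auto intro!: derivative_eq_intros)
      then have "((\<lambda>h. (1 - exp (- (s * h))) / h) \<longlongrightarrow> s) (at 0)"
        by (simp add: has_field_derivative_iff)
      moreover have "filterlim ?m (at 0) sequentially"
        using LIMSEQ_inverse_real_of_nat by (auto simp: filterlim_at)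
      ultimately have "(\<lambda>n. (1 - exp (- (s * ?m n))) / ?m n) \<longlonglongrightarrow> s" by (rule filterlim_compose)
      from LIMSEQ_subseq_LIMSEQ[OF this r]
      show "(\<lambda>n. (1 - exp (- (s * ?m (r n)))) / ?m (r n)) \<longlonglongrightarrow> s" by (simp add: o_def)
      show "l + s powr \<alpha> \<noteq> 0" using l by (metis add_pos_nonneg less_irrefl powr_ge_zero)
    qed (use s in auto)
    show ?thesis by (rule LIMSEQ_unique[OF A[unfolded val] B])
  qed
  have fin: "AE \<phi> in P. \<phi> 0 < \<top>"
  proof -
    let ?s = "\<lambda>n. inverse (real (Suc n))"
    have sp: "0 < ?s n" for n by simp
    note [measurable] = borel_measurable_lap[OF sp]
    have "(\<lambda>n. \<integral>\<phi>. lap (?s n) (\<phi> 0) \<partial>P) \<longlonglongrightarrow> (\<integral>\<phi>. indicator {\<phi>\<in>space P. \<phi> 0 < \<top>} \<phi> \<partial>P)"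
    proof (rule integral_dominated_convergence[where w="\<lambda>_. 1"])
      show "AE \<phi> in P. (\<lambda>n. lap (?s n) (\<phi> 0)) \<longlonglongrightarrow> indicator {\<phi>\<in>space P. \<phi> 0 < \<top>} \<phi>"
      proof (rule AE_I2)
        fix \<phi> :: "nat \<Rightarrow> ennreal" assume sp: "\<phi> \<in> space P"
        show "(\<lambda>n. lap (?s n) (\<phi> 0)) \<longlonglongrightarrow> indicator {\<phi>\<in>space P. \<phi> 0 < \<top>} \<phi>"
        proof (cases "\<phi> 0")
          case (real x)
          have "(\<lambda>n. exp (- ?s n * x)) \<longlonglongrightarrow> exp (- 0 * x)"
            by (intro tendsto_intros LIMSEQ_inverse_real_of_nat)
          then show ?thesis using real sp by (simp add: lap_ennreal)
        qed simp
      qed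
    qed (auto simp: less_imp_le)
    moreover have "(\<lambda>n. \<integral>\<phi>. lap (?s n) (\<phi> 0) \<partial>P) \<longlonglongrightarrow> l / (l + 0)"
      unfolding lap[OF sp]
    proof (intro tendsto_intros)
      have "(\<lambda>m. inverse (real (Suc m)) powr \<alpha>) \<longlonglongrightarrow> 0 powr \<alpha>"
        by (rule tendsto_powr'[OF LIMSEQ_inverse_real_of_nat tendsto_const]) (use \<alpha> in auto)
      then show "(\<lambda>m. inverse (real (Suc m)) powr \<alpha>) \<longlonglongrightarrow> 0" by simp
    qed (use l in auto)
    ultimately have "(\<integral>\<phi>. indicator {\<phi>\<in>space P. \<phi> 0 < \<top>} \<phi> \<partial>P) = l / (l + 0)" by (rule LIMSEQ_unique)
    then have "P.prob {\<phi>\<in>space P. \<phi> 0 < \<top>} = 1" using l by (simp add: Collect_conj_eq Int_absorb1)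
    then show ?thesis by (subst (asm) P.prob_Collect_eq_1) auto
  qed
  define H where "H = distr P borel (\<lambda>\<phi>. enn2real (\<phi> 0))"
  have "is_waiting_law \<alpha> l H"
    unfolding is_waiting_law_def
  proof (intro conjI allI impI)
    show "prob_space H" unfolding H_def by (rule P.prob_space_distr) measurable
    show "sets H = sets borel" by (simp add: H_def)
    show "AE x in H. 0 \<le> x" unfolding H_def by (subst AE_distr_iff) auto
    fix s :: real assume "0 \<le> s"
    show "(\<integral>x. exp (- s * x) \<partial>H) = l / (l + s powr \<alpha>)"
    proof (cases "s = 0")
      case True
      interpret H: prob_space H by fact
      show ?thesis using True l by (simp add: H.prob_space)
    next
      case False
      with \<open>0 \<le> s\<close> have s: "0 < s" by simp
      note [measurable] = borel_measurable_lap[OF s]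
      have "(\<integral>x. exp (- s * x) \<partial>H) = (\<integral>\<phi>. exp (- s * enn2real (\<phi> 0)) \<partial>P)"
        unfolding H_def by (rule integral_distr) measurable
      also have "\<dots> = (\<integral>\<phi>. lap s (\<phi> 0) \<partial>P)"
        by (rule Bochner_Integration.integral_cong_AE) (use fin in \<open>auto simp: lap_def\<close>)
      finally show ?thesis using lap[OF s] by simp
    qed
  qed
  then show ?thesis by blast
qed

lemma waiting_law_unique:
  assumes H: "is_waiting_law \<alpha> l H" and H': "is_waiting_law \<alpha> l H'"
  shows "H = H'"
proof -
  have pr: "prob_space K" "sets K = sets borel" "AE x in K. 0 \<le> x" "space K = UNIV"
    if "is_waiting_law \<alpha> l K" for K
    using that sets_eq_imp_space_eq[of K borel] by (auto simp: is_waiting_law_def)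
  have m: "ennreal \<in> borel_measurable K" if "is_waiting_law \<alpha> l K" for K
    using pr(2)[OF that] by (metis measurable_cong_sets measurable_ennreal)
  have L: "(\<integral>x. lap (real k) (ennreal x) \<partial>K) = l / (l + real k powr \<alpha>)" if "is_waiting_law \<alpha> l K" "1 \<le> k" for K k
  proof -
    have "(\<integral>x. lap (real k) (ennreal x) \<partial>K) = (\<integral>x. exp (- real k * x) \<partial>K)"
    proof (rule Bochner_Integration.integral_cong_AE)
      have "0 < real k" using that(2) by simp
      then show "(\<lambda>x. lap (real k) (ennreal x)) \<in> borel_measurable K"
        by (intro measurable_compose[OF m[OF that(1)] borel_measurable_lap])
      show "(\<lambda>x. exp (- real k * x)) \<in> borel_measurable K"
        unfolding measurable_cong_sets[OF pr(2)[OF that(1)] refl] by measurable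
    qed (use pr(3)[OF that(1)] in \<open>auto simp: lap_ennreal\<close>)
    then show ?thesis using that(1) by (simp add: is_waiting_law_def)
  qed
  have "cdf H t = cdf H' t" for t
  proof (cases "0 \<le> t")
    case True
    have "measure H {x \<in> space H. ennreal x \<le> ennreal t} = measure H' {x \<in> space H'. ennreal x \<le> ennreal t}"
      by (rule distribution_function_unique[OF pr(1)[OF H] m[OF H] pr(1)[OF H'] m[OF H'] _ True])
         (simp add: L H H')
    moreover have "{x \<in> space K. ennreal x \<le> ennreal t} = {..t}" if "is_waiting_law \<alpha> l K" for K
      using pr(4)[OF that] True by (auto simp: ennreal_le_iff)
    ultimately show ?thesis by (simp add: cdf_def H H')
  next
    case False
    have "cdf K t = 0" if "is_waiting_law \<alpha> l K" for K
    proof -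
      interpret prob_space K by (rule pr(1)[OF that])
      have "AE x in K. x \<notin> {..t}" using pr(3)[OF that] by (rule AE_mp) (rule AE_I2, use False in auto)
      then have "prob {..t} = 0" using pr(2)[OF that] by (subst prob_eq_0) auto
      then show ?thesis by (simp add: cdf_def)
    qed
    then show ?thesis using H H' by simp
  qed
  moreover have "real_distribution K" if "is_waiting_law \<alpha> l K" for K
    using pr[OF that] by (simp add: real_distribution_def real_distribution_axioms_def)
  ultimately show ?thesis using H H' by (intro cdf_unique) auto
qed

lemma waiting_law: "0 < \<alpha> \<Longrightarrow> \<alpha> \<le> 1 \<Longrightarrow> 0 < l \<Longrightarrow> is_waiting_law \<alpha> l (waiting_law \<alpha> l)"
  unfolding waiting_law_def using waiting_law_exists waiting_law_unique by (metis theI)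

section \<open>The fractional Poisson process\<close>

text \<open>
  Splitting off the first waiting time leaves an independent copy of the process, shifted by that
  time, and \<open>excess\<close> turns the shift into an additive term.
\<close>
lemma FPP_law_props:
  assumes \<alpha>: "0 < \<alpha>" "\<alpha> \<le> 1" and l: "0 < l"
  shows FPP_monotone: "monotone_process_law (FPP_law \<alpha> l)"
    and FPP_renewal: "\<delta> 0 = 0 \<Longrightarrow> 0 < s \<Longrightarrow> lap_excess (FPP_law \<alpha> l) (Suc d) \<delta> s =
       l / (l + s powr \<alpha>) * lap_excess (FPP_law \<alpha> l) d (\<lambda>i. \<delta> (Suc i)) s"
proof -
  let ?W = "waiting_law \<alpha> l"
  let ?S = "\<Pi>\<^sub>M k\<in>(UNIV :: nat set). ?W"
  let ?F = "\<lambda>\<omega> i. \<Sum>k\<le>i. ennreal (\<omega> k)"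
  have W: "is_waiting_law \<alpha> l ?W" by (rule waiting_law[OF assms])
  then have pW: "prob_space ?W" and sW: "sets ?W = sets borel" by (auto simp: is_waiting_law_def)
  interpret W: prob_space ?W by (rule pW)
  interpret sequence_space ?W ..
  have c: "(\<lambda>\<omega>. ennreal (\<omega> k)) \<in> borel_measurable ?S" for k
  proof -
    have "(\<lambda>\<omega>. \<omega> k) \<in> measurable ?S ?W" by (rule measurable_component_singleton) simp
    then have "(\<lambda>\<omega>. \<omega> k) \<in> borel_measurable ?S" using sW by (metis measurable_cong_sets)
    then show ?thesis by measurable
  qed
  have F: "?F \<in> borel_measurable ?S"
    by (rule measurable_coordinatewise_then_product) (intro borel_measurable_sum c)
  have FPP: "FPP_law \<alpha> l = distr ?S borel ?F" by (simp add: FPP_law_def)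
  have pl: "process_law (FPP_law \<alpha> l)"
    unfolding FPP process_law_def using P.prob_space_distr[OF F] by simp
  show "monotone_process_law (FPP_law \<alpha> l)"
  proof -
    have "{\<phi> :: nat \<Rightarrow> ennreal. \<forall>i. \<phi> i \<le> \<phi> (Suc i)} \<in> sets borel"
      by (intro borel_closed closed_Collect_all closed_Collect_le continuous_on_coordinate)
    then have "AE \<phi> in FPP_law \<alpha> l. \<phi> \<in> monotone_seqs"
      unfolding FPP by (subst AE_distr_iff[OF F]) (auto simp: monotone_seqs_def)
    with pl show ?thesis by (simp add: monotone_process_law_def)
  qed
  assume \<delta>: "\<delta> 0 = 0" and s: "0 < s"
  let ?g = "\<lambda>d \<delta> \<phi>. lap s (excess d \<delta> \<phi>)"
  have gm: "?g d \<delta> \<in> borel_measurable borel" for d \<delta>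
    by (rule borel_measurable_continuous_onI[OF continuous_on_lap_excess[OF s]])
  have gF: "(\<lambda>\<omega>. ?g d \<delta> (?F \<omega>)) \<in> borel_measurable ?S" for d \<delta>
    by (rule measurable_compose[OF F gm])
  have I: "lap_excess (FPP_law \<alpha> l) d \<delta> s = (\<integral>\<omega>. ?g d \<delta> (?F \<omega>) \<partial>?S)" for d \<delta>
    unfolding FPP by (rule integral_distr[OF F gm])
  have Fc: "?F (case_nat x \<omega>) = case_nat (ennreal x) (\<lambda>i. ennreal x + ?F \<omega> i)" for x \<omega>
  proof
    fix i show "?F (case_nat x \<omega>) i = case_nat (ennreal x) (\<lambda>i. ennreal x + ?F \<omega> i) i"
      by (cases i) (simp_all add: sum.atMost_Suc_shift del: sum.atMost_Suc)
  qed
  have cm: "(\<lambda>(x, \<omega>). case_nat x \<omega>) \<in> measurable (?W \<Otimes>\<^sub>M ?S) ?S" by measurable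
  interpret pair: pair_prob_space ?W ?S ..
  have hm: "(\<lambda>w. ?g (Suc d) \<delta> (?F (case_prod case_nat w))) \<in> borel_measurable (?W \<Otimes>\<^sub>M ?S)"
    by (rule measurable_compose[OF cm gF])
  have hb: "norm (?g d \<delta> \<phi>) \<le> 1" for d \<delta> \<phi> using s by simp
  have "lap_excess (FPP_law \<alpha> l) (Suc d) \<delta> s = (\<integral>\<omega>. ?g (Suc d) \<delta> (?F \<omega>) \<partial>distr (?W \<Otimes>\<^sub>M ?S) ?S (\<lambda>(x, \<omega>). case_nat x \<omega>))"
    unfolding I PiM_iter ..
  also have "\<dots> = (\<integral>w. ?g (Suc d) \<delta> (?F (case_prod case_nat w)) \<partial>(?W \<Otimes>\<^sub>M ?S))"
    by (rule integral_distr[OF cm gF])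
  also have "\<dots> = (\<integral>x. \<integral>\<omega>. ?g (Suc d) \<delta> (?F (case_prod case_nat (x, \<omega>))) \<partial>?S \<partial>?W)"
    by (rule pair.integral_fst'[symmetric], rule pair.P.integrable_const_bound[where B=1])
       (use hm hb in auto)
  also have "\<dots> = (\<integral>x. \<integral>\<omega>. lap s (ennreal x) * ?g d (\<lambda>i. \<delta> (Suc i)) (?F \<omega>) \<partial>?S \<partial>?W)"
    unfolding prod.case Fc excess_case_nat[where \<delta>=\<delta>, OF \<delta>] lap_add ..
  also have "\<dots> = (\<integral>x. lap s (ennreal x) \<partial>?W) * lap_excess (FPP_law \<alpha> l) d (\<lambda>i. \<delta> (Suc i)) s"
    unfolding I by simp
  also have "(\<integral>x. lap s (ennreal x) \<partial>?W) = (\<integral>x. exp (- s * x) \<partial>?W)"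
  proof (rule Bochner_Integration.integral_cong_AE)
    have "ennreal \<in> borel_measurable ?W" using sW by (metis measurable_cong_sets measurable_ennreal)
    then show "(\<lambda>x. lap s (ennreal x)) \<in> borel_measurable ?W"
      by (rule measurable_compose[OF _ borel_measurable_lap[OF s]])
    show "(\<lambda>x. exp (- s * x)) \<in> borel_measurable ?W"
      unfolding measurable_cong_sets[OF sW refl] by measurable
  qed (use W in \<open>auto simp: lap_ennreal is_waiting_law_def\<close>)
  also have "\<dots> = l / (l + s powr \<alpha>)" using W s by (simp add: is_waiting_law_def)
  finally show "lap_excess (FPP_law \<alpha> l) (Suc d) \<delta> s =
       l / (l + s powr \<alpha>) * lap_excess (FPP_law \<alpha> l) d (\<lambda>i. \<delta> (Suc i)) s" .
qed

text \<open>
  With \<open>l = \<Gamma>(1 + \<beta>)\<close> and \<open>\<kappa> = l * s powr (- \<beta>)\<close>, a fixed point satisfies \<open>E = \<kappa> * (E' - E)\<close> for the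
  expectations \<open>E\<close> and \<open>E'\<close> in dimensions \<open>d + 1\<close> and \<open>d\<close>, that is, \<open>E = l / (l + s powr \<beta>) * E'\<close>. This
  is the renewal property.
\<close>
theorem FPP_unique_fixed_point:
  assumes \<beta>: "0 < \<beta>" "\<beta> \<le> 1"
  shows "monotone_process_law P \<and> hitting_return_relation \<beta> P P \<longleftrightarrow> P = FPP_law \<beta> (Gamma (1 + \<beta>))"
proof -
  let ?l = "Gamma (1 + \<beta>)" let ?R = "FPP_law \<beta> ?l"
  have l: "0 < ?l" using \<beta> by (intro Gamma_real_pos) simp
  have mono: "monotone_process_law ?R" by (rule FPP_monotone[OF \<beta> l])
  have rel: "laplace_relation \<beta> ?R ?R"
    unfolding laplace_relation_def
  proof (intro allI impI)
    fix d and \<delta> :: "nat \<Rightarrow> real" and s :: real assume "spread d \<delta> \<and> 0 < s"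
    then have \<delta>: "\<delta> 0 = 0" and s: "0 < s" by (auto simp: spread_def)
    let ?E = "lap_excess ?R d (\<lambda>i. \<delta> (Suc i)) s"
    have alg: "L / (L + w) * E = L * inverse w * (E - L / (L + w) * E)" if "0 < L" "0 < w" for L w E :: real
    proof -
      have "E - L / (L + w) * E = w / (L + w) * E" using that by (simp add: field_simps)
      then show ?thesis using that by simp
    qed
    have "?l / (?l + s powr \<beta>) * ?E = ?l * s powr (- \<beta>) * (?E - ?l / (?l + s powr \<beta>) * ?E)"
      unfolding powr_minus using l s by (intro alg) auto
    then show "lap_excess ?R (Suc d) \<delta> s = ?l * s powr (- \<beta>) * (?E - lap_excess ?R (Suc d) \<delta> s)"
      unfolding FPP_renewal[where \<delta>=\<delta>, OF \<beta> l \<delta> s] .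
  qed
  show ?thesis
  proof
    assume P: "monotone_process_law P \<and> hitting_return_relation \<beta> P P"
    then have "process_law P" by (simp add: monotone_process_law_def)
    with P have "laplace_relation \<beta> P P" using hitting_return_relation_iff_laplace \<beta>(1) by blast
    with P mono rel show "P = ?R" using laplace_relation_unique_fixed \<beta>(1) by blast
  next
    assume P: "P = ?R"
    have "process_law ?R" using mono by (simp add: monotone_process_law_def)
    then have "hitting_return_relation \<beta> ?R ?R" using hitting_return_relation_iff_laplace \<beta>(1) rel by blast
    then show "monotone_process_law P \<and> hitting_return_relation \<beta> P P" using mono P by simp
  qed
qed

section \<open>Transfer operators\<close>

lemma integrable_mult_bounded:
  fixes f g :: "'a \<Rightarrow> real"
  assumes "integrable M f" "g \<in> borel_measurable M" "AE x in M. \<bar>g x\<bar> \<le> C"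
  shows "integrable M (\<lambda>x. f x * g x)"
proof (rule Bochner_Integration.integrable_bound[of _ "\<lambda>x. C * f x"])
  show "integrable M (\<lambda>x. C * f x)" using assms(1) by simp
  show "AE x in M. norm (f x * g x) \<le> norm (C * f x)"
    using assms(3)
  proof eventually_elim
    case (elim x)
    then have "\<bar>f x\<bar> * \<bar>g x\<bar> \<le> \<bar>f x\<bar> * \<bar>C\<bar>" by (intro mult_left_mono) auto
    then show ?case by (simp add: abs_mult mult.commute)
  qed
qed (use assms in auto)

lemma (in sigma_finite_measure) finite_absolutely_continuous_real_density:
  assumes N: "finite_measure N" "sets N = sets M" and ac: "absolutely_continuous M N"
  obtains h :: "'a \<Rightarrow> real" where "integrable M h" "\<And>x. 0 \<le> h x" "density M (\<lambda>x. ennreal (h x)) = N"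
proof -
  interpret N: finite_measure N by (rule N)
  obtain h0 where h0[measurable]: "h0 \<in> borel_measurable M" and d: "density M h0 = N"
    using Radon_Nikodym[OF ac N(2)] by auto
  have "(\<integral>\<^sup>+x. h0 x \<partial>M) = emeasure N (space M)"
    unfolding d[symmetric] by (subst emeasure_density) (auto intro!: nn_integral_cong)
  then have fin: "(\<integral>\<^sup>+x. h0 x \<partial>M) < \<infinity>" by (simp add: N.emeasure_eq_measure)
  have "AE x in M. h0 x \<noteq> \<infinity>" using nn_integral_PInf_AE[OF h0] fin by auto
  then have AEh: "AE x in M. ennreal (enn2real (h0 x)) = h0 x" by eventually_elim (simp add: less_top)
  show thesis
  proof (rule that[of "\<lambda>x. enn2real (h0 x)"])
    show "integrable M (\<lambda>x. enn2real (h0 x))"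
    proof (rule integrableI_nonneg)
      show "(\<integral>\<^sup>+x. ennreal (enn2real (h0 x)) \<partial>M) < \<infinity>"
        using fin AEh by (subst nn_integral_cong_AE[where v=h0]) auto
    qed auto
    show "density M (\<lambda>x. ennreal (enn2real (h0 x))) = N"
      unfolding d[symmetric] by (rule density_cong) (use AEh in auto)
  qed simp
qed

locale mpt_system = sigma_finite_measure M for M :: "'a measure" +
  fixes T :: "'a \<Rightarrow> 'a"
  assumes mpt: "mpt M T"
begin

lemma T_measurable [measurable]: "T \<in> measurable M M"
  using mpt by (simp add: mpt_def)

lemma T_pow_measurable [measurable]: "T ^^ n \<in> measurable M M"
proof (induction n)
  case (Suc n)
  have "T ^^ Suc n = (\<lambda>x. T ((T ^^ n) x))" by auto
  then show ?case using Suc by (metis T_measurable measurable_compose)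
qed (simp add: id_def)

lemma emeasure_preimage:
  assumes "A \<in> sets M"
  shows "emeasure M (T -` A \<inter> space M) = emeasure M A"
proof -
  have "emeasure (distr M M T) A = emeasure M (T -` A \<inter> space M)"
    using assms by (intro emeasure_distr) auto
  then show ?thesis using mpt by (simp add: mpt_def)
qed

lemma AE_T: assumes "AE x in M. P x" shows "AE x in M. P (T x)"
proof -
  have d: "distr M M T = M" using mpt by (simp add: mpt_def)
  have "AE x in distr M M T. P x" unfolding d by (rule assms)
  then show ?thesis by (rule AE_distrD[OF T_measurable])
qed

text \<open>
  The measure with density \<open>f\<close> has an image under \<open>T\<close> that is absolutely continuous, because \<open>T\<close>
  preserves null sets; its Radon--Nikodym density is the required function.
\<close>
lemma is_transfer_exists_nonneg:
  assumes f: "integrable M f" "\<And>x. 0 \<le> f x"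
  shows "\<exists>h. is_transfer M T f h"
proof -
  note [measurable] = borel_measurable_integrable[OF f(1)]
  let ?N = "distr (density M (\<lambda>x. ennreal (f x))) M T"
  have Tm: "T \<in> measurable (density M (\<lambda>x. ennreal (f x))) M" by simp
  have ac: "absolutely_continuous M ?N"
    unfolding absolutely_continuous_def
  proof
    fix A assume "A \<in> null_sets M"
    then have A: "A \<in> sets M" "emeasure M A = 0" by auto
    have "T -` A \<inter> space M \<in> null_sets M" using A emeasure_preimage[OF A(1)] by auto
    then have "AE x in M. x \<notin> T -` A \<inter> space M" by (rule AE_not_in)
    then have "emeasure (density M (\<lambda>x. ennreal (f x))) (T -` A \<inter> space M) = 0"
      using A by (subst emeasure_density) (auto simp: nn_integral_0_iff_AE elim!: eventually_mono)
    then show "A \<in> null_sets ?N" using A by (auto simp: emeasure_distr)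
  qed
  have "finite_measure ?N"
  proof
    have "emeasure ?N (space ?N) = (\<integral>\<^sup>+x. ennreal (f x) \<partial>M)"
      by (subst emeasure_distr[OF Tm])
         (auto simp: emeasure_density indicator_def measurable_space[OF T_measurable] intro!: nn_integral_cong)
    then show "emeasure ?N (space ?N) \<noteq> \<infinity>" using f(1) by (simp add: integrable_iff_bounded f(2) less_top)
  qed
  from finite_absolutely_continuous_real_density[OF this _ ac]
  obtain h :: "'a \<Rightarrow> real" where h: "integrable M h" "\<And>x. 0 \<le> h x" and dh: "density M (\<lambda>x. ennreal (h x)) = ?N"
    by auto
  have "is_transfer M T f h"
    unfolding is_transfer_def
  proof (intro conjI ballI impI)
    fix g :: "'a \<Rightarrow> real" assume g[measurable]: "g \<in> borel_measurable M"
    have "(\<integral>x. h x * g x \<partial>M) = (\<integral>x. g x \<partial>density M (\<lambda>x. ennreal (h x)))"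
      using h by (subst integral_density) auto
    also have "\<dots> = (\<integral>x. g (T x) \<partial>density M (\<lambda>x. ennreal (f x)))"
      unfolding dh by (rule integral_distr[OF Tm g])
    also have "\<dots> = (\<integral>x. f x * g (T x) \<partial>M)"
      using f(2) by (subst integral_density) auto
    finally show "(\<integral>x. f x * g (T x) \<partial>M) = (\<integral>x. h x * g x \<partial>M)" by simp
  qed (rule h)
  then show ?thesis by blast
qed

lemma is_transfer_transfer:
  assumes f: "integrable M f"
  shows "is_transfer M T f (transfer M T f)"
proof -
  have fp: "integrable M (\<lambda>x. max 0 (f x))" and fm: "integrable M (\<lambda>x. max 0 (- f x))" using f by auto
  obtain h1 where h1: "is_transfer M T (\<lambda>x. max 0 (f x)) h1" using is_transfer_exists_nonneg[OF fp] by auto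
  obtain h2 where h2: "is_transfer M T (\<lambda>x. max 0 (- f x)) h2" using is_transfer_exists_nonneg[OF fm] by auto
  have "is_transfer M T f (\<lambda>x. h1 x - h2 x)"
    unfolding is_transfer_def
  proof (intro conjI ballI impI)
    show "integrable M (\<lambda>x. h1 x - h2 x)" using h1 h2 by (auto simp: is_transfer_def)
    fix g :: "'a \<Rightarrow> real" assume g[measurable]: "g \<in> borel_measurable M" and b: "\<exists>C. AE x in M. \<bar>g x\<bar> \<le> C"
    then obtain C where C: "AE x in M. \<bar>g x\<bar> \<le> C" by blast
    have gT: "(\<lambda>x. g (T x)) \<in> borel_measurable M" by measurable
    note CT = AE_T[OF C]
    have "(\<integral>x. f x * g (T x) \<partial>M) = (\<integral>x. max 0 (f x) * g (T x) - max 0 (- f x) * g (T x) \<partial>M)"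
    proof (rule Bochner_Integration.integral_cong[OF refl])
      fix x
      have "f x = max 0 (f x) - max 0 (- f x)" by simp
      then show "f x * g (T x) = max 0 (f x) * g (T x) - max 0 (- f x) * g (T x)"
        by (metis left_diff_distrib)
    qed
    also have "\<dots> = (\<integral>x. max 0 (f x) * g (T x) \<partial>M) - (\<integral>x. max 0 (- f x) * g (T x) \<partial>M)"
      by (rule Bochner_Integration.integral_diff[OF integrable_mult_bounded[OF fp gT CT] integrable_mult_bounded[OF fm gT CT]])
    also have "\<dots> = (\<integral>x. h1 x * g x \<partial>M) - (\<integral>x. h2 x * g x \<partial>M)"
      using h1 h2 g b unfolding is_transfer_def by simp
    also have "\<dots> = (\<integral>x. h1 x * g x - h2 x * g x \<partial>M)"
      by (rule Bochner_Integration.integral_diff[symmetric]; rule integrable_mult_bounded[OF _ g C])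
         (use h1 h2 in \<open>auto simp: is_transfer_def\<close>)
    finally show "(\<integral>x. f x * g (T x) \<partial>M) = (\<integral>x. (h1 x - h2 x) * g x \<partial>M)" by (simp add: left_diff_distrib)
  qed
  then show ?thesis unfolding transfer_def by (rule someI[of "is_transfer M T f"])
qed

lemma transfer_integrable: "integrable M f \<Longrightarrow> integrable M (transfer M T f)"
  using is_transfer_transfer by (auto simp: is_transfer_def)

lemma transfer_integral:
  assumes "integrable M f" "g \<in> borel_measurable M" "\<And>x. \<bar>g x\<bar> \<le> C"
  shows "(\<integral>x. transfer M T f x * g x \<partial>M) = (\<integral>x. f x * g (T x) \<partial>M)"
proof -
  have "\<exists>C. AE x in M. \<bar>g x\<bar> \<le> C" using assms(3) by (intro exI[of _ C]) simp
  then show ?thesis using is_transfer_transfer[OF assms(1)] assms(2) by (simp add: is_transfer_def)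
qed

text \<open>
  Test the defining duality with the indicator of the set where the image is negative.
\<close>
lemma transfer_nonneg:
  assumes f: "integrable M f" "AE x in M. 0 \<le> f x"
  shows "AE x in M. 0 \<le> transfer M T f x"
proof -
  let ?h = "transfer M T f"
  have ih: "integrable M ?h" by (rule transfer_integrable[OF f(1)])
  note [measurable] = borel_measurable_integrable[OF ih]
  let ?g = "\<lambda>x. if ?h x < 0 then 1 else 0 :: real"
  have gm: "?g \<in> borel_measurable M" by measurable
  have e: "(\<integral>x. ?h x * ?g x \<partial>M) = (\<integral>x. f x * ?g (T x) \<partial>M)"
    by (rule transfer_integral[OF f(1) gm, of 1]) auto
  have "0 \<le> (\<integral>x. f x * ?g (T x) \<partial>M)"
    by (rule integral_nonneg_AE) (use f(2) in \<open>auto elim: eventually_mono\<close>)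
  moreover have ip: "integrable M (\<lambda>x. - (?h x * ?g x))"
    by (intro integrable_minus integrable_mult_bounded[OF ih gm, of 1]) auto
  have nn: "0 \<le> - (?h x * ?g x)" for x by auto
  have "0 \<le> (\<integral>x. - (?h x * ?g x) \<partial>M)" by (rule integral_nonneg_AE) (use nn in auto)
  ultimately have "(\<integral>x. - (?h x * ?g x) \<partial>M) = 0" using e by simp
  then have "AE x in M. - (?h x * ?g x) = 0"
    using integral_nonneg_eq_0_iff_AE[OF ip] nn by auto
  then show ?thesis by eventually_elim (auto split: if_splits)
qed

lemma iterate_integrable: "integrable M f \<Longrightarrow> integrable M ((transfer M T ^^ k) f)"
  by (induction k) (auto intro: transfer_integrable)

lemma iterate_nonneg:
  assumes "integrable M f" "AE x in M. 0 \<le> f x"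
  shows "AE x in M. 0 \<le> (transfer M T ^^ k) f x"
proof (induction k)
  case (Suc k)
  from transfer_nonneg[OF iterate_integrable[OF assms(1)] this] show ?case by simp
qed (use assms in simp)

lemma iterate_integral:
  assumes f: "integrable M f" and g: "g \<in> borel_measurable M" "\<And>x. \<bar>g x\<bar> \<le> C"
  shows "(\<integral>x. (transfer M T ^^ k) f x * g x \<partial>M) = (\<integral>x. f x * g ((T ^^ k) x) \<partial>M)"
  using g
proof (induction k arbitrary: g)
  case (Suc k)
  have gT: "(\<lambda>x. g (T x)) \<in> borel_measurable M" using Suc.prems(1) by measurable
  have "(\<integral>x. (transfer M T ^^ Suc k) f x * g x \<partial>M) = (\<integral>x. (transfer M T ^^ k) f x * g (T x) \<partial>M)"
    using transfer_integral[OF iterate_integrable[OF f, of k] Suc.prems] by simp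
  also have "\<dots> = (\<integral>x. f x * g (T ((T ^^ k) x)) \<partial>M)"
    by (rule Suc.IH[OF gT Suc.prems(2)])
  finally show ?case by simp
qed simp

text \<open>
  Suppose that the points that never enter \<open>E\<close> have positive measure, and let \<open>u\<close> be an integrable
  density supported on them. By duality all iterates of \<open>u\<close> of index at least 1 vanish on \<open>E\<close>, so their
  sum is finite there, against conservativity.
\<close>
lemma recurrence:
  assumes ce: "conservative_ergodic M T" and E: "E \<in> sets M" "0 < emeasure M E"
  shows "AE x in M. \<exists>n\<ge>1. (T ^^ n) x \<in> E"
proof -
  note [measurable] = E(1)
  obtain w :: "'a \<Rightarrow> real" where w[measurable]: "w \<in> borel_measurable M" and w0: "\<And>x. w x > 0"
    and w1: "\<And>x. w x \<le> 1" and wi: "integrable M w"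
    using obtain_positive_integrable_function by blast
  define D where "D = {x \<in> space M. \<forall>n\<ge>1. (T ^^ n) x \<notin> E}"
  have D[measurable]: "D \<in> sets M" unfolding D_def by measurable
  let ?u = "\<lambda>x. w x * indicator D x :: real"
  have ui: "integrable M ?u" by (rule integrable_mult_bounded[OF wi, of _ 1]) (auto simp: indicator_def)
  have u0: "0 \<le> ?u x" for x using w0[of x] by simp
  have "(\<integral>x. ?u x \<partial>M) = 0"
  proof (rule ccontr)
    assume "(\<integral>x. ?u x \<partial>M) \<noteq> 0"
    moreover have "0 \<le> (\<integral>x. ?u x \<partial>M)" using u0 by (intro Bochner_Integration.integral_nonneg) auto
    ultimately have "0 < (\<integral>x. ?u x \<partial>M)" by simp
    with ce ui u0 have inf: "AE x in M. (\<Sum>k. ennreal ((transfer M T ^^ k) ?u x)) = \<infinity>"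
      unfolding conservative_ergodic_def by simp
    have z: "AE x in M. x \<in> E \<longrightarrow> (transfer M T ^^ k) ?u x = 0" if "1 \<le> k" for k
    proof -
      have ik: "integrable M ((transfer M T ^^ k) ?u)" by (rule iterate_integrable[OF ui])
      have nk: "AE x in M. 0 \<le> (transfer M T ^^ k) ?u x" by (rule iterate_nonneg[OF ui]) (simp add: u0)
      have p: "integrable M (\<lambda>x. (transfer M T ^^ k) ?u x * indicator E x)"
        by (rule integrable_mult_bounded[OF ik, of _ 1]) (auto simp: indicator_def)
      have "(\<integral>x. (transfer M T ^^ k) ?u x * indicator E x \<partial>M) = (\<integral>x. ?u x * indicator E ((T ^^ k) x) \<partial>M)"
        by (rule iterate_integral[OF ui, where C=1]) (auto simp: indicator_def)
      also have "\<dots> = (\<integral>x. 0 \<partial>M)"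
        by (rule Bochner_Integration.integral_cong) (use that in \<open>auto simp: D_def indicator_def\<close>)
      finally have z0: "(\<integral>x. (transfer M T ^^ k) ?u x * indicator E x \<partial>M) = 0" by simp
      have "AE x in M. 0 \<le> (transfer M T ^^ k) ?u x * indicator E x"
        using nk by eventually_elim (rule mult_nonneg_nonneg, auto)
      from iffD1[OF integral_nonneg_eq_0_iff_AE[OF p this] z0]
      have "AE x in M. (transfer M T ^^ k) ?u x * indicator E x = 0" .
      then show ?thesis by eventually_elim (auto simp: indicator_def)
    qed
    have "AE x in M. \<forall>k. 1 \<le> k \<longrightarrow> x \<in> E \<longrightarrow> (transfer M T ^^ k) ?u x = 0"
      unfolding AE_all_countable using z by auto
    with inf have "AE x in M. x \<notin> E"
    proof eventually_elim
      case (elim x)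
      show ?case
      proof
        assume "x \<in> E"
        then have "ennreal ((transfer M T ^^ k) ?u x) = (if k = 0 then ennreal (?u x) else 0)" for k
          using elim(2) by auto
        then have "(\<Sum>k. ennreal ((transfer M T ^^ k) ?u x)) = (\<Sum>k. if k = 0 then ennreal (?u x) else 0)" by simp
        also have "\<dots> = ennreal (?u x)" using suminf_finite[of "{0}" "\<lambda>k. if k = 0 then ennreal (?u x) else 0"] by simp
        finally show False using elim(1) by simp
      qed
    qed
    then have "emeasure M E = 0"
      using sets.sets_into_space[OF E(1)] by (subst (asm) AE_iff_measurable[where N=E]) auto
    with E(2) show False by simp
  qed
  then have "AE x in M. ?u x = 0" using integral_nonneg_eq_0_iff_AE[OF ui] u0 by auto
  moreover have "AE x in M. x \<in> space M" by (rule AE_space)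
  ultimately show ?thesis
  proof eventually_elim
    case (elim x)
    then have "x \<notin> D" using w0[of x] by (auto simp: indicator_def split: if_splits)
    then show ?case using elim by (auto simp: D_def)
  qed
qed

section \<open>The filling scheme\<close>

text \<open>
  The positive part of \<open>w\<close> is a supply and the negative part a demand. In each step the remaining
  supply is transported by \<open>T\<close> and cancels whatever demand it meets.
\<close>
primrec fill :: "('a \<Rightarrow> real) \<Rightarrow> nat \<Rightarrow> 'a \<Rightarrow> real" where
  "fill w 0 = w"
| "fill w (Suc k) = (\<lambda>x. transfer M T (\<lambda>y. max 0 (fill w k y)) x - max 0 (- fill w k x))"

lemma fill_integrable: "integrable M w \<Longrightarrow> integrable M (fill w k)"
  by (induction k) (auto intro!: transfer_integrable Bochner_Integration.integrable_diff integrable_max)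

lemma fill_pos_integrable:
  assumes "integrable M w"
  shows "integrable M (\<lambda>x. max 0 (fill w k x))" "integrable M (\<lambda>x. max 0 (- fill w k x))"
  using fill_integrable[OF assms, of k] by auto

lemma transfer_fill_nonneg:
  "integrable M w \<Longrightarrow> AE x in M. 0 \<le> transfer M T (\<lambda>y. max 0 (fill w k y)) x"
  by (intro transfer_nonneg fill_pos_integrable) auto

text \<open>
  A step changes only the position of the supply, so a test function \<open>H\<close> notices it only through
  \<open>H \<circ> T - H\<close>.
\<close>
lemma fill_step:
  assumes w: "integrable M w" and H: "H \<in> borel_measurable M" "\<And>x. \<bar>H x\<bar> \<le> 1"
  shows "(\<integral>x. fill w (Suc k) x * H x \<partial>M) - (\<integral>x. fill w k x * H x \<partial>M)
    = (\<integral>x. max 0 (fill w k x) * (H (T x) - H x) \<partial>M)"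
proof -
  let ?p = "\<lambda>x. max 0 (fill w k x)" and ?n = "\<lambda>x. max 0 (- fill w k x)"
  note p = fill_pos_integrable(1)[OF w, of k] and n = fill_pos_integrable(2)[OF w, of k]
  have HA: "AE x in M. \<bar>H x\<bar> \<le> 1" "AE x in M. \<bar>H (T x)\<bar> \<le> 1" using H(2) by auto
  have HT: "(\<lambda>x. H (T x)) \<in> borel_measurable M" using H(1) by measurable
  note pH = integrable_mult_bounded[OF p H(1) HA(1)] and nH = integrable_mult_bounded[OF n H(1) HA(1)]
   and pHT = integrable_mult_bounded[OF p HT HA(2)]
   and tH = integrable_mult_bounded[OF transfer_integrable[OF p] H(1) HA(1)]
  have "(\<integral>x. fill w (Suc k) x * H x \<partial>M) = (\<integral>x. transfer M T ?p x * H x - ?n x * H x \<partial>M)"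
    by (simp add: left_diff_distrib)
  also have "\<dots> = (\<integral>x. ?p x * H (T x) \<partial>M) - (\<integral>x. ?n x * H x \<partial>M)"
    by (subst Bochner_Integration.integral_diff[OF tH nH]) (simp add: transfer_integral[OF p H(1), of 1] H(2))
  finally have 1: "(\<integral>x. fill w (Suc k) x * H x \<partial>M) = (\<integral>x. ?p x * H (T x) \<partial>M) - (\<integral>x. ?n x * H x \<partial>M)" .
  have "fill w k x * H x = ?p x * H x - ?n x * H x" for x
  proof -
    have "fill w k x = ?p x - ?n x" by simp
    then show ?thesis by (metis left_diff_distrib)
  qed
  then have 2: "(\<integral>x. fill w k x * H x \<partial>M) = (\<integral>x. ?p x * H x \<partial>M) - (\<integral>x. ?n x * H x \<partial>M)"
    using Bochner_Integration.integral_diff[OF pH nH] by simp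
  have "(\<integral>x. ?p x * (H (T x) - H x) \<partial>M) = (\<integral>x. ?p x * H (T x) \<partial>M) - (\<integral>x. ?p x * H x \<partial>M)"
    using Bochner_Integration.integral_diff[OF pHT pH] by (simp add: right_diff_distrib)
  with 1 2 show ?thesis by simp
qed

lemma fill_integral: "integrable M w \<Longrightarrow> (\<integral>x. fill w k x \<partial>M) = (\<integral>x. w x \<partial>M)"
proof (induction k)
  case (Suc k)
  then show ?case using fill_step[OF Suc.prems, of "\<lambda>_. 1" k] by simp
qed simp

lemma fill_abs_integral:
  assumes w: "integrable M w" "(\<integral>x. w x \<partial>M) = 0"
  shows "(\<integral>x. \<bar>fill w k x\<bar> \<partial>M) = 2 * (\<integral>x. max 0 (fill w k x) \<partial>M)"
    and "(\<integral>x. max 0 (- fill w k x) \<partial>M) = (\<integral>x. max 0 (fill w k x) \<partial>M)"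
proof -
  note p = fill_pos_integrable(1)[OF w(1), of k] and n = fill_pos_integrable(2)[OF w(1), of k]
  have "(\<integral>x. fill w k x \<partial>M) = (\<integral>x. max 0 (fill w k x) - max 0 (- fill w k x) \<partial>M)"
    by (rule Bochner_Integration.integral_cong) auto
  then have "(\<integral>x. max 0 (fill w k x) \<partial>M) - (\<integral>x. max 0 (- fill w k x) \<partial>M) = 0"
    using fill_integral[OF w(1), of k] w(2) Bochner_Integration.integral_diff[OF p n] by simp
  then show 1: "(\<integral>x. max 0 (- fill w k x) \<partial>M) = (\<integral>x. max 0 (fill w k x) \<partial>M)" by simp
  have "(\<integral>x. \<bar>fill w k x\<bar> \<partial>M) = (\<integral>x. max 0 (fill w k x) + max 0 (- fill w k x) \<partial>M)"
    by (rule Bochner_Integration.integral_cong) auto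
  then show "(\<integral>x. \<bar>fill w k x\<bar> \<partial>M) = 2 * (\<integral>x. max 0 (fill w k x) \<partial>M)"
    using Bochner_Integration.integral_add[OF p n] 1 by simp
qed

text \<open>
  Demand decreases pointwise, and its integral always equals that of the supply. If it is eventually met
  almost everywhere, both integrals tend to 0 by dominated convergence. Otherwise it is never fully met
  on a set \<open>E\<close> of positive measure. All supply that enters \<open>E\<close> is absorbed there, so the supply after \<open>k\<close> steps is at most the mass of
  the initial supply on orbits that avoid \<open>E\<close> up to time \<open>k\<close>, which tends to 0 by recurrence.
\<close>
lemma fill_converges:
  assumes ce: "conservative_ergodic M T" and w: "integrable M w" "(\<integral>x. w x \<partial>M) = 0"
  shows "(\<lambda>k. \<integral>x. \<bar>fill w k x\<bar> \<partial>M) \<longlonglongrightarrow> 0"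
proof -
  let ?p = "\<lambda>k x. max 0 (fill w k x)" and ?n = "\<lambda>k x. max 0 (- fill w k x)"
  note [measurable] = borel_measurable_integrable[OF fill_integrable[OF w(1)]]
  note p = fill_pos_integrable(1)[OF w(1)] and n = fill_pos_integrable(2)[OF w(1)]
  define E where "E = {x \<in> space M. \<forall>k. fill w k x < 0}"
  have E[measurable]: "E \<in> sets M" unfolding E_def by measurable
  have "(\<lambda>k. \<integral>x. ?p k x \<partial>M) \<longlonglongrightarrow> 0"
  proof (cases "emeasure M E = 0")
    case True
    have "AE x in M. x \<notin> E" using True E by (intro AE_not_in) auto
    moreover have "AE x in M. x \<in> space M" by (rule AE_space)
    moreover have "AE x in M. \<forall>k. 0 \<le> transfer M T (?p k) x"
      unfolding AE_all_countable using transfer_fill_nonneg[OF w(1)] by blast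
    ultimately have lim: "AE x in M. (\<forall>k. ?n k x \<le> ?n 0 x) \<and> (\<lambda>k. ?n k x) \<longlonglongrightarrow> 0"
    proof eventually_elim
      case (elim x)
      have st: "?n (Suc k) x \<le> ?n k x" for k using elim(3)[rule_format, of k] by auto
      then have dec: "decseq (\<lambda>k. ?n k x)" by (rule decseq_SucI)
      obtain K where "0 \<le> fill w K x" using elim(1,2) by (auto simp: E_def not_less)
      then have "?n K x = 0" by simp
      then have "?n k x = 0" if "K \<le> k" for k using decseqD[OF dec that] by (simp add: antisym)
      then have "eventually (\<lambda>k. ?n k x = 0) sequentially" by (auto simp: eventually_sequentially)
      then have "(\<lambda>k. ?n k x) \<longlonglongrightarrow> 0" by (rule tendsto_eventually)
      moreover have "?n k x \<le> ?n 0 x" for k by (rule decseqD[OF dec le0])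
      ultimately show ?case by blast
    qed
    have "(\<lambda>k. \<integral>x. ?n k x \<partial>M) \<longlonglongrightarrow> (\<integral>x. 0 \<partial>M)"
    proof (rule integral_dominated_convergence[where w="?n 0"])
      show "integrable M (?n 0)" by (rule n)
      show "AE x in M. (\<lambda>k. ?n k x) \<longlonglongrightarrow> 0" using lim by eventually_elim auto
      show "AE x in M. norm (?n k x) \<le> ?n 0 x" for k using lim by eventually_elim auto
    qed measurable
    then show ?thesis using fill_abs_integral(2)[OF w] by simp
  next
    case False
    define A where "A j = {x \<in> space M. \<forall>i\<in>{1..j}. (T ^^ i) x \<notin> E}" for j
    have A[measurable]: "A j \<in> sets M" for j unfolding A_def by measurable
    have i1: "integrable M (\<lambda>x. ?p k x * indicator B x)" if "B \<in> sets M" for k B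
      using that by (intro integrable_mult_bounded[OF p, of _ 1]) (auto simp: indicator_def)
    have step: "(\<integral>x. ?p (Suc k) x * indicator (A j) x \<partial>M) \<le> (\<integral>x. ?p k x * indicator (A (Suc j)) x \<partial>M)" for k j
    proof -
      let ?t = "transfer M T (?p k)" and ?B = "A j \<inter> (space M - E)"
      have it: "integrable M (\<lambda>x. ?t x * indicator ?B x)"
        by (intro integrable_mult_bounded[OF transfer_integrable[OF p], of _ 1]) (auto simp: indicator_def)
      have "(\<integral>x. ?p (Suc k) x * indicator (A j) x \<partial>M) \<le> (\<integral>x. ?t x * indicator ?B x \<partial>M)"
      proof (rule integral_mono_AE[OF i1[OF A] it])
        show "AE x in M. ?p (Suc k) x * indicator (A j) x \<le> ?t x * indicator ?B x"
          using transfer_fill_nonneg[OF w(1), of k]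
        proof eventually_elim
          case (elim x)
          show ?case
          proof (cases "x \<in> E")
            case True
            then have "fill w (Suc k) x < 0" unfolding E_def by blast
            then show ?thesis using True by (simp add: indicator_def)
          next
            case False
            have "?p (Suc k) x \<le> ?t x" using elim by simp
            then show ?thesis using False by (auto simp: A_def indicator_def)
          qed
        qed
      qed
      also have "\<dots> = (\<integral>x. ?p k x * indicator ?B (T x) \<partial>M)"
        by (rule transfer_integral[OF p, where C=1]) (auto simp: indicator_def)
      also have "\<dots> = (\<integral>x. ?p k x * indicator (A (Suc j)) x \<partial>M)"
      proof (rule Bochner_Integration.integral_cong[OF refl])
        fix x assume x: "x \<in> space M"
        then have Tx: "T x \<in> space M" using T_measurable by (rule measurable_space[rotated])
        have "x \<in> A (Suc j) \<longleftrightarrow> T x \<notin> E \<and> (\<forall>i\<in>{1..j}. (T ^^ i) (T x) \<notin> E)"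
        proof -
          have "{1..Suc j} = insert 1 (Suc ` {1..j})" by (auto simp: image_iff)
          then show ?thesis using x by (simp add: A_def funpow_swap1 del: image_Suc_atLeastAtMost)
        qed
        then show "?p k x * indicator ?B (T x) = ?p k x * indicator (A (Suc j)) x"
          using Tx by (auto simp: A_def indicator_def)
      qed
      finally show ?thesis .
    qed
    have bound: "(\<integral>x. ?p k x * indicator (A j) x \<partial>M) \<le> (\<integral>x. ?p 0 x * indicator (A (j + k)) x \<partial>M)" for k j
    proof (induction k arbitrary: j)
      case (Suc k)
      show ?case using order_trans[OF step Suc.IH[of "Suc j"]] by simp
    qed simp
    have A0: "A 0 = space M" by (simp add: A_def)
    have le: "(\<integral>x. ?p k x \<partial>M) \<le> (\<integral>x. ?p 0 x * indicator (A k) x \<partial>M)" for k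
    proof -
      have "(\<integral>x. ?p k x \<partial>M) = (\<integral>x. ?p k x * indicator (A 0) x \<partial>M)"
        by (rule Bochner_Integration.integral_cong) (auto simp: A0)
      then show ?thesis using bound[of k 0] by simp
    qed
    have "(\<lambda>k. \<integral>x. ?p 0 x * indicator (A k) x \<partial>M) \<longlonglongrightarrow> (\<integral>x. 0 \<partial>M)"
    proof (rule integral_dominated_convergence[where w="?p 0"])
      show "integrable M (?p 0)" by (rule p)
      have "AE x in M. \<exists>n\<ge>1. (T ^^ n) x \<in> E"
        by (rule recurrence[OF ce E]) (use False in \<open>simp add: zero_less_iff_neq_zero\<close>)
      then show "AE x in M. (\<lambda>k. ?p 0 x * indicator (A k) x) \<longlonglongrightarrow> 0"
      proof eventually_elim
        case (elim x)
        then obtain n where n: "1 \<le> n" "(T ^^ n) x \<in> E" by blast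
        then have "x \<notin> A k" if "n \<le> k" for k using that by (auto simp: A_def)
        then have "eventually (\<lambda>k. ?p 0 x * indicator (A k) x = 0) sequentially"
          unfolding eventually_sequentially by (intro exI[of _ n]) auto
        then show ?case by (rule tendsto_eventually)
      qed
      show "(\<lambda>x. ?p 0 x * indicator (A k) x) \<in> borel_measurable M" for k
        by (rule borel_measurable_integrable[OF i1[OF A]])
      show "AE x in M. norm (?p 0 x * indicator (A k) x) \<le> ?p 0 x" for k
        by (auto simp: indicator_def)
    qed simp
    then have "(\<lambda>k. \<integral>x. ?p 0 x * indicator (A k) x \<partial>M) \<longlonglongrightarrow> 0" by simp
    then show ?thesis
    proof (rule tendsto_sandwich[OF _ _ tendsto_const, rotated 2])
      show "eventually (\<lambda>k. 0 \<le> (\<integral>x. ?p k x \<partial>M)) sequentially" by simp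
      show "eventually (\<lambda>k. (\<integral>x. ?p k x \<partial>M) \<le> (\<integral>x. ?p 0 x * indicator (A k) x \<partial>M)) sequentially"
        by (rule always_eventually) (intro allI le)
    qed
  qed
  from tendsto_mult_right[OF this, of 2] show ?thesis using fill_abs_integral(1)[OF w] by simp
qed

text \<open>
  For fixed \<open>K\<close>, the first \<open>K\<close> steps of the filling scheme change the integral by terms that vanish as
  \<open>n\<close> tends to infinity, and what remains after them has small total variation.
\<close>
lemma asymptotically_invariant_integral:
  fixes H :: "nat \<Rightarrow> 'a \<Rightarrow> real" and w :: "'a \<Rightarrow> real"
  assumes ce: "conservative_ergodic M T"
    and H[measurable]: "\<And>n. H n \<in> borel_measurable M" and H1: "\<And>n x. \<bar>H n x\<bar> \<le> 1"
    and inv: "\<And>u. integrable M u \<Longrightarrow> (\<And>x. 0 \<le> u x) \<Longrightarrow> (\<lambda>n. \<integral>x. u x * \<bar>H n (T x) - H n x\<bar> \<partial>M) \<longlonglongrightarrow> 0"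
    and w: "integrable M w" "(\<integral>x. w x \<partial>M) = 0"
  shows "(\<lambda>n. \<integral>x. w x * H n x \<partial>M) \<longlonglongrightarrow> 0"
proof (rule LIMSEQ_I)
  fix e :: real assume e: "0 < e"
  from fill_converges[OF ce w] e obtain K where K: "(\<integral>x. \<bar>fill w K x\<bar> \<partial>M) < e / 2"
    using LIMSEQ_D[of _ 0 "e/2"] by (metis (no_types, lifting) diff_zero half_gt_zero order_refl real_norm_def abs_less_iff)
  note p = fill_pos_integrable(1)[OF w(1)]
  let ?s = "\<lambda>n. \<Sum>k<K. \<integral>x. max 0 (fill w k x) * \<bar>H n (T x) - H n x\<bar> \<partial>M"
  have "?s \<longlonglongrightarrow> (\<Sum>k<K. 0)" by (intro tendsto_sum inv p) auto
  then have "?s \<longlonglongrightarrow> 0" by simp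
  from LIMSEQ_D[OF this, of "e/2"] e obtain N where N: "\<And>n. N \<le> n \<Longrightarrow> \<bar>?s n\<bar> < e / 2" by auto
  have bound: "\<bar>\<integral>x. w x * H n x \<partial>M\<bar> \<le> ?s n + (\<integral>x. \<bar>fill w K x\<bar> \<partial>M)" for n
  proof -
    have HA: "AE x in M. \<bar>H n x\<bar> \<le> 1" using H1 by auto
    have d: "\<bar>(\<integral>x. fill w (Suc k) x * H n x \<partial>M) - (\<integral>x. fill w k x * H n x \<partial>M)\<bar>
      \<le> (\<integral>x. max 0 (fill w k x) * \<bar>H n (T x) - H n x\<bar> \<partial>M)" for k
    proof -
      have "\<bar>\<integral>x. max 0 (fill w k x) * (H n (T x) - H n x) \<partial>M\<bar>
        \<le> (\<integral>x. \<bar>max 0 (fill w k x) * (H n (T x) - H n x)\<bar> \<partial>M)" by (rule integral_abs_bound)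
      then show ?thesis unfolding fill_step[OF w(1) H H1] by (simp add: abs_mult)
    qed
    have "\<bar>\<integral>x. w x * H n x \<partial>M\<bar> \<le> (\<Sum>k<m. \<integral>x. max 0 (fill w k x) * \<bar>H n (T x) - H n x\<bar> \<partial>M)
        + \<bar>\<integral>x. fill w m x * H n x \<partial>M\<bar>" for m
    proof (induction m)
      case (Suc m)
      then show ?case using d[of m] by simp
    qed simp
    moreover have "\<bar>\<integral>x. fill w K x * H n x \<partial>M\<bar> \<le> (\<integral>x. \<bar>fill w K x\<bar> \<partial>M)"
    proof -
      have "\<bar>\<integral>x. fill w K x * H n x \<partial>M\<bar> \<le> (\<integral>x. \<bar>fill w K x * H n x\<bar> \<partial>M)" by (rule integral_abs_bound)
      also have "\<dots> \<le> (\<integral>x. \<bar>fill w K x\<bar> \<partial>M)"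
      proof (rule integral_mono)
        show "integrable M (\<lambda>x. \<bar>fill w K x * H n x\<bar>)"
          by (intro integrable_abs integrable_mult_bounded[OF fill_integrable[OF w(1)] H HA])
        show "integrable M (\<lambda>x. \<bar>fill w K x\<bar>)" by (intro integrable_abs fill_integrable w)
        show "\<bar>fill w K x * H n x\<bar> \<le> \<bar>fill w K x\<bar>" for x
          using H1[of n x] by (simp add: abs_mult mult_left_le)
      qed
      finally show ?thesis .
    qed
    ultimately show ?thesis by (meson add_left_mono order_trans)
  qed
  show "\<exists>N. \<forall>n\<ge>N. norm ((\<integral>x. w x * H n x \<partial>M) - 0) < e"
  proof (intro exI allI impI)
    fix n assume "N \<le> n"
    with N[of n] bound[of n] K show "norm ((\<integral>x. w x * H n x \<partial>M) - 0) < e" by simp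
  qed
qed

end

section \<open>Return times along an orbit\<close>

lemma Inf_eSuc_image: "Inf (eSuc ` S) = eSuc (Inf S)"
proof (cases "S = {}")
  case True then show ?thesis by (simp add: Inf_enat_def)
next
  case False
  then have "Inf S \<in> S" unfolding Inf_enat_def by (auto intro: LeastI)
  then have "Inf (eSuc ` S) \<le> eSuc (Inf S)" by (intro Inf_lower) auto
  moreover have "eSuc (Inf S) \<le> Inf (eSuc ` S)" by (intro Inf_greatest) (auto intro: Inf_lower)
  ultimately show ?thesis by (rule antisym)
qed

lemma return_time_shift:
  assumes "return_time T A k x = eSuc (return_time T A j (T x))"
  shows "return_time T A (Suc k) x = eSuc (return_time T A (Suc j) (T x))"
proof -
  have "{enat n | n. eSuc r < enat n \<and> (T ^^ n) x \<in> A} = eSuc ` {enat n | n. r < enat n \<and> (T ^^ n) (T x) \<in> A}" (is "?L = ?R") for r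
  proof
    show "?L \<subseteq> ?R"
    proof
      fix z assume "z \<in> ?L"
      then obtain n where n: "z = enat n" "eSuc r < enat n" "(T ^^ n) x \<in> A" by auto
      then obtain m where m: "n = Suc m" by (cases n) (auto simp: zero_enat_def[symmetric])
      with n have "z = eSuc (enat m)" "r < enat m" "(T ^^ m) (T x) \<in> A"
        by (auto simp: eSuc_enat[symmetric] funpow_swap1)
      then show "z \<in> ?R" by blast
    qed
    show "?R \<subseteq> ?L"
    proof
      fix z assume "z \<in> ?R"
      then obtain m where m: "z = eSuc (enat m)" "r < enat m" "(T ^^ m) (T x) \<in> A" by auto
      then have "z = enat (Suc m)" "eSuc r < enat (Suc m)" "(T ^^ Suc m) x \<in> A"
        by (auto simp: eSuc_enat[symmetric] funpow_swap1)
      then show "z \<in> ?L" by blast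
    qed
  qed
  then show ?thesis using assms by (simp add: Inf_eSuc_image)
qed

lemma return_time_in:
  assumes "T x \<in> A"
  shows "return_time T A (Suc k) x = eSuc (return_time T A k (T x))"
proof (induction k)
  case 0
  have "Inf {enat n | n. 0 < enat n \<and> (T ^^ n) x \<in> A} = 1"
  proof (rule antisym)
    show "Inf {enat n | n. 0 < enat n \<and> (T ^^ n) x \<in> A} \<le> 1"
      using assms by (intro Inf_lower) (auto simp: one_enat_def zero_enat_def intro!: exI[of _ 1])
    show "1 \<le> Inf {enat n | n. 0 < enat n \<and> (T ^^ n) x \<in> A}"
      by (intro Inf_greatest) (auto simp: one_enat_def zero_enat_def)
  qed
  then show ?case by (simp add: one_eSuc)
next
  case (Suc k)
  then show ?case by (rule return_time_shift)
qed

lemma return_time_out: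
  assumes "T x \<notin> A"
  shows "return_time T A (Suc k) x = eSuc (return_time T A (Suc k) (T x))"
proof (induction k)
  case 0
  have "{enat n | n. 0 < enat n \<and> (T ^^ n) x \<in> A} = eSuc ` {enat n | n. 0 < enat n \<and> (T ^^ n) (T x) \<in> A}" (is "?L = ?R")
  proof
    show "?L \<subseteq> ?R"
    proof
      fix z assume "z \<in> ?L"
      then obtain n where n: "z = enat n" "0 < n" "(T ^^ n) x \<in> A" by (auto simp: zero_enat_def)
      then obtain m where m: "n = Suc m" by (cases n) auto
      have "m \<noteq> 0" using n m assms by (cases m) auto
      with n m have "z = eSuc (enat m)" "0 < enat m" "(T ^^ m) (T x) \<in> A"
        by (auto simp: eSuc_enat[symmetric] funpow_swap1 zero_enat_def)
      then show "z \<in> ?R" by blast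
    qed
    show "?R \<subseteq> ?L"
    proof
      fix z assume "z \<in> ?R"
      then obtain m where m: "z = eSuc (enat m)" "(T ^^ m) (T x) \<in> A" by auto
      then have "z = enat (Suc m)" "0 < enat (Suc m)" "(T ^^ Suc m) x \<in> A"
        by (auto simp: eSuc_enat[symmetric] funpow_swap1)
      then show "z \<in> ?L" by blast
    qed
  qed
  then show ?case by (simp add: Inf_eSuc_image)
next
  case (Suc k)
  then show ?case by (rule return_time_shift)
qed

lemma return_time_mono: "return_time T A k x \<le> return_time T A (Suc k) x"
  by (auto intro!: Inf_greatest)

lemma scaled_return_monotone: "scaled_seq c (return_seq T A x) \<in> monotone_seqs"
  using return_time_mono[of T A _ x]
  by (auto simp: monotone_seqs_def scaled_seq_def return_seq_def intro!: mult_left_mono simp del: return_time.simps)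

lemma scaled_return_in:
  assumes "T x \<in> A"
  shows "scaled_seq c (return_seq T A x) = case_nat (ennreal c) (\<lambda>i. ennreal c + scaled_seq c (return_seq T A (T x)) i)"
proof
  fix i
  show "scaled_seq c (return_seq T A x) i = case_nat (ennreal c) (\<lambda>i. ennreal c + scaled_seq c (return_seq T A (T x)) i) i"
  proof (cases i)
    case 0
    then show ?thesis
      using return_time_in[of T x A 0, OF assms] by (simp add: scaled_seq_def return_seq_def del: return_time.simps(2))
  next
    case (Suc j)
    then show ?thesis
      using return_time_in[of T x A i, OF assms]
      by (simp add: scaled_seq_def return_seq_def distrib_left del: return_time.simps)
  qed
qed

lemma scaled_return_out:
  assumes "T x \<notin> A"
  shows "scaled_seq c (return_seq T A x) = (\<lambda>i. ennreal c + scaled_seq c (return_seq T A (T x)) i)"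
  using return_time_out[of T x A, OF assms]
  by (auto simp: scaled_seq_def return_seq_def distrib_left simp del: return_time.simps)

text \<open>
  One step of the orbit. If \<open>T x\<close> lies outside \<open>A\<close>, every return time of \<open>x\<close> is one more than that of
  \<open>T x\<close>; if \<open>T x\<close> lies in \<open>A\<close>, the first return time is 1 and the following ones are one more than the
  return times of \<open>T x\<close>. In both cases a factor \<open>exp (- s * c)\<close> splits off.
\<close>
lemma lap_return_step:
  assumes \<delta>: "\<delta> 0 = 0" and c: "0 \<le> c"
  shows "lap s (excess (Suc d) \<delta> (scaled_seq c (return_seq T A x))) =
    exp (- s * c) * (if T x \<in> A then lap s (excess d (\<lambda>i. \<delta> (Suc i)) (scaled_seq c (return_seq T A (T x))))
      else lap s (excess (Suc d) \<delta> (scaled_seq c (return_seq T A (T x)))))"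
  using scaled_return_in[of T x A c] scaled_return_out[of T x A c]
    excess_case_nat[where \<delta>=\<delta>, OF \<delta>] excess_shift[where \<delta>=\<delta>, OF \<delta>] lap_ennreal_add[OF c]
  by simp

lemma ennreal_of_enat_Inf_Collect:
  "ennreal_of_enat (Inf {enat n | n. P n}) = (INF n. if P n then of_nat n else \<top>)"
proof (rule antisym)
  show "ennreal_of_enat (Inf {enat n | n. P n}) \<le> (INF n. if P n then of_nat n else \<top>)"
  proof (rule INF_greatest)
    fix n
    show "ennreal_of_enat (Inf {enat n | n. P n}) \<le> (if P n then of_nat n else \<top>)"
    proof (cases "P n")
      case True
      then have "Inf {enat n | n. P n} \<le> enat n" by (intro Inf_lower) auto
      then show ?thesis using True ennreal_of_enat_le_iff[of _ "enat n"] by simp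
    qed simp
  qed
  show "(INF n. if P n then of_nat n else \<top>) \<le> ennreal_of_enat (Inf {enat n | n. P n})"
  proof (cases "\<exists>n. P n")
    case True
    then have "Inf {enat n | n. P n} \<in> {enat n | n. P n}" unfolding Inf_enat_def
      using LeastI_ex[of "\<lambda>x. x \<in> {enat n | n. P n}"] by auto
    then obtain n where n: "Inf {enat n | n. P n} = enat n" "P n" by auto
    have "(INF n. if P n then of_nat n else \<top>) \<le> (if P n then of_nat n else \<top> :: ennreal)" by (rule INF_lower) simp
    then show ?thesis using n by simp
  qed (simp add: Inf_enat_def)
qed

context mpt_system
begin

lemma return_time_measurable:
  assumes [measurable]: "A \<in> sets M"
  shows "(\<lambda>x. ennreal_of_enat (return_time T A k x)) \<in> borel_measurable M"
proof (induction k)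
  case (Suc k)
  note [measurable] = Suc
  have lt: "return_time T A k x < enat n \<longleftrightarrow> ennreal_of_enat (return_time T A k x) < of_nat n" for x n
    using ennreal_of_enat_le_iff[of "enat n" "return_time T A k x"] by (simp only: not_le[symmetric] ennreal_of_enat_enat)
  show ?case
    unfolding return_time.simps ennreal_of_enat_Inf_Collect lt by measurable
qed simp

lemma scaled_return_measurable:
  assumes "A \<in> sets M"
  shows "(\<lambda>x. scaled_seq c (return_seq T A x)) \<in> borel_measurable M"
proof (rule measurable_coordinatewise_then_product)
  fix i
  note [measurable] = return_time_measurable[OF assms]
  show "(\<lambda>x. scaled_seq c (return_seq T A x) i) \<in> borel_measurable M"
    unfolding scaled_seq_def return_seq_def by measurable
qed

lemma lap_return_measurable:
  assumes "A \<in> sets M" "0 < s"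
  shows "(\<lambda>x. lap s (excess d \<delta> (scaled_seq c (return_seq T A x)))) \<in> borel_measurable M"
  by (rule measurable_compose[OF scaled_return_measurable[OF assms(1)]
        borel_measurable_continuous_onI[OF continuous_on_lap_excess[OF assms(2)]]])

section \<open>The renewal identity\<close>

text \<open>
  By \<open>lap_return_step\<close>, \<open>D\<close> equals \<open>exp (- s * c)\<close> times \<open>D + indicator A * (E - D)\<close> composed with \<open>T\<close>;
  duality moves \<open>T\<close> to the transfer operator, and the identity is iterated \<open>n\<close> times.
\<close>
lemma renewal_identity:
  fixes A c s \<delta> d
  defines "D \<equiv> \<lambda>x. lap s (excess (Suc d) \<delta> (scaled_seq c (return_seq T A x)))"
    and "E \<equiv> \<lambda>x. lap s (excess d (\<lambda>i. \<delta> (Suc i)) (scaled_seq c (return_seq T A x)))"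
  assumes A[measurable]: "A \<in> sets M" and c: "0 \<le> c" and s: "0 < s" and \<delta>: "\<delta> 0 = 0" and f: "integrable M f"
  shows "(\<integral>x. f x * D x \<partial>M) = (\<Sum>k=1..n. exp (- s * c) ^ k * (\<integral>x. (transfer M T ^^ k) f x * (indicator A x * (E x - D x)) \<partial>M))
     + exp (- s * c) ^ n * (\<integral>x. (transfer M T ^^ n) f x * D x \<partial>M)"
proof (induction n)
  case (Suc n)
  let ?q = "exp (- s * c)" and ?t = "\<lambda>k. (transfer M T ^^ k) f"
  let ?g = "\<lambda>x. indicator A x * (E x - D x)"
  have Dm[measurable]: "D \<in> borel_measurable M" and Em[measurable]: "E \<in> borel_measurable M"
    unfolding D_def E_def by (rule lap_return_measurable[OF A s])+
  have D1: "0 \<le> D x" "D x \<le> 1" and E1: "0 \<le> E x" "E x \<le> 1" for x using s by (simp_all add: D_def E_def)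
  have gm: "?g \<in> borel_measurable M" by measurable
  have g1: "\<bar>?g x\<bar> \<le> 1" for x using D1[of x] E1[of x] by (auto simp: indicator_def)
  have step: "D x = ?q * (D (T x) + ?g (T x))" for x
    using lap_return_step[where \<delta>=\<delta> and T=T and A=A and x=x and d=d and s=s, OF \<delta> c] by (simp add: D_def E_def)
  have "(\<integral>x. ?t n x * D x \<partial>M) = ?q * (\<integral>x. ?t n x * (D (T x) + ?g (T x)) \<partial>M)"
    by (subst step) (simp add: mult.left_commute)
  also have "(\<integral>x. ?t n x * (D (T x) + ?g (T x)) \<partial>M) = (\<integral>x. ?t (Suc n) x * (D x + ?g x) \<partial>M)"
    using transfer_integral[OF iterate_integrable[OF f, of n], of "\<lambda>x. D x + ?g x" 2]
      D1 g1 by (simp add: abs_le_iff) (smt (verit) D1 g1)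
  also have "\<dots> = (\<integral>x. ?t (Suc n) x * ?g x \<partial>M) + (\<integral>x. ?t (Suc n) x * D x \<partial>M)"
  proof -
    have a: "integrable M (\<lambda>x. ?t (Suc n) x * ?g x)"
      by (rule integrable_mult_bounded[where C=1, OF iterate_integrable[OF f] gm]) (simp add: g1)
    have b: "integrable M (\<lambda>x. ?t (Suc n) x * D x)"
      by (rule integrable_mult_bounded[where C=1, OF iterate_integrable[OF f] Dm]) (simp add: D1)
    show ?thesis using Bochner_Integration.integral_add[OF a b] by (simp add: distrib_left add.commute)
  qed
  finally show ?case using Suc.IH by (simp add: distrib_left mult.assoc mult.left_commute)
qed simp

end

section \<open>Abelian estimates\<close>

text \<open>
  Abel summation writes both power series through their partial sums. From index \<open>N\<close> on these differ by
  at most the relative error \<open>\<eta>\<close>; before \<open>N\<close> the difference is bounded by \<open>S N + A N\<close>, and the weights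
  \<open>(1 / q - 1) * q ^ k\<close> have total mass \<open>1 / q\<close>.
\<close>
lemma abel_summation_estimate:
  fixes t A :: "nat \<Rightarrow> real" and q \<eta> :: real
  defines "S \<equiv> \<lambda>n. \<Sum>k<n. t k"
  assumes t: "\<And>k. 0 \<le> t k" and A: "\<And>k. 0 \<le> A k" "mono A"
    and q: "0 < q" "q < 1" and sumA: "summable (\<lambda>k. q ^ k * A k)"
    and close: "\<And>n. N \<le> n \<Longrightarrow> \<bar>S n - A n\<bar> \<le> \<eta> * A n" and \<eta>: "0 \<le> \<eta>"
  shows "summable (\<lambda>k. q ^ k * t k)"
    and "\<bar>(\<Sum>k. q ^ k * t k) - (1 / q - 1) * (\<Sum>k. q ^ k * A k)\<bar>
        \<le> \<eta> * ((1 / q - 1) * (\<Sum>k. q ^ k * A k)) + (S N + A N) / q"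
proof -
  have S0: "0 \<le> S n" for n unfolding S_def using t by (intro sum_nonneg) auto
  have Smono: "S m \<le> S n" if "m \<le> n" for m n unfolding S_def using t that by (intro sum_mono2) auto
  have diff: "\<bar>S k - A k\<bar> \<le> \<eta> * A k + (S N + A N)" for k
  proof (cases "N \<le> k")
    case True
    then show ?thesis using close[OF True] S0[of N] A(1)[of N] by linarith
  next
    case False
    then have "S k \<le> S N" "A k \<le> A N" using Smono monoD[OF A(2)] by auto
    moreover have "0 \<le> \<eta> * A k" using \<eta> A by simp
    ultimately show ?thesis using S0[of k] A(1)[of k] by linarith
  qed
  have geo: "summable (\<lambda>k. q ^ k)" "(\<Sum>k. q ^ k) = 1 / (1 - q)"
    using q by (auto intro!: summable_geometric suminf_geometric)
  let ?b = "\<lambda>k. \<eta> * (q ^ k * A k) + (S N + A N) * q ^ k"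
  have sb: "summable ?b" by (intro summable_add summable_mult sumA geo)
  have dq: "\<bar>q ^ k * (S k - A k)\<bar> \<le> ?b k" for k
  proof -
    have "\<bar>q ^ k * (S k - A k)\<bar> = q ^ k * \<bar>S k - A k\<bar>" using q by (simp add: abs_mult)
    also have "\<dots> \<le> q ^ k * (\<eta> * A k + (S N + A N))" using q diff by (intro mult_left_mono) auto
    also have "\<dots> = ?b k" by (simp add: algebra_simps)
    finally show ?thesis .
  qed
  have sd: "summable (\<lambda>k. q ^ k * (S k - A k))"
    by (rule summable_comparison_test'[OF sb, of 0]) (simp add: dq)
  have sS: "summable (\<lambda>k. q ^ k * S k)"
    using summable_add[OF sd sumA] by (simp add: algebra_simps)
  have sS1: "summable (\<lambda>k. q ^ k * S (Suc k))"
  proof -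
    have "summable (\<lambda>k. (1 / q) * (q ^ Suc k * S (Suc k)))"
      using sS by (intro summable_mult) (subst summable_Suc_iff)
    then show ?thesis using q by simp
  qed
  have tS: "q ^ k * t k = q ^ k * S (Suc k) - q ^ k * S k" for k by (simp add: S_def algebra_simps)
  show "summable (\<lambda>k. q ^ k * t k)" unfolding tS by (intro summable_diff sS1 sS)
  have "(\<Sum>k. q ^ k * t k) = (\<Sum>k. q ^ k * S (Suc k)) - (\<Sum>k. q ^ k * S k)"
    unfolding tS by (rule suminf_diff[OF sS1 sS, symmetric])
  also have "(\<Sum>k. q ^ k * S (Suc k)) = (1 / q) * (\<Sum>k. q ^ k * S k)"
  proof -
    have "(\<Sum>k. q ^ Suc k * S (Suc k)) = (\<Sum>k. q ^ k * S k)"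
      using suminf_split_head[OF sS] by (simp add: S_def)
    moreover have "(\<Sum>k. q ^ Suc k * S (Suc k)) = q * (\<Sum>k. q ^ k * S (Suc k))"
      using suminf_mult[OF sS1, of q] by (simp add: mult.assoc)
    ultimately show ?thesis using q by (simp add: field_simps)
  qed
  finally have e: "(\<Sum>k. q ^ k * t k) = (1 / q - 1) * (\<Sum>k. q ^ k * S k)" by (simp add: left_diff_distrib)
  have d: "(\<Sum>k. q ^ k * (S k - A k)) = (\<Sum>k. q ^ k * S k) - (\<Sum>k. q ^ k * A k)"
    using suminf_diff[OF sS sumA] by (simp only: right_diff_distrib)
  have "(\<Sum>k. q ^ k * t k) - (1 / q - 1) * (\<Sum>k. q ^ k * A k) = (1 / q - 1) * (\<Sum>k. q ^ k * (S k - A k))"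
    unfolding e d by (simp only: right_diff_distrib)
  moreover have "\<bar>\<Sum>k. q ^ k * (S k - A k)\<bar> \<le> \<eta> * (\<Sum>k. q ^ k * A k) + (S N + A N) * (1 / (1 - q))"
  proof -
    have sa: "summable (\<lambda>k. \<bar>q ^ k * (S k - A k)\<bar>)"
      by (rule summable_comparison_test'[OF sb, of 0]) (simp add: dq)
    have "\<bar>\<Sum>k. q ^ k * (S k - A k)\<bar> \<le> (\<Sum>k. \<bar>q ^ k * (S k - A k)\<bar>)" by (rule summable_rabs[OF sa])
    also have "\<dots> \<le> (\<Sum>k. ?b k)" by (rule suminf_le[OF dq sa sb])
    also have "\<dots> = \<eta> * (\<Sum>k. q ^ k * A k) + (S N + A N) * (\<Sum>k. q ^ k)"
      by (simp only: suminf_add[symmetric, OF summable_mult[OF sumA] summable_mult[OF geo(1)]]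
          suminf_mult[OF sumA] suminf_mult[OF geo(1)])
    finally show ?thesis by (simp add: geo)
  qed
  moreover have q1: "0 \<le> 1 / q - 1" using q by simp
  ultimately have "\<bar>(\<Sum>k. q ^ k * t k) - (1 / q - 1) * (\<Sum>k. q ^ k * A k)\<bar>
    \<le> (1 / q - 1) * (\<eta> * (\<Sum>k. q ^ k * A k) + (S N + A N) * (1 / (1 - q)))"
    by (simp add: abs_mult mult_left_mono)
  also have "\<dots> = \<eta> * ((1 / q - 1) * (\<Sum>k. q ^ k * A k)) + (S N + A N) * ((1 / q - 1) * (1 / (1 - q)))"
    by (simp add: algebra_simps)
  also have "(1 / q - 1) * (1 / (1 - q)) = 1 / q" using q by (simp add: field_simps)
  finally show "\<bar>(\<Sum>k. q ^ k * t k) - (1 / q - 1) * (\<Sum>k. q ^ k * A k)\<bar>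
        \<le> \<eta> * ((1 / q - 1) * (\<Sum>k. q ^ k * A k)) + (S N + A N) / q" by simp
qed

text \<open>
  The floor makes the integrand a step function; on its \<open>k\<close>-th step the exponential weight integrates
  to a difference of consecutive powers.
\<close>
lemma nn_integral_exp_floor:
  fixes A :: "nat \<Rightarrow> real"
  assumes A: "\<And>k. 0 \<le> A k" and s: "0 < s" and x: "0 < x"
  shows "(\<integral>\<^sup>+u. ennreal (indicator {0..} u * (s * exp (- s * u)) * floor_ext A (x * u)) \<partial>lborel)
    = (\<Sum>k. ennreal ((exp (- s / x) ^ k - exp (- s / x) ^ Suc k) * A k))"
proof -
  let ?I = "\<lambda>k. {real k / x ..< real (Suc k) / x}"
  have bin: "indicator {0..} u * (s * exp (- s * u)) * floor_ext A (x * u) =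
      (if 0 \<le> u then s * exp (- s * u) * A (nat \<lfloor>x * u\<rfloor>) else 0)" for u
    by (simp add: floor_ext_def)
  have mem: "u \<in> ?I k \<longleftrightarrow> 0 \<le> u \<and> k = nat \<lfloor>x * u\<rfloor>" for u k
  proof -
    have "u \<in> ?I k \<longleftrightarrow> real k \<le> x * u \<and> x * u < real (Suc k)"
      using x by (auto simp: field_simps)
    also have "\<dots> \<longleftrightarrow> 0 \<le> u \<and> k = nat \<lfloor>x * u\<rfloor>"
    proof
      assume a: "real k \<le> x * u \<and> x * u < real (Suc k)"
      then have "0 \<le> x * u" by linarith
      then have "0 \<le> u" using x by (simp add: zero_le_mult_iff)
      moreover have "\<lfloor>x * u\<rfloor> = int k" using a by (intro floor_unique) auto
      ultimately show "0 \<le> u \<and> k = nat \<lfloor>x * u\<rfloor>" by simp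
    next
      assume a: "0 \<le> u \<and> k = nat \<lfloor>x * u\<rfloor>"
      then have "0 \<le> x * u" using x by simp
      then have "real k = of_int \<lfloor>x * u\<rfloor>" using a by simp
      then show "real k \<le> x * u \<and> x * u < real (Suc k)" by linarith
    qed
    finally show ?thesis .
  qed
  have "ennreal (indicator {0..} u * (s * exp (- s * u)) * floor_ext A (x * u))
    = (\<Sum>k. ennreal (s * exp (- s * u) * A k) * indicator (?I k) u)" for u
  proof (cases "0 \<le> u")
    case True
    have "(\<Sum>k. ennreal (s * exp (- s * u) * A k) * indicator (?I k) u)
      = (\<Sum>k\<in>{nat \<lfloor>x * u\<rfloor>}. ennreal (s * exp (- s * u) * A k) * indicator (?I k) u)"
      by (rule suminf_finite) (use mem in \<open>auto simp: indicator_def\<close>)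
    also have "\<dots> = ennreal (s * exp (- s * u) * A (nat \<lfloor>x * u\<rfloor>))"
    proof -
      have "indicator (?I (nat \<lfloor>x * u\<rfloor>)) u = (1 :: ennreal)"
        unfolding indicator_def mem using True by simp
      then show ?thesis by simp
    qed
    finally show ?thesis using True by (simp add: floor_ext_def)
  next
    case False
    then have "indicator (?I k) u = (0::ennreal)" for k unfolding indicator_def mem by simp
    then show ?thesis using False by simp
  qed
  then have "(\<integral>\<^sup>+u. ennreal (indicator {0..} u * (s * exp (- s * u)) * floor_ext A (x * u)) \<partial>lborel)
    = (\<integral>\<^sup>+u. (\<Sum>k. ennreal (s * exp (- s * u) * A k) * indicator (?I k) u) \<partial>lborel)" by simp
  also have "\<dots> = (\<Sum>k. \<integral>\<^sup>+u. ennreal (s * exp (- s * u) * A k) * indicator (?I k) u \<partial>lborel)"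
    by (rule nn_integral_suminf) measurable
  also have "\<dots> = (\<Sum>k. ennreal ((exp (- s / x) ^ k - exp (- s / x) ^ Suc k) * A k))"
  proof (rule suminf_cong)
    fix k
    let ?a = "real k / x" and ?b = "real (Suc k) / x"
    have ab: "?a \<le> ?b" using x by (simp add: divide_right_mono)
    let ?w = "\<lambda>u. ennreal (s * exp (- s * u))"
    have "(\<integral>\<^sup>+u. ?w u * indicator {?a..} u \<partial>lborel) = (\<integral>\<^sup>+u. ?w u * indicator (?I k) u + ?w u * indicator {?b..} u \<partial>lborel)"
      using ab by (intro nn_integral_cong) (auto simp: indicator_def)
    also have "\<dots> = (\<integral>\<^sup>+u. ?w u * indicator (?I k) u \<partial>lborel) + (\<integral>\<^sup>+u. ?w u * indicator {?b..} u \<partial>lborel)"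
      by (rule nn_integral_add) measurable
    finally have "ennreal (exp (- s * ?a)) = (\<integral>\<^sup>+u. ?w u * indicator (?I k) u \<partial>lborel) + ennreal (exp (- s * ?b))"
      unfolding nn_integral_exp_tail[OF s] .
    then have w: "(\<integral>\<^sup>+u. ?w u * indicator (?I k) u \<partial>lborel) = ennreal (exp (- s * ?a) - exp (- s * ?b))"
      by (simp add: ennreal_minus[symmetric])
    have "(\<integral>\<^sup>+u. ennreal (s * exp (- s * u) * A k) * indicator (?I k) u \<partial>lborel)
      = (\<integral>\<^sup>+u. ennreal (A k) * (?w u * indicator (?I k) u) \<partial>lborel)"
      using s A by (intro nn_integral_cong) (simp add: ennreal_mult mult_ac)
    also have "\<dots> = ennreal (A k) * ennreal (exp (- s * ?a) - exp (- s * ?b))"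
      unfolding w[symmetric] by (rule nn_integral_cmult) measurable
    also have "\<dots> = ennreal ((exp (- s * ?a) - exp (- s * ?b)) * A k)"
    proof -
      have "- s * ?b \<le> - s * ?a" using ab s by (intro mult_left_mono_neg) auto
      then have "0 \<le> exp (- s * ?a) - exp (- s * ?b)" by (simp only: exp_le_cancel_iff diff_ge_0_iff_ge)
      then show ?thesis using A by (subst ennreal_mult[symmetric]) (auto simp: mult.commute)
    qed
    also have "exp (- s * ?a) = exp (- s / x) ^ k" by (simp add: exp_of_nat_mult [symmetric] mult.commute)
    also have "exp (- s * ?b) = exp (- s / x) ^ Suc k"
      unfolding exp_of_nat_mult [symmetric] by (simp add: mult.commute)
    finally show "(\<integral>\<^sup>+u. ennreal (s * exp (- s * u) * A k) * indicator (?I k) u \<partial>lborel)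
      = ennreal ((exp (- s / x) ^ k - exp (- s / x) ^ Suc k) * A k)" .
  qed
  finally show ?thesis .
qed

lemma floor_ext_mono:
  assumes "mono A" "x \<le> y" shows "floor_ext A x \<le> floor_ext A y"
  unfolding floor_ext_def using assms by (intro monoD[OF assms(1)] nat_mono floor_mono)

text \<open>
  A Potter bound. Doubling the argument multiplies \<open>A\<close> asymptotically by \<open>2 powr \<alpha> \<le> 2\<close>, hence by at
  most 4 from some \<open>X\<close> on. For \<open>u > 1\<close> take the least \<open>k\<close> with \<open>u \<le> 2 ^ k\<close>; then \<open>2 ^ k \<le> 2 * u\<close>, so
  \<open>4 ^ k \<le> 4 * u\<^sup>2\<close>.
\<close>
lemma regular_variation_quadratic_bound:
  fixes A :: "nat \<Rightarrow> real"
  assumes A: "\<And>k. 0 \<le> A k" "mono A" and rv: "regularly_varying A \<alpha>" and \<alpha>: "\<alpha> \<le> 1"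
    and pos: "eventually (\<lambda>x. 0 < floor_ext A x) at_top"
  obtains X where "0 < X" "\<And>x u. X \<le> x \<Longrightarrow> 0 \<le> u \<Longrightarrow> floor_ext A (x * u) \<le> (1 + 4 * u\<^sup>2) * floor_ext A x"
proof -
  have "2 powr \<alpha> \<le> 2 powr 1" using \<alpha> by (intro powr_mono) auto
  then have "2 powr \<alpha> < (4::real)" by simp
  moreover have "((\<lambda>x. floor_ext A (x * 2) / floor_ext A x) \<longlongrightarrow> 2 powr \<alpha>) at_top"
    using rv by (simp add: regularly_varying_def)
  ultimately have "eventually (\<lambda>x. floor_ext A (x * 2) / floor_ext A x < 4) at_top"
    by (rule order_tendstoD(2)[rotated])
  with pos have "eventually (\<lambda>x. floor_ext A (x * 2) \<le> 4 * floor_ext A x) at_top"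
    by eventually_elim (auto simp: divide_less_eq)
  then obtain X1 where X1: "\<And>x. X1 \<le> x \<Longrightarrow> floor_ext A (x * 2) \<le> 4 * floor_ext A x"
    unfolding eventually_at_top_linorder by blast
  define X where "X = max X1 1"
  have A0: "0 \<le> floor_ext A x" for x using A by (simp add: floor_ext_def)
  have pow: "floor_ext A (x * 2 ^ k) \<le> 4 ^ k * floor_ext A x" if x: "X \<le> x" for x k
  proof (induction k)
    case (Suc k)
    have "1 * X1 \<le> x * 2 ^ k" if "0 \<le> X1" using x that by (intro order_trans[OF _ mult_mono[of X1 x 1 "2 ^ k"]]) (auto simp: X_def)
    moreover have "X1 \<le> x * 2 ^ k" if "X1 \<le> 0" using x that by (intro order_trans[OF that]) (auto simp: X_def)
    ultimately have "X1 \<le> x * 2 ^ k" by linarith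
    from X1[OF this] Suc show ?case by (simp add: mult_ac)
  qed simp
  show thesis
  proof (rule that[of X])
    show "0 < X" by (simp add: X_def)
    fix x u assume x: "X \<le> x" and u: "0 \<le> (u::real)"
    have x0: "0 < x" using x by (simp add: X_def)
    show "floor_ext A (x * u) \<le> (1 + 4 * u\<^sup>2) * floor_ext A x"
    proof (cases "u \<le> 1")
      case True
      have "floor_ext A (x * u) \<le> floor_ext A x"
        using True x0 by (intro floor_ext_mono A) (simp add: mult_left_le)
      also have "\<dots> = 1 * floor_ext A x" by simp
      also have "\<dots> \<le> (1 + 4 * u\<^sup>2) * floor_ext A x" using A0 by (intro mult_right_mono) auto
      finally show ?thesis .
    next
      case False
      define k where "k = (LEAST k. u \<le> 2 ^ k)"
      have ex: "\<exists>k. u \<le> 2 ^ k" using real_arch_pow[of 2 u] by (auto intro: less_imp_le)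
      have k: "u \<le> 2 ^ k" unfolding k_def using LeastI_ex[OF ex] .
      have "k \<noteq> 0" using k False by (intro notI) auto
      then obtain j where j: "k = Suc j" by (cases k) auto
      have "\<not> u \<le> 2 ^ j" using not_less_Least[of j "\<lambda>k. u \<le> 2 ^ k"] j by (simp add: k_def)
      then have "(2 ^ k :: real) \<le> 2 * u" using j by simp
      then have "(2 ^ k)\<^sup>2 \<le> (2 * u)\<^sup>2" by (intro power_mono) auto
      moreover have "(2 ^ k)\<^sup>2 = (4 ^ k :: real)" by (simp add: power2_eq_square power_mult_distrib [symmetric])
      ultimately have 4: "4 ^ k \<le> 1 + 4 * u\<^sup>2" by (simp add: power_mult_distrib)
      have "floor_ext A (x * u) \<le> floor_ext A (x * 2 ^ k)"
        using k x0 by (intro floor_ext_mono A mult_left_mono) auto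
      also have "\<dots> \<le> 4 ^ k * floor_ext A x" by (rule pow[OF x])
      also have "\<dots> \<le> (1 + 4 * u\<^sup>2) * floor_ext A x" using 4 A0 by (intro mult_right_mono)
      finally show ?thesis .
    qed
  qed
qed

lemma integrable_exp_powr:
  fixes s \<beta> :: real
  assumes "0 < s" "0 \<le> \<beta>"
  shows "integrable lborel (\<lambda>u. indicator {0..} u * (exp (- s * u) * u powr \<beta>))"
    and "(\<integral>u. indicator {0..} u * (exp (- s * u) * u powr \<beta>) \<partial>lborel) = Gamma (1 + \<beta>) * s powr (- \<beta> - 1)"
proof -
  let ?g = "\<lambda>u. indicator {0..} u * (exp (- s * u) * u powr \<beta>)"
  have e: "(\<integral>\<^sup>+u. ennreal ((1 + \<beta>) * ?g u) \<partial>lborel) = ennreal (Gamma (2 + \<beta>) * s powr (- \<beta> - 1))"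
    using laplace_powr_kernel[of "1 + \<beta>" s 0] assms by (simp add: mult_ac add_ac minus_diff_commute)
  have i: "integrable lborel (\<lambda>u. (1 + \<beta>) * ?g u)"
    by (rule integrableI_nonneg) (use e assms in auto)
  then show "integrable lborel ?g" using assms by simp
  have G: "0 < Gamma (2 + \<beta>)" using assms by (intro Gamma_real_pos) simp
  have "(1 + \<beta>) * (\<integral>u. ?g u \<partial>lborel) = (\<integral>u. (1 + \<beta>) * ?g u \<partial>lborel)" by simp
  also have "\<dots> = enn2real (ennreal (Gamma (2 + \<beta>) * s powr (- \<beta> - 1)))"
    unfolding e[symmetric] by (rule integral_eq_nn_integral) (use assms in auto)
  also have "\<dots> = Gamma (2 + \<beta>) * s powr (- \<beta> - 1)" using G by simp
  also have "Gamma (2 + \<beta>) = (1 + \<beta>) * Gamma (1 + \<beta>)"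
    using Gamma_plus1[of "1 + \<beta>"] assms by (auto simp: add_ac nonpos_Ints_def)
  finally have "(1 + \<beta>) * (\<integral>u. ?g u \<partial>lborel) = (1 + \<beta>) * (Gamma (1 + \<beta>) * s powr (- \<beta> - 1))" by simp
  then show "(\<integral>u. ?g u \<partial>lborel) = Gamma (1 + \<beta>) * s powr (- \<beta> - 1)"
    using assms by (subst (asm) mult_left_cancel) auto
qed

text \<open>
  The Abel sum is the integral of \<open>s * exp (- s * u) * A (x n * u)\<close>. Multiplied by \<open>\<mu> n\<close>, the integrand
  converges to \<open>m * s * exp (- s * u) * u powr \<alpha>\<close> by regular variation, and the quadratic bound supplies
  an integrable majorant.
\<close>
lemma abelian_limit_aux:
  fixes A :: "nat \<Rightarrow> real" and x \<mu> :: "nat \<Rightarrow> real"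
  assumes A: "\<And>k. 0 \<le> A k" "mono A" and rv: "regularly_varying A \<alpha>" and \<alpha>: "0 < \<alpha>"
    and pos: "eventually (\<lambda>x. 0 < floor_ext A x) at_top"
    and s: "0 < s" and x: "filterlim x at_top sequentially" and \<mu>: "\<And>n. 0 < \<mu> n"
    and lim: "(\<lambda>n. floor_ext A (x n) * \<mu> n) \<longlonglongrightarrow> m" and m: "0 \<le> m"
    and X: "0 < X" "\<And>x u. X \<le> x \<Longrightarrow> 0 \<le> u \<Longrightarrow> floor_ext A (x * u) \<le> (1 + 4 * u\<^sup>2) * floor_ext A x"
    and xX: "\<And>n. X \<le> x n" and bd: "\<And>n. floor_ext A (x n) * \<mu> n \<le> m + 1"
  shows "summable (\<lambda>k. exp (- s / x n) ^ k * A k)"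
    and "(\<lambda>n. \<mu> n * ((1 / exp (- s / x n) - 1) * (\<Sum>k. exp (- s / x n) ^ k * A k)))
      \<longlonglongrightarrow> m * (Gamma (1 + \<alpha>) * s powr (- \<alpha>))"
proof -
  have A0: "0 \<le> floor_ext A x" for x using A by (simp add: floor_ext_def)
  have x0: "0 < x n" for n using xX[of n] X(1) by linarith
  let ?h = "\<lambda>n u. indicator {0..} u * (s * exp (- s * u)) * floor_ext A (x n * u)"
  let ?g = "\<lambda>n u. ?h n u * \<mu> n"
  let ?e = "\<lambda>\<beta> u. indicator {0..} u * (exp (- s * u) * u powr \<beta>)"
  let ?W = "\<lambda>u. s * (m + 1) * (?e 0 u + 4 * ?e 2 u)"
  have meas[measurable]: "(\<lambda>u. floor_ext A (x n * u)) \<in> borel_measurable borel" for n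
    unfolding floor_ext_def by measurable
  have W: "integrable lborel ?W"
    using integrable_exp_powr(1)[OF s, of 0] integrable_exp_powr(1)[OF s, of 2]
    by (intro integrable_mult_right Bochner_Integration.integrable_add) auto
  have nz: "AE u in lborel. u \<noteq> (0::real)" by (rule AE_lborel_singleton)
  have gW: "AE u in lborel. norm (?g n u) \<le> ?W u" for n
    using nz
  proof eventually_elim
    case (elim u)
    show ?case
    proof (cases "0 \<le> u")
      case True
      then have u: "0 < u" using elim by simp
      have "floor_ext A (x n * u) * \<mu> n \<le> (1 + 4 * u\<^sup>2) * floor_ext A (x n) * \<mu> n"
        using X(2)[OF xX True] \<mu>[of n] by (intro mult_right_mono) (auto simp: less_imp_le)
      also have "\<dots> = (1 + 4 * u\<^sup>2) * (floor_ext A (x n) * \<mu> n)" by simp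
      also have "\<dots> \<le> (1 + 4 * u\<^sup>2) * (m + 1)" using bd by (intro mult_left_mono) auto
      finally have "s * exp (- s * u) * (floor_ext A (x n * u) * \<mu> n) \<le> s * exp (- s * u) * ((1 + 4 * u\<^sup>2) * (m + 1))"
        using s by (intro mult_left_mono) auto
      moreover have "norm (?g n u) = s * exp (- s * u) * (floor_ext A (x n * u) * \<mu> n)"
        using True s A0 \<mu>[of n] by (simp add: abs_mult)
      moreover have "?W u = s * exp (- s * u) * ((1 + 4 * u\<^sup>2) * (m + 1))"
        using u by (simp add: powr_numeral algebra_simps)
      ultimately show ?thesis by linarith
    qed simp
  qed
  have gm: "?g n \<in> borel_measurable lborel" for n by measurable
  have ig: "integrable lborel (?g n)" for n
  proof (rule Bochner_Integration.integrable_bound[OF W gm])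
    show "AE u in lborel. norm (?g n u) \<le> norm (?W u)"
      using gW[of n] by eventually_elim (rule order_trans, assumption, simp only: real_norm_def abs_ge_self)
  qed
  have ih: "integrable lborel (?h n)" for n
    using integrable_mult_right[OF ig[of n], of "1 / \<mu> n"] \<mu>[of n] by (simp add: field_simps)
  have limg: "(\<lambda>n. \<integral>u. ?g n u \<partial>lborel) \<longlonglongrightarrow> (\<integral>u. s * m * ?e \<alpha> u \<partial>lborel)"
  proof (rule integral_dominated_convergence[where w="?W", OF _ gm W _ gW])
    show "AE u in lborel. (\<lambda>n. ?g n u) \<longlonglongrightarrow> s * m * ?e \<alpha> u"
      using nz
    proof eventually_elim
      case (elim u)
      show ?case
      proof (cases "0 \<le> u")
        case True
        then have u: "0 < u" using elim by simp
        have "((\<lambda>y. floor_ext A (y * u) / floor_ext A y) \<longlongrightarrow> u powr \<alpha>) at_top"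
          using rv u by (simp add: regularly_varying_def)
        from filterlim_compose[OF this x]
        have "(\<lambda>n. floor_ext A (x n * u) / floor_ext A (x n)) \<longlonglongrightarrow> u powr \<alpha>" .
        from tendsto_mult[OF this lim]
        have "(\<lambda>n. floor_ext A (x n * u) / floor_ext A (x n) * (floor_ext A (x n) * \<mu> n)) \<longlonglongrightarrow> u powr \<alpha> * m" .
        moreover have "eventually (\<lambda>n. floor_ext A (x n * u) / floor_ext A (x n) * (floor_ext A (x n) * \<mu> n)
            = floor_ext A (x n * u) * \<mu> n) sequentially"
          using eventually_compose_filterlim[OF pos x] by eventually_elim simp
        ultimately have "(\<lambda>n. floor_ext A (x n * u) * \<mu> n) \<longlonglongrightarrow> u powr \<alpha> * m"
          by (rule Lim_transform_eventually)
        from tendsto_mult_left[OF this, of "s * exp (- s * u)"]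
        show ?thesis using u by (simp add: mult_ac)
      qed simp
    qed
  qed measurable
  have rhs: "(\<integral>u. s * m * ?e \<alpha> u \<partial>lborel) = m * (Gamma (1 + \<alpha>) * s powr (- \<alpha>))"
  proof -
    have "s * s powr (- \<alpha> - 1) = s powr (- \<alpha>)" using s by (simp add: powr_diff)
    then show ?thesis using integrable_exp_powr(2)[OF s, of \<alpha>] \<alpha> by simp
  qed
  have hn: "0 \<le> ?h n u" for n u using s A0 by simp
  have q: "0 < exp (- s / x n)" "exp (- s / x n) < 1" for n using s x0[of n] by auto
  have tn: "0 \<le> (exp (- s / x n) ^ k - exp (- s / x n) ^ Suc k) * A k" for n k
  proof -
    have "exp (- s / x n) ^ Suc k \<le> exp (- s / x n) ^ k" using q[of n] by (intro power_decreasing) auto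
    then show ?thesis using A by simp
  qed
  have nn: "(\<Sum>k. ennreal ((exp (- s / x n) ^ k - exp (- s / x n) ^ Suc k) * A k)) = ennreal (\<integral>u. ?h n u \<partial>lborel)" for n
  proof -
    have "(\<integral>\<^sup>+u. ennreal (?h n u) \<partial>lborel) = ennreal (\<integral>u. ?h n u \<partial>lborel)"
      by (rule nn_integral_eq_integral[OF ih]) (intro always_eventually allI hn)
    then show ?thesis using nn_integral_exp_floor[OF A(1) s x0[of n]] by simp
  qed
  have tsum: "summable (\<lambda>k. (exp (- s / x n) ^ k - exp (- s / x n) ^ Suc k) * A k)" for n
    by (rule summable_suminf_not_top[OF tn]) (simp only: nn ennreal_neq_top not_False_eq_True)
  have fac: "(exp (- s / x n) ^ k - exp (- s / x n) ^ Suc k) * A k = (1 - exp (- s / x n)) * (exp (- s / x n) ^ k * A k)" for n k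
    by (simp add: algebra_simps)
  show sm: "summable (\<lambda>k. exp (- s / x n) ^ k * A k)" for n
  proof -
    have "1 - exp (- s / x n) = 0 \<or> summable (\<lambda>k. exp (- s / x n) ^ k * A k)"
      by (rule iffD1[OF summable_cmult_iff]) (use tsum[of n] in \<open>simp only: fac\<close>)
    moreover have "1 - exp (- s / x n) \<noteq> 0" using q(2)[of n] by linarith
    ultimately show ?thesis by blast
  qed
  have val: "\<mu> n * ((1 / exp (- s / x n) - 1) * (\<Sum>k. exp (- s / x n) ^ k * A k))
    = exp (s / x n) * (\<integral>u. ?g n u \<partial>lborel)" for n
  proof -
    have "ennreal (\<integral>u. ?h n u \<partial>lborel) = ennreal (\<Sum>k. (exp (- s / x n) ^ k - exp (- s / x n) ^ Suc k) * A k)"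
      unfolding nn[symmetric] by (rule suminf_ennreal2[OF tn tsum])
    then have "(\<integral>u. ?h n u \<partial>lborel) = (\<Sum>k. (exp (- s / x n) ^ k - exp (- s / x n) ^ Suc k) * A k)"
      using hn tn tsum by (subst (asm) ennreal_inj) (auto intro!: suminf_nonneg Bochner_Integration.integral_nonneg)
    also have "\<dots> = (1 - exp (- s / x n)) * (\<Sum>k. exp (- s / x n) ^ k * A k)"
      unfolding fac by (rule suminf_mult[OF sm])
    finally have "(\<integral>u. ?g n u \<partial>lborel) = (1 - exp (- s / x n)) * (\<Sum>k. exp (- s / x n) ^ k * A k) * \<mu> n" by simp
    moreover have "1 / exp (- s / x n) - 1 = exp (s / x n) * (1 - exp (- s / x n))"
      by (simp add: exp_minus field_simps)
    ultimately show ?thesis by (simp only: mult_ac)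
  qed
  have "(\<lambda>n. exp (s / x n)) \<longlonglongrightarrow> exp 0"
    by (intro tendsto_exp tendsto_divide_0[OF tendsto_const] filterlim_at_top_imp_at_infinity x)
  from tendsto_mult[OF this limg]
  show "(\<lambda>n. \<mu> n * ((1 / exp (- s / x n) - 1) * (\<Sum>k. exp (- s / x n) ^ k * A k)))
      \<longlonglongrightarrow> m * (Gamma (1 + \<alpha>) * s powr (- \<alpha>))"
    unfolding val rhs by simp
qed

lemma abelian_limit:
  fixes A :: "nat \<Rightarrow> real" and x \<mu> :: "nat \<Rightarrow> real"
  assumes A: "\<And>k. 0 \<le> A k" "mono A" and rv: "regularly_varying A \<alpha>" and \<alpha>: "0 < \<alpha>" "\<alpha> \<le> 1"
    and pos: "eventually (\<lambda>x. 0 < floor_ext A x) at_top"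
    and s: "0 < s" and x: "filterlim x at_top sequentially" and \<mu>: "\<And>n. 0 < \<mu> n"
    and lim: "(\<lambda>n. floor_ext A (x n) * \<mu> n) \<longlonglongrightarrow> m" and m: "0 \<le> m"
  shows "eventually (\<lambda>n. summable (\<lambda>k. exp (- s / x n) ^ k * A k)) sequentially"
    and "(\<lambda>n. \<mu> n * ((1 / exp (- s / x n) - 1) * (\<Sum>k. exp (- s / x n) ^ k * A k)))
      \<longlonglongrightarrow> m * (Gamma (1 + \<alpha>) * s powr (- \<alpha>))"
proof -
  obtain X where X: "0 < X" "\<And>x u. X \<le> x \<Longrightarrow> 0 \<le> u \<Longrightarrow> floor_ext A (x * u) \<le> (1 + 4 * u\<^sup>2) * floor_ext A x"
    using regular_variation_quadratic_bound[OF A rv \<alpha>(2) pos] by blast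
  have "eventually (\<lambda>n. X \<le> x n) sequentially" using x by (simp add: filterlim_at_top)
  moreover have "eventually (\<lambda>n. floor_ext A (x n) * \<mu> n < m + 1) sequentially"
    using lim by (rule order_tendstoD) simp
  ultimately have "eventually (\<lambda>n. X \<le> x n \<and> floor_ext A (x n) * \<mu> n \<le> m + 1) sequentially"
    by eventually_elim simp
  then obtain K where K: "\<And>n. K \<le> n \<Longrightarrow> X \<le> x n" "\<And>n. K \<le> n \<Longrightarrow> floor_ext A (x n) * \<mu> n \<le> m + 1"
    unfolding eventually_sequentially by blast
  have x': "filterlim (\<lambda>n. x (n + K)) at_top sequentially"
    using filterlim_compose[OF x filterlim_add_const_nat_at_top[of K]] .
  note aux = abelian_limit_aux[OF A rv \<alpha>(1) pos s x' \<mu> LIMSEQ_ignore_initial_segment[OF lim] m X K(1)[OF le_add2] K(2)[OF le_add2]]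
  have "summable (\<lambda>k. exp (- s / x n) ^ k * A k)" if "K \<le> n" for n
    using aux(1)[of "n - K"] that by auto
  then show "eventually (\<lambda>n. summable (\<lambda>k. exp (- s / x n) ^ k * A k)) sequentially"
    unfolding eventually_sequentially by blast
  show "(\<lambda>n. \<mu> n * ((1 / exp (- s / x n) - 1) * (\<Sum>k. exp (- s / x n) ^ k * A k)))
      \<longlonglongrightarrow> m * (Gamma (1 + \<alpha>) * s powr (- \<alpha>))"
    by (rule LIMSEQ_offset[of _ K]) (use aux(2) in auto)
qed

context mpt_system
begin

section \<open>Hitting integrals\<close>

text \<open>
  Let \<open>n\<close> tend to infinity in the renewal identity. The kernel \<open>K - f\<close> that appears is the Abel sum of the
  iterates of \<open>f\<close> without the term of index 0, and on \<open>Y\<close> it is uniformly close to the number \<open>L\<close>. The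
  constant 5 is a sum: since \<open>\<eta> \<le> 1\<close>, Abel summation costs \<open>(S N + A N) / q \<le> 3 * A N / q\<close>, and the omitted
  term is \<open>f \<le> S N \<le> 2 * A N / q\<close>.
\<close>
lemma hitting_integral_estimate:
  fixes \<delta> :: "nat \<Rightarrow> real" and d :: nat
  defines "D \<equiv> \<lambda>A c s x. lap s (excess (Suc d) \<delta> (scaled_seq c (return_seq T A x)))"
    and "E \<equiv> \<lambda>A c s x. lap s (excess d (\<lambda>i. \<delta> (Suc i)) (scaled_seq c (return_seq T A x)))"
  assumes f: "integrable M f" "AE x in M. 0 \<le> f x"
    and A: "\<And>k. 0 \<le> A k" "mono A"
    and uni: "AE x in M. x \<in> Y \<longrightarrow> (\<forall>n\<ge>N. \<bar>(\<Sum>k<n. (transfer M T ^^ k) f x) - A n\<bar> \<le> \<eta> * A n)"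
    and N: "1 \<le> N" and \<eta>: "0 \<le> \<eta>" "\<eta> \<le> 1"
    and B: "B \<in> sets M" "B \<subseteq> Y" "emeasure M B < \<infinity>"
    and c: "0 < c" and s: "0 < s" and \<delta>: "\<delta> 0 = 0"
    and sumA: "summable (\<lambda>k. exp (- s * c) ^ k * A k)"
  defines "q \<equiv> exp (- s * c)"
  defines "L \<equiv> (1 / q - 1) * (\<Sum>k. q ^ k * A k)"
  shows "\<bar>(\<integral>x. f x * D B c s x \<partial>M) - L * (\<integral>x. indicator B x * (E B c s x - D B c s x) \<partial>M)\<bar>
    \<le> (\<eta> * L + 5 * A N / q) * measure M B"
proof -
  let ?t = "\<lambda>k. (transfer M T ^^ k) f"
  let ?D = "D B c s" and ?E = "E B c s"
  let ?g = "\<lambda>x. indicator B x * (?E x - ?D x)"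
  note [measurable] = B(1)
  have q: "0 < q" "q < 1" unfolding q_def using s c by auto
  have Dm[measurable]: "?D \<in> borel_measurable M" and Em[measurable]: "?E \<in> borel_measurable M"
    unfolding D_def E_def by (rule lap_return_measurable[OF B(1) s])+
  have D1: "0 \<le> ?D x" "?D x \<le> 1" and E1: "0 \<le> ?E x" "?E x \<le> 1" for x using s by (simp_all add: D_def E_def)
  have g1: "\<bar>?g x\<bar> \<le> indicator B x" for x using D1[of x] E1[of x] by (auto simp: indicator_def)
  then have g2: "\<bar>?g x\<bar> \<le> 1" for x by (rule order_trans) (simp add: indicator_def)
  have gm[measurable]: "?g \<in> borel_measurable M" by measurable
  have iB: "integrable M (indicator B :: 'a \<Rightarrow> real)" using B by (simp add: integrable_indicator_iff)
  have ti: "integrable M (?t k)" for k by (rule iterate_integrable[OF f(1)])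
  have tm[measurable]: "?t k \<in> borel_measurable M" for k using ti[of k] by (rule borel_measurable_integrable)
  have tg: "integrable M (\<lambda>x. ?t k x * ?g x)" for k
    by (rule integrable_mult_bounded[where C=1, OF ti gm]) (simp add: g2)
  define K where "K x = (\<Sum>k. q ^ k * ?t k x)" for x
  define R where "R = \<eta> * L + 5 * A N / q"
  have L0: "0 \<le> L" unfolding L_def using q A(1) sumA[folded q_def] by (intro mult_nonneg_nonneg suminf_nonneg) auto
  have R0: "0 \<le> R" unfolding R_def using L0 \<eta> A(1)[of N] q by (intro add_nonneg_nonneg) auto
  have tnn: "AE x in M. \<forall>k. 0 \<le> ?t k x"
    unfolding AE_all_countable using iterate_nonneg[OF f] by blast
  have key: "AE x in M. x \<in> B \<longrightarrow> (\<forall>k. 0 \<le> ?t k x) \<and> summable (\<lambda>k. q ^ k * ?t k x) \<and> \<bar>K x - f x - L\<bar> \<le> R"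
    using tnn uni
  proof eventually_elim
    case (elim x)
    show ?case
    proof
      assume x: "x \<in> B"
      then have cl: "\<bar>(\<Sum>k<n. ?t k x) - A n\<bar> \<le> \<eta> * A n" if "N \<le> n" for n
        using elim(2) B(2) that by blast
      have t0: "0 \<le> ?t k x" for k using elim(1) by blast
      have est: "summable (\<lambda>k. q ^ k * ?t k x)"
        "\<bar>K x - L\<bar> \<le> \<eta> * L + ((\<Sum>k<N. ?t k x) + A N) / q"
        unfolding K_def L_def
        by (rule abel_summation_estimate[where N=N, OF t0 A q sumA[folded q_def] _ \<eta>(1)], erule cl)+
      let ?S = "\<Sum>k<N. ?t k x"
      have "\<eta> * A N \<le> 1 * A N" using \<eta> A(1) by (intro mult_right_mono) auto
      then have S: "?S \<le> 2 * A N" using cl[OF order_refl] by linarith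
      have "?t 0 x \<le> ?S" using N t0 by (intro member_le_sum) auto
      then have f0: "f x \<le> 2 * A N" "0 \<le> f x" using S t0[of 0] by auto
      have "A N * q \<le> A N * 1" using q A(1) by (intro mult_left_mono) auto
      then have Aq: "A N \<le> A N / q" using q by (simp add: le_divide_eq)
      have "(?S + A N) / q \<le> (3 * A N) / q" using S q by (intro divide_right_mono) auto
      then have "\<bar>K x - L\<bar> \<le> \<eta> * L + 3 * A N / q"
        using est(2) by linarith
      then have "\<bar>K x - f x - L\<bar> \<le> \<eta> * L + 3 * A N / q + 2 * A N" using f0 by linarith
      also have "\<dots> \<le> R" 
      proof -
        have "3 * A N / q = 3 * (A N / q)" "5 * A N / q = 5 * (A N / q)" by simp_all
        with Aq show ?thesis unfolding R_def by linarith
      qed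
      finally show "(\<forall>k. 0 \<le> ?t k x) \<and> summable (\<lambda>k. q ^ k * ?t k x) \<and> \<bar>K x - f x - L\<bar> \<le> R"
        using est(1) t0 by blast
    qed
  qed
  have Km[measurable]: "K \<in> borel_measurable M" unfolding K_def by measurable
  have fm[measurable]: "f \<in> borel_measurable M" using f(1) by simp
  \<comment> \<open>The remainder of the renewal identity is at most the n-th power of q times
    the integral of f.\<close>
  have lim1: "(\<lambda>n. \<Sum>k=1..n. q ^ k * (\<integral>x. ?t k x * ?g x \<partial>M)) \<longlonglongrightarrow> (\<integral>x. f x * ?D x \<partial>M)"
  proof -
    have "\<bar>\<integral>x. ?t n x * ?D x \<partial>M\<bar> \<le> (\<integral>x. f x \<partial>M)" for n
    proof -
      have nn: "AE x in M. 0 \<le> ?t n x" by (rule iterate_nonneg[OF f])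
      have "0 \<le> (\<integral>x. ?t n x * ?D x \<partial>M)"
        by (rule integral_nonneg_AE) (use nn D1 in \<open>auto elim!: eventually_mono\<close>)
      moreover have "(\<integral>x. ?t n x * ?D x \<partial>M) \<le> (\<integral>x. ?t n x * 1 \<partial>M)"
      proof (rule integral_mono_AE)
        show "integrable M (\<lambda>x. ?t n x * ?D x)"
          by (rule integrable_mult_bounded[where C=1, OF ti Dm]) (simp add: D1)
        show "AE x in M. ?t n x * ?D x \<le> ?t n x * 1"
          using nn by eventually_elim (intro mult_left_mono D1)
      qed (use ti in simp)
      ultimately show ?thesis using iterate_integral[OF f(1), of "\<lambda>_. 1" 1 n] by simp
    qed
    then have bd: "norm (q ^ n * (\<integral>x. ?t n x * ?D x \<partial>M)) \<le> q ^ n * (\<integral>x. f x \<partial>M)" for n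
      using q by (simp add: abs_mult mult_left_mono)
    have "(\<lambda>n. q ^ n * (\<integral>x. f x \<partial>M)) \<longlonglongrightarrow> 0"
      using q by (intro tendsto_mult_left_zero LIMSEQ_power_zero) auto
    from Lim_null_comparison[OF always_eventually[OF allI[OF bd]] this]
    have "(\<lambda>n. q ^ n * (\<integral>x. ?t n x * ?D x \<partial>M)) \<longlonglongrightarrow> 0" .
    from tendsto_diff[OF tendsto_const this, of "\<integral>x. f x * ?D x \<partial>M"]
    have "(\<lambda>n. (\<integral>x. f x * ?D x \<partial>M) - q ^ n * (\<integral>x. ?t n x * ?D x \<partial>M)) \<longlonglongrightarrow> (\<integral>x. f x * ?D x \<partial>M)" by simp
    moreover have "(\<integral>x. f x * ?D x \<partial>M) - q ^ n * (\<integral>x. ?t n x * ?D x \<partial>M)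
       = (\<Sum>k=1..n. q ^ k * (\<integral>x. ?t k x * ?g x \<partial>M))" for n
      using renewal_identity[where \<delta>=\<delta> and d=d, OF B(1) less_imp_le[OF c] s \<delta> f(1), of n]
      unfolding D_def E_def q_def by simp
    ultimately show ?thesis by simp
  qed
  have lim2: "(\<lambda>n. \<Sum>k=1..n. q ^ k * (\<integral>x. ?t k x * ?g x \<partial>M)) \<longlonglongrightarrow> (\<integral>x. (K x - f x) * ?g x \<partial>M)"
  proof -
    have sum_eq: "(\<Sum>k=1..n. q ^ k * (\<integral>x. ?t k x * ?g x \<partial>M)) = (\<integral>x. (\<Sum>k=1..n. q ^ k * ?t k x) * ?g x \<partial>M)" for n
    proof -
      have "(\<integral>x. (\<Sum>k=1..n. q ^ k * ?t k x) * ?g x \<partial>M) = (\<integral>x. (\<Sum>k=1..n. q ^ k * (?t k x * ?g x)) \<partial>M)"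
        by (simp only: sum_distrib_right mult.assoc)
      also have "\<dots> = (\<Sum>k=1..n. \<integral>x. q ^ k * (?t k x * ?g x) \<partial>M)"
        by (rule Bochner_Integration.integral_sum) (intro integrable_mult_right tg)
      finally show ?thesis by simp
    qed
    show ?thesis unfolding sum_eq
    proof (rule integral_dominated_convergence[where w="\<lambda>x. (L + R) * indicator B x"])
      show "integrable M (\<lambda>x. (L + R) * indicator B x)" by (intro integrable_mult_right iB)
      show "AE x in M. (\<lambda>n. (\<Sum>k=1..n. q ^ k * ?t k x) * ?g x) \<longlonglongrightarrow> (K x - f x) * ?g x"
        using key
      proof eventually_elim
        case (elim x)
        show ?case
        proof (cases "x \<in> B")
          case True
          have "(\<lambda>n. \<Sum>k<n. q ^ k * ?t k x) \<longlonglongrightarrow> K x"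
            unfolding K_def by (rule summable_LIMSEQ) (use elim True in blast)
          from LIMSEQ_ignore_initial_segment[OF this, of 1]
          have "(\<lambda>n. (\<Sum>k<n + 1. q ^ k * ?t k x) - f x) \<longlonglongrightarrow> K x - f x" by (intro tendsto_diff tendsto_const)
          moreover have "(\<Sum>k<n + 1. q ^ k * ?t k x) - f x = (\<Sum>k=1..n. q ^ k * ?t k x)" for n
          proof -
            have "{..<n + 1} = insert 0 {1..n}" by auto
            then show ?thesis by simp
          qed
          ultimately show ?thesis by (intro tendsto_mult tendsto_const) simp
        qed simp
      qed
      show "AE x in M. norm ((\<Sum>k=1..n. q ^ k * ?t k x) * ?g x) \<le> (L + R) * indicator B x" for n
        using key
      proof eventually_elim
        case (elim x)
        show ?case
        proof (cases "x \<in> B")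
          case True
          with elim have t0: "\<And>k. 0 \<le> ?t k x" and sm: "summable (\<lambda>k. q ^ k * ?t k x)" and b: "\<bar>K x - f x - L\<bar> \<le> R" by auto
          have "0 \<le> (\<Sum>k=1..n. q ^ k * ?t k x)" using t0 q by (intro sum_nonneg) auto
          moreover have "(\<Sum>k=1..n. q ^ k * ?t k x) + f x \<le> K x"
          proof -
            have "(\<Sum>k\<in>insert 0 {1..n}. q ^ k * ?t k x) \<le> K x"
              unfolding K_def using t0 q by (intro sum_le_suminf[OF sm]) auto
            then show ?thesis by simp
          qed
          ultimately have "\<bar>\<Sum>k=1..n. q ^ k * ?t k x\<bar> \<le> L + R" using b by linarith
          then have "\<bar>\<Sum>k=1..n. q ^ k * ?t k x\<bar> * \<bar>?g x\<bar> \<le> (L + R) * 1"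
            by (intro mult_mono g2) (use L0 R0 in auto)
          then show ?thesis using True by (simp add: abs_mult)
        qed simp
      qed
    qed measurable
  qed
  have eq: "(\<integral>x. f x * ?D x \<partial>M) = (\<integral>x. (K x - f x) * ?g x \<partial>M)" by (rule LIMSEQ_unique[OF lim1 lim2])
  have ib: "AE x in M. norm ((K x - f x - L) * ?g x) \<le> R * indicator B x"
    using key
  proof eventually_elim
    case (elim x)
    show ?case
    proof (cases "x \<in> B")
      case True
      then have "\<bar>K x - f x - L\<bar> * \<bar>?g x\<bar> \<le> R * 1" by (intro mult_mono g2) (use elim True R0 in auto)
      then show ?thesis using True by (simp add: abs_mult)
    qed simp
  qed
  have iR: "integrable M (\<lambda>x. R * indicator B x)" by (intro integrable_mult_right iB)
  have i1: "integrable M (\<lambda>x. (K x - f x - L) * ?g x)"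
    by (rule Bochner_Integration.integrable_bound[OF iR]) (use ib in \<open>auto elim!: eventually_mono\<close>)
  have ig: "integrable M ?g"
    by (rule Bochner_Integration.integrable_bound[OF iB]) (use g1 in auto)
  have "(\<integral>x. (K x - f x) * ?g x \<partial>M) = (\<integral>x. (K x - f x - L) * ?g x + L * ?g x \<partial>M)"
    by (rule Bochner_Integration.integral_cong[OF refl]) (simp only: distrib_right[symmetric] diff_add_cancel)
  also have "\<dots> = (\<integral>x. (K x - f x - L) * ?g x \<partial>M) + L * (\<integral>x. ?g x \<partial>M)"
    by (subst Bochner_Integration.integral_add[OF i1 integrable_mult_right[OF ig]]) simp
  finally have "(\<integral>x. f x * ?D x \<partial>M) - L * (\<integral>x. ?g x \<partial>M) = (\<integral>x. (K x - f x - L) * ?g x \<partial>M)"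
    using eq by simp
  moreover have "\<bar>\<integral>x. (K x - f x - L) * ?g x \<partial>M\<bar> \<le> (\<integral>x. R * indicator B x \<partial>M)"
  proof -
    have "\<bar>\<integral>x. (K x - f x - L) * ?g x \<partial>M\<bar> \<le> (\<integral>x. \<bar>(K x - f x - L) * ?g x\<bar> \<partial>M)" by (rule integral_abs_bound)
    also have "\<dots> \<le> (\<integral>x. R * indicator B x \<partial>M)"
      by (rule integral_mono_AE[OF integrable_abs[OF i1] iR]) (use ib in \<open>auto elim!: eventually_mono\<close>)
    finally show ?thesis .
  qed
  moreover have "(\<integral>x. R * indicator B x \<partial>M) = R * measure M B" using B(1) by (simp add: Int_absorb1 sets.sets_into_space)
  ultimately show ?thesis unfolding R_def by simp
qed

end

section \<open>Uniform sets\<close>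

lemma filterlim_floor_nat: "filterlim (\<lambda>x::real. nat \<lfloor>x\<rfloor>) at_top at_top"
  by (rule filterlim_compose[OF filterlim_nat_sequentially filterlim_floor_sequentially])

text \<open>
  If \<open>b s\<close> stayed below \<open>Z\<close>, then \<open>a\<close> at \<open>b s\<close> would take one of finitely many values, whereas it is
  asymptotic to \<open>s\<close>.
\<close>
lemma asymptotic_inverse_at_top:
  assumes "asymptotic_inverse a b"
  shows "((\<lambda>s. floor_ext a (b s) / s) \<longlongrightarrow> 1) at_top" and "filterlim b at_top at_top"
proof -
  have "(\<lambda>s. floor_ext a (b s)) \<sim>[at_top] (\<lambda>s. s)" using assms by (simp add: asymptotic_inverse_def)
  then show l: "((\<lambda>s. floor_ext a (b s) / s) \<longlongrightarrow> 1) at_top"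
    by (rule asymp_equivD_strong) (rule eventually_mono[OF eventually_gt_at_top[of "0::real"]], simp)
  show "filterlim b at_top at_top"
    unfolding filterlim_at_top
  proof
    fix Z :: real
    define K where "K = Max (a ` {..nat \<lceil>Z\<rceil>})"
    have "eventually (\<lambda>s. 1 / 2 < floor_ext a (b s) / s) at_top" using order_tendstoD(1)[OF l, of "1/2"] by simp
    moreover have "eventually (\<lambda>s. max 0 (2 * K) < s) at_top" by (rule eventually_gt_at_top)
    ultimately show "eventually (\<lambda>s. Z \<le> b s) at_top"
    proof eventually_elim
      case (elim s)
      then have s: "0 < s" "2 * K < s" by auto
      then have "s / 2 < floor_ext a (b s)" using elim(1) by (simp add: less_divide_eq)
      then have K: "K < floor_ext a (b s)" using s by simp
      show ?case
      proof (rule ccontr)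
        assume "\<not> Z \<le> b s"
        then have "\<lfloor>b s\<rfloor> \<le> \<lceil>Z\<rceil>" by linarith
        then have "nat \<lfloor>b s\<rfloor> \<in> {..nat \<lceil>Z\<rceil>}" by simp
        then have "floor_ext a (b s) \<le> K" unfolding K_def floor_ext_def by (intro Max_ge) auto
        with K show False by simp
      qed
    qed
  qed
qed

context mpt_system
begin

text \<open>
  The partial sums at one typical point of \<open>Y\<close> form a nondecreasing sequence \<open>A\<close> that is asymptotic to
  a multiple of \<open>a\<close>. It inherits regular variation from \<open>a\<close> and approximates the partial sums with
  uniformly small relative error on \<open>Y\<close>.
\<close>
lemma uniform_set_comparison:
  assumes u: "uniform_set M T a Y" and rv: "regularly_varying a \<alpha>"
  obtains f A where "integrable M f" "AE x in M. 0 \<le> f x" "0 < (\<integral>x. f x \<partial>M)"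
    "\<And>k::nat. (0::real) \<le> A k" "mono A" "regularly_varying A \<alpha>" "eventually (\<lambda>x. 0 < floor_ext A x) at_top"
    "((\<lambda>x. floor_ext A x / floor_ext a x) \<longlongrightarrow> (\<integral>x. f x \<partial>M)) at_top"
    "eventually (\<lambda>x. 0 < floor_ext a x) at_top"
    "\<forall>\<eta>>0. \<exists>N. AE x in M. x \<in> Y \<longrightarrow> (\<forall>n\<ge>N. \<bar>(\<Sum>k<n. (transfer M T ^^ k) f x) - A n\<bar> \<le> \<eta> * A n)"
proof -
  obtain f where f: "integrable M f" "AE x in M. 0 \<le> f x" and m0: "0 < (\<integral>x. f x \<partial>M)"
    and lim: "(\<lambda>n. esssup (restrict_space M Y)
               (\<lambda>x. ereal \<bar>(1 / a n) * (\<Sum>k<n. (transfer M T ^^ k) f x) - (\<integral>y. f y \<partial>M)\<bar>)) \<longlonglongrightarrow> 0"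
    using u unfolding uniform_set_def by blast
  have Y: "Y \<in> sets M" "0 < emeasure M Y" using u by (auto simp: uniform_set_def)
  let ?m = "\<integral>x. f x \<partial>M" and ?t = "\<lambda>k. (transfer M T ^^ k) f"
  let ?S = "\<lambda>n x. \<Sum>k<n. ?t k x"
  have unif: "\<exists>N. AE x in M. x \<in> Y \<longrightarrow> (\<forall>n\<ge>N. \<bar>(1 / a n) * ?S n x - ?m\<bar> < e)" if e: "0 < e" for e
  proof -
    have "0 < ereal e" using e by simp
    from order_tendstoD(2)[OF lim this] obtain N where
      N: "\<And>n. N \<le> n \<Longrightarrow> esssup (restrict_space M Y) (\<lambda>x. ereal \<bar>(1 / a n) * ?S n x - ?m\<bar>) < ereal e"
      unfolding eventually_sequentially by blast
    have "AE x in M. N \<le> n \<longrightarrow> x \<in> Y \<longrightarrow> \<bar>(1 / a n) * ?S n x - ?m\<bar> < e" for n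
    proof (cases "N \<le> n")
      case True
      have "AE x in restrict_space M Y. ereal \<bar>(1 / a n) * ?S n x - ?m\<bar> < ereal e"
        using esssup_AE[of "\<lambda>x. ereal \<bar>(1 / a n) * ?S n x - ?m\<bar>" "restrict_space M Y"]
        by (rule eventually_mono) (rule le_less_trans[OF _ N[OF True]])
      moreover have "Y \<inter> space M \<in> sets M" using Y(1) by auto
      ultimately show ?thesis by (simp add: AE_restrict_space_iff)
    qed simp
    then have "AE x in M. \<forall>n. N \<le> n \<longrightarrow> x \<in> Y \<longrightarrow> \<bar>(1 / a n) * ?S n x - ?m\<bar> < e"
      unfolding AE_all_countable by blast
    then have "AE x in M. x \<in> Y \<longrightarrow> (\<forall>n\<ge>N. \<bar>(1 / a n) * ?S n x - ?m\<bar> < e)"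
      by eventually_elim blast
    then show ?thesis by blast
  qed
  have exj: "\<forall>j. \<exists>N. AE x in M. x \<in> Y \<longrightarrow> (\<forall>n\<ge>N. \<bar>(1 / a n) * ?S n x - ?m\<bar> < inverse (real (Suc j)))"
    by (intro allI unif) simp
  obtain N where N: "\<forall>j. AE x in M. x \<in> Y \<longrightarrow> (\<forall>n\<ge>N j. \<bar>(1 / a n) * ?S n x - ?m\<bar> < inverse (real (Suc j)))"
    using choice[OF exj] by (rule exE)
  have "AE x in M. \<forall>j. x \<in> Y \<longrightarrow> (\<forall>n\<ge>N j. \<bar>(1 / a n) * ?S n x - ?m\<bar> < inverse (real (Suc j)))"
    unfolding AE_all_countable by (rule N)
  moreover have "AE x in M. \<forall>k. 0 \<le> ?t k x" unfolding AE_all_countable using iterate_nonneg[OF f] by blast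
  ultimately have good: "AE x in M. (\<forall>k. 0 \<le> ?t k x) \<and>
      (x \<in> Y \<longrightarrow> (\<forall>j. \<forall>n\<ge>N j. \<bar>(1 / a n) * ?S n x - ?m\<bar> < inverse (real (Suc j))))"
    by eventually_elim blast
  have ex: "\<exists>y\<in>Y. (\<forall>k. 0 \<le> ?t k y) \<and> (\<forall>j. \<forall>n\<ge>N j. \<bar>(1 / a n) * ?S n y - ?m\<bar> < inverse (real (Suc j)))"
  proof (rule ccontr)
    assume no: "\<not> ?thesis"
    have "AE x in M. x \<notin> Y"
      using good
    proof eventually_elim
      case (elim x)
      show ?case
      proof
        assume x: "x \<in> Y"
        have "\<exists>y\<in>Y. (\<forall>k. 0 \<le> ?t k y) \<and> (\<forall>j. \<forall>n\<ge>N j. \<bar>(1 / a n) * ?S n y - ?m\<bar> < inverse (real (Suc j)))"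
          by (intro bexI[OF _ x] conjI conjunct1[OF elim] mp[OF conjunct2[OF elim] x])
        with no show False by contradiction
      qed
    qed
    then have "emeasure M Y = 0"
      using sets.sets_into_space[OF Y(1)] Y(1) by (subst (asm) AE_iff_measurable[where N=Y]) auto
    with Y(2) show False by simp
  qed
  from ex obtain y where ty: "\<And>k. 0 \<le> ?t k y"
    and yN: "\<And>j n. N j \<le> n \<Longrightarrow> \<bar>(1 / a n) * ?S n y - ?m\<bar> < inverse (real (Suc j))" by blast
  define A where "A n = ?S n y" for n
  have A0: "0 \<le> A n" for n unfolding A_def using ty by (intro sum_nonneg) auto
  have Am: "mono A" unfolding A_def using ty by (intro monoI sum_mono2) auto
  have Al: "(\<lambda>n. (1 / a n) * A n) \<longlonglongrightarrow> ?m"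
  proof (rule LIMSEQ_I)
    fix e :: real assume "0 < e"
    then obtain j where "inverse (real (Suc j)) < e" using reals_Archimedean by blast
    then show "\<exists>n0. \<forall>n\<ge>n0. norm ((1 / a n) * A n - ?m) < e"
      using yN[of j] unfolding A_def by (intro exI[of _ "N j"]) (auto intro: less_trans)
  qed
  have "eventually (\<lambda>n. ?m / 2 < (1 / a n) * A n) sequentially"
    using order_tendstoD(1)[OF Al, of "?m / 2"] m0 by simp
  then have ev: "eventually (\<lambda>n. ?m / 2 < (1 / a n) * A n \<and> 0 < A n \<and> 0 < a n) sequentially"
  proof eventually_elim
    case (elim n)
    then have p: "0 < (1 / a n) * A n" using m0 by linarith
    then have "A n \<noteq> 0" by auto
    then have An: "0 < A n" using A0[of n] by simp
    then have "0 < 1 / a n" using p by (simp only: zero_less_mult_iff) auto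
    with An elim show ?case by simp
  qed
  have evf: "eventually (\<lambda>x. 0 < floor_ext A x \<and> 0 < floor_ext a x) at_top"
    using eventually_compose_filterlim[OF ev filterlim_floor_nat] unfolding floor_ext_def
    by eventually_elim simp
  have Alf: "((\<lambda>x. floor_ext A x / floor_ext a x) \<longlongrightarrow> ?m) at_top"
    using filterlim_compose[OF Al filterlim_floor_nat] by (simp add: floor_ext_def)
  have rvA: "regularly_varying A \<alpha>"
    unfolding regularly_varying_def
  proof (intro allI impI)
    fix y :: real assume y: "0 < y"
    have fy: "filterlim (\<lambda>x. x * y) at_top at_top"
      using filterlim_tendsto_pos_mult_at_top[OF tendsto_const y filterlim_ident] by (simp add: mult.commute)
    have "((\<lambda>x. (floor_ext A (x * y) / floor_ext a (x * y)) * (floor_ext a (x * y) / floor_ext a x) / (floor_ext A x / floor_ext a x))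
        \<longlongrightarrow> ?m * y powr \<alpha> / ?m) at_top"
      using rv y m0 unfolding regularly_varying_def
      by (intro tendsto_intros filterlim_compose[OF Alf fy] Alf) auto
    moreover have "eventually (\<lambda>x. (floor_ext A (x * y) / floor_ext a (x * y)) * (floor_ext a (x * y) / floor_ext a x) / (floor_ext A x / floor_ext a x)
        = floor_ext A (x * y) / floor_ext A x) at_top"
      using evf eventually_compose_filterlim[OF evf fy] by eventually_elim simp
    ultimately have "((\<lambda>x. floor_ext A (x * y) / floor_ext A x) \<longlongrightarrow> ?m * y powr \<alpha> / ?m) at_top"
      by (rule Lim_transform_eventually)
    then show "((\<lambda>x. floor_ext A (x * y) / floor_ext A x) \<longlongrightarrow> y powr \<alpha>) at_top" using m0 by simp
  qed
  have un: "\<exists>N. AE x in M. x \<in> Y \<longrightarrow> (\<forall>n\<ge>N. \<bar>?S n x - A n\<bar> \<le> \<eta> * A n)" if \<eta>: "0 < \<eta>" for \<eta>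
  proof -
    \<comment> \<open>As A n / a n exceeds half the integral of f, an error of 2 * e relative to
      a n is at most \<eta> relative to A n.\<close>
    define e where "e = \<eta> * ?m / 4"
    have e: "0 < e" using \<eta> m0 by (simp add: e_def)
    obtain N1 where N1: "AE x in M. x \<in> Y \<longrightarrow> (\<forall>n\<ge>N1. \<bar>(1 / a n) * ?S n x - ?m\<bar> < e)" using unif[OF e] by blast
    obtain N2 where N2: "\<And>n. N2 \<le> n \<Longrightarrow> \<bar>(1 / a n) * A n - ?m\<bar> < e" using LIMSEQ_D[OF Al e] by auto
    obtain N3 where N3: "\<And>n. N3 \<le> n \<Longrightarrow> ?m / 2 < (1 / a n) * A n \<and> 0 < A n \<and> 0 < a n"
      using ev unfolding eventually_sequentially by blast
    have "AE x in M. x \<in> Y \<longrightarrow> (\<forall>n\<ge>max N1 (max N2 N3). \<bar>?S n x - A n\<bar> \<le> \<eta> * A n)"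
      using N1
    proof eventually_elim
      case (elim x)
      show ?case
      proof (intro impI allI)
        fix n assume x: "x \<in> Y" and n: "max N1 (max N2 N3) \<le> n"
        have 1: "\<bar>(1 / a n) * ?S n x - ?m\<bar> < e" using elim x n by auto
        have 2: "\<bar>(1 / a n) * A n - ?m\<bar> < e" using N2 n by auto
        have 3: "?m / 2 < (1 / a n) * A n" "0 < a n" using N3[of n] n by auto
        have "\<bar>(1 / a n) * ?S n x - (1 / a n) * A n\<bar> \<le> 2 * e" using 1 2 by linarith
        then have "\<bar>(1 / a n) * (?S n x - A n)\<bar> \<le> 2 * e" by (simp only: right_diff_distrib)
        then have "\<bar>?S n x - A n\<bar> \<le> 2 * e * a n" using 3(2) by (simp add: abs_mult divide_le_eq)
        also have "\<dots> = \<eta> * (?m / 2 * a n)" by (simp add: e_def)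
        also have "\<dots> \<le> \<eta> * A n" using 3 \<eta> by (intro mult_left_mono) (auto simp: less_divide_eq)
        finally show "\<bar>?S n x - A n\<bar> \<le> \<eta> * A n" .
      qed
    qed
    then show ?thesis by blast
  qed
  show thesis
  proof (rule that[of f A])
    show "eventually (\<lambda>x. 0 < floor_ext A x) at_top" "eventually (\<lambda>x. 0 < floor_ext a x) at_top"
      using evf by (auto elim: eventually_mono)
  qed (use f m0 A0 Am rvA Alf un in auto)
qed

lemma integral_uniform_measure_eq:
  fixes h :: "'a \<Rightarrow> real"
  assumes [measurable]: "B \<in> sets M" "h \<in> borel_measurable M" and B: "0 < emeasure M B" "emeasure M B < \<infinity>"
  shows "(\<integral>x. h x \<partial>uniform_measure M B) = (\<integral>x. indicator B x * h x \<partial>M) / measure M B"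
proof -
  have e: "emeasure M B = ennreal (measure M B)" using B by (intro emeasure_eq_ennreal_measure) auto
  have pos: "0 < measure M B" using B e by (metis ennreal_less_zero_iff ennreal_0 zero_less_measure_iff)
  have "(indicator B x / emeasure M B :: ennreal) = ennreal (indicator B x / measure M B)" for x
    using pos unfolding e by (auto simp: indicator_def divide_ennreal simp flip: ennreal_1)
  then have "uniform_measure M B = density M (\<lambda>x. ennreal (indicator B x / measure M B))"
    by (simp add: uniform_measure_def)
  then have "(\<integral>x. h x \<partial>uniform_measure M B) = (\<integral>x. (indicator B x / measure M B) * h x \<partial>M)"
    using pos by (simp add: integral_density)
  also have "\<dots> = (\<integral>x. (indicator B x * h x) / measure M B \<partial>M)" by simp
  also have "\<dots> = (\<integral>x. indicator B x * h x \<partial>M) / measure M B" by (rule integral_divide_zero)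
  finally show ?thesis .
qed

text \<open>
  With \<open>x n = b (1 / \<mu> (B n))\<close>, the inverse of the scaling, \<open>a (x n)\<close> is asymptotic to \<open>1 / \<mu> (B n)\<close>.
  So \<open>\<mu> (B n)\<close> times the Abel sum at \<open>exp (- s / x n)\<close> tends to \<open>\<Gamma>(1 + \<alpha>) * s powr (- \<alpha>)\<close> times the
  integral of \<open>f\<close>, while the error terms of the estimate are at most \<open>\<eta>\<close> times this limit up to \<open>o(1)\<close>.
\<close>
lemma hitting_return_asymptotics:
  fixes B :: "nat \<Rightarrow> 'a set" and b :: "real \<Rightarrow> real" and \<delta> :: "nat \<Rightarrow> real"
  defines "\<Theta> \<equiv> \<lambda>n x. scaled_seq (scaling b (measure M (B n))) (return_seq T (B n) x)"
  assumes f: "integrable M f" "AE x in M. 0 \<le> f x" and m: "0 < (\<integral>x. f x \<partial>M)"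
    and A: "\<And>k. 0 \<le> A k" "mono A" "regularly_varying A \<alpha>" "eventually (\<lambda>x. 0 < floor_ext A x) at_top"
    and Aa: "((\<lambda>x. floor_ext A x / floor_ext a x) \<longlongrightarrow> (\<integral>x. f x \<partial>M)) at_top"
    and apos: "eventually (\<lambda>x. 0 < floor_ext a x) at_top"
    and uni: "\<forall>\<eta>>0. \<exists>N. AE x in M. x \<in> Y \<longrightarrow> (\<forall>n\<ge>N. \<bar>(\<Sum>k<n. (transfer M T ^^ k) f x) - A n\<bar> \<le> \<eta> * A n)"
    and \<alpha>: "0 < \<alpha>" "\<alpha> \<le> 1" and ai: "asymptotic_inverse a b"
    and B: "\<And>n. B n \<in> sets M" "\<And>n. 0 < emeasure M (B n)" "\<And>n. emeasure M (B n) < \<infinity>" "\<And>n. B n \<subseteq> Y"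
    and B0: "(\<lambda>n. measure M (B n)) \<longlonglongrightarrow> 0"
    and sp: "spread d \<delta>" and s: "0 < s"
  shows "(\<lambda>n. (1 / (\<integral>x. f x \<partial>M)) * (\<integral>x. f x * lap s (excess (Suc d) \<delta> (\<Theta> n x)) \<partial>M)
     - Gamma (1 + \<alpha>) * s powr (- \<alpha>) *
       ((\<integral>x. lap s (excess d (\<lambda>i. \<delta> (Suc i)) (\<Theta> n x)) \<partial>uniform_measure M (B n))
        - (\<integral>x. lap s (excess (Suc d) \<delta> (\<Theta> n x)) \<partial>uniform_measure M (B n)))) \<longlonglongrightarrow> 0"
    and "eventually (\<lambda>n. 0 < scaling b (measure M (B n))) sequentially"
    and "(\<lambda>n. scaling b (measure M (B n))) \<longlonglongrightarrow> 0"
proof -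
  let ?m = "\<integral>x. f x \<partial>M" and ?\<kappa> = "Gamma (1 + \<alpha>) * s powr (- \<alpha>)"
  let ?\<mu> = "\<lambda>n. measure M (B n)"
  define x where "x n = b (1 / ?\<mu> n)" for n
  let ?c = "\<lambda>n. scaling b (?\<mu> n)"
  have cx: "?c n = 1 / x n" for n by (simp add: scaling_def x_def)
  have \<delta>: "\<delta> 0 = 0" using sp by (simp add: spread_def)
  have \<mu>: "0 < ?\<mu> n" for n
    using B(2)[of n] B(3)[of n] by (simp add: measure_def enn2real_positive_iff)
  have i\<mu>: "filterlim (\<lambda>n. 1 / ?\<mu> n) at_top sequentially"
  proof -
    have "filterlim ?\<mu> (at_right 0) sequentially"
      unfolding filterlim_at using B0 \<mu> by (auto intro!: always_eventually simp: less_imp_neq[symmetric])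
    from filterlim_compose[OF filterlim_inverse_at_top_right this] show ?thesis by (simp add: inverse_eq_divide)
  qed
  have xt: "filterlim x at_top sequentially"
    unfolding x_def by (rule filterlim_compose[OF asymptotic_inverse_at_top(2)[OF ai] i\<mu>])
  have xpos: "eventually (\<lambda>n. 0 < x n) sequentially" using xt by (simp add: filterlim_at_top_dense)
  then show cpos: "eventually (\<lambda>n. 0 < ?c n) sequentially" by eventually_elim (simp add: cx)
  show c0: "?c \<longlonglongrightarrow> 0"
    unfolding cx by (intro tendsto_divide_0[OF tendsto_const] filterlim_at_top_imp_at_infinity xt)
  have ax: "(\<lambda>n. floor_ext a (x n) * ?\<mu> n) \<longlonglongrightarrow> 1"
    using filterlim_compose[OF asymptotic_inverse_at_top(1)[OF ai] i\<mu>] by (simp add: x_def)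
  have "(\<lambda>n. (floor_ext A (x n) / floor_ext a (x n)) * (floor_ext a (x n) * ?\<mu> n)) \<longlonglongrightarrow> ?m * 1"
    by (intro tendsto_mult ax filterlim_compose[OF Aa xt])
  moreover have "eventually (\<lambda>n. (floor_ext A (x n) / floor_ext a (x n)) * (floor_ext a (x n) * ?\<mu> n) = floor_ext A (x n) * ?\<mu> n) sequentially"
    using eventually_compose_filterlim[OF apos xt] by eventually_elim simp
  ultimately have "(\<lambda>n. floor_ext A (x n) * ?\<mu> n) \<longlonglongrightarrow> ?m * 1" by (rule Lim_transform_eventually)
  then have Ax: "(\<lambda>n. floor_ext A (x n) * ?\<mu> n) \<longlonglongrightarrow> ?m" by simp
  let ?q = "\<lambda>n. exp (- s * ?c n)"
  let ?L = "\<lambda>n. (1 / ?q n - 1) * (\<Sum>k. ?q n ^ k * A k)"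
  have qx: "exp (- s / x n) = ?q n" for n by (simp add: cx)
  note ab = abelian_limit[OF A(1,2,3) \<alpha> A(4) s xt \<mu> Ax less_imp_le[OF m], unfolded qx]
  have Llim: "(\<lambda>n. ?\<mu> n * ?L n) \<longlonglongrightarrow> ?m * ?\<kappa>" by (rule ab(2))
  let ?D = "\<lambda>n x. lap s (excess (Suc d) \<delta> (\<Theta> n x))"
  let ?E = "\<lambda>n x. lap s (excess d (\<lambda>i. \<delta> (Suc i)) (\<Theta> n x))"
  define G where "G n = (\<integral>x. ?E n x \<partial>uniform_measure M (B n)) - (\<integral>x. ?D n x \<partial>uniform_measure M (B n))" for n
  have Dm: "?D n \<in> borel_measurable M" and Em: "?E n \<in> borel_measurable M" for n
    unfolding \<Theta>_def by (rule lap_return_measurable[OF B(1) s])+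
  have bnd: "0 \<le> ?D n x" "?D n x \<le> 1" "0 \<le> ?E n x" "?E n x \<le> 1" for n x using s by simp_all
  have iB: "integrable M (indicator (B n) :: 'a \<Rightarrow> real)" for n using B by (simp add: integrable_indicator_iff)
  have Gint: "(\<integral>x. indicator (B n) x * (?E n x - ?D n x) \<partial>M) = ?\<mu> n * G n" for n
  proof -
    have i: "integrable M (\<lambda>x. indicator (B n) x * ?D n x)" "integrable M (\<lambda>x. indicator (B n) x * ?E n x)"
      by (rule integrable_mult_bounded[where C=1, OF iB Dm], simp add: bnd)
         (rule integrable_mult_bounded[where C=1, OF iB Em], simp add: bnd)
    have "(\<integral>x. indicator (B n) x * (?E n x - ?D n x) \<partial>M)
      = (\<integral>x. indicator (B n) x * ?E n x \<partial>M) - (\<integral>x. indicator (B n) x * ?D n x \<partial>M)"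
      unfolding right_diff_distrib by (rule Bochner_Integration.integral_diff[OF i(2,1)])
    also have "\<dots> = ?\<mu> n * G n"
      unfolding G_def using integral_uniform_measure_eq[OF B(1) Em B(2) B(3), of n n] integral_uniform_measure_eq[OF B(1) Dm B(2) B(3), of n n] \<mu>[of n]
      by (simp add: right_diff_distrib)
    finally show ?thesis .
  qed
  have G1: "\<bar>G n\<bar> \<le> 1" for n
  proof -
    interpret U: prob_space "uniform_measure M (B n)"
      using B(2,3)[of n] by (intro prob_space_uniform_measure) auto
    have mU: "?D n \<in> borel_measurable (uniform_measure M (B n))" "?E n \<in> borel_measurable (uniform_measure M (B n))"
      using Dm Em by (simp_all add: measurable_cong_sets[OF sets_uniform_measure refl])
    have iD: "integrable (uniform_measure M (B n)) (?D n)" "integrable (uniform_measure M (B n)) (?E n)"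
      using mU bnd by (auto intro!: U.integrable_const_bound[where B=1])
    have "(\<integral>x. ?D n x \<partial>uniform_measure M (B n)) \<le> 1" "(\<integral>x. ?E n x \<partial>uniform_measure M (B n)) \<le> 1"
      using iD bnd by (auto intro!: U.integral_le_const)
    moreover have "0 \<le> (\<integral>x. ?D n x \<partial>uniform_measure M (B n))" "0 \<le> (\<integral>x. ?E n x \<partial>uniform_measure M (B n))"
      using bnd by (auto intro!: Bochner_Integration.integral_nonneg)
    ultimately show ?thesis unfolding G_def by linarith
  qed
  have main: "(\<lambda>n. (\<integral>x. f x * ?D n x \<partial>M) - ?m * ?\<kappa> * G n) \<longlonglongrightarrow> 0"
  proof (rule LIMSEQ_I)
    fix e :: real assume e: "0 < e"
    have mk: "0 < ?m * ?\<kappa>" using m \<alpha> s by (simp add: Gamma_real_pos)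
    \<comment> \<open>Half of e is spent on the relative error; all other error terms vanish in
      the limit.\<close>
    define \<eta> where "\<eta> = min 1 (e / (2 * (?m * ?\<kappa>)))"
    have \<eta>: "0 < \<eta>" "\<eta> \<le> 1" using e mk by (auto simp: \<eta>_def)
    have "\<eta> \<le> e / (2 * (?m * ?\<kappa>))" by (simp add: \<eta>_def)
    then have "\<eta> * (2 * (?m * ?\<kappa>)) \<le> e" using mk by (simp add: le_divide_eq)
    moreover have "0 < \<eta> * (?m * ?\<kappa>)" by (rule mult_pos_pos[OF \<eta>(1) mk])
    moreover have "\<eta> * (2 * (?m * ?\<kappa>)) = 2 * (\<eta> * (?m * ?\<kappa>))" by simp
    ultimately have \<eta>e: "\<eta> * (?m * ?\<kappa>) < e" by linarith
    obtain N0 where N0: "AE x in M. x \<in> Y \<longrightarrow> (\<forall>n\<ge>N0. \<bar>(\<Sum>k<n. (transfer M T ^^ k) f x) - A n\<bar> \<le> \<eta> * A n)"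
      using uni[THEN spec, THEN mp, OF \<eta>(1)] by blast
    \<comment> \<open>The partial sum of length N has to contain the term of index 0.\<close>
    define N where "N = max N0 1"
    have N1: "1 \<le> N" by (simp add: N_def)
    have N: "AE x in M. x \<in> Y \<longrightarrow> (\<forall>n\<ge>N. \<bar>(\<Sum>k<n. (transfer M T ^^ k) f x) - A n\<bar> \<le> \<eta> * A n)"
      using N0 by eventually_elim (simp add: N_def)
    let ?r = "\<lambda>n. (\<eta> * ?L n + 5 * A N / ?q n) * ?\<mu> n + \<bar>?\<mu> n * ?L n - ?m * ?\<kappa>\<bar>"
    have q1: "?q \<longlonglongrightarrow> 1"
      using tendsto_exp[OF tendsto_mult[OF tendsto_const c0, of "- s"]] by simp
    have "(\<lambda>n. \<eta> * (?\<mu> n * ?L n) + 5 * A N / ?q n * ?\<mu> n + \<bar>?\<mu> n * ?L n - ?m * ?\<kappa>\<bar>)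
      \<longlonglongrightarrow> \<eta> * (?m * ?\<kappa>) + 5 * A N / 1 * 0 + \<bar>?m * ?\<kappa> - ?m * ?\<kappa>\<bar>"
      by (intro tendsto_add tendsto_mult tendsto_divide tendsto_rabs tendsto_diff tendsto_const Llim[unfolded mult.assoc] Llim q1 B0) auto
    then have "?r \<longlonglongrightarrow> \<eta> * (?m * ?\<kappa>)" by (simp add: algebra_simps)
    from order_tendstoD(2)[OF this \<eta>e]
    have "eventually (\<lambda>n. ?r n < e \<and> 0 < ?c n \<and> summable (\<lambda>k. ?q n ^ k * A k)) sequentially"
      using cpos ab(1) by eventually_elim simp
    then obtain K where K: "\<And>n. K \<le> n \<Longrightarrow> ?r n < e \<and> 0 < ?c n \<and> summable (\<lambda>k. ?q n ^ k * A k)"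
      unfolding eventually_sequentially by blast
    show "\<exists>K. \<forall>n\<ge>K. norm ((\<integral>x. f x * ?D n x \<partial>M) - ?m * ?\<kappa> * G n - 0) < e"
    proof (intro exI[of _ K] allI impI)
      fix n assume "K \<le> n"
      from K[OF this] have r: "?r n < e" and c: "0 < ?c n" and sm: "summable (\<lambda>k. ?q n ^ k * A k)" by auto
      have est: "\<bar>(\<integral>x. f x * ?D n x \<partial>M) - ?L n * (?\<mu> n * G n)\<bar> \<le> (\<eta> * ?L n + 5 * A N / ?q n) * ?\<mu> n"
        using hitting_integral_estimate[where d=d and \<delta>=\<delta>, OF f A(1,2) N N1 less_imp_le[OF \<eta>(1)] \<eta>(2) B(1) B(4) B(3) c s \<delta> sm]
        unfolding \<Theta>_def[symmetric] Gint[symmetric] unfolding \<Theta>_def .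
      have "\<bar>?L n * (?\<mu> n * G n) - ?m * ?\<kappa> * G n\<bar> = \<bar>?\<mu> n * ?L n - ?m * ?\<kappa>\<bar> * \<bar>G n\<bar>"
        by (subst abs_mult[symmetric]) (simp add: algebra_simps)
      also have "\<dots> \<le> \<bar>?\<mu> n * ?L n - ?m * ?\<kappa>\<bar> * 1" using G1 by (intro mult_left_mono) auto
      finally have "\<bar>?L n * (?\<mu> n * G n) - ?m * ?\<kappa> * G n\<bar> \<le> \<bar>?\<mu> n * ?L n - ?m * ?\<kappa>\<bar>" by simp
      then show "norm ((\<integral>x. f x * ?D n x \<partial>M) - ?m * ?\<kappa> * G n - 0) < e" using est r unfolding real_norm_def by linarith
    qed
  qed
  have alg: "(1 / m) * (u - m * k * g) = (1 / m) * u - k * g" if "0 < m" for m u k g :: real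
    using that by (simp add: field_simps)
  have "(\<lambda>n. (1 / ?m) * ((\<integral>x. f x * ?D n x \<partial>M) - ?m * ?\<kappa> * G n)) \<longlonglongrightarrow> (1 / ?m) * 0"
    by (intro tendsto_mult tendsto_const main)
  then show "(\<lambda>n. (1 / ?m) * (\<integral>x. f x * ?D n x \<partial>M) - ?\<kappa> *
       ((\<integral>x. ?E n x \<partial>uniform_measure M (B n)) - (\<integral>x. ?D n x \<partial>uniform_measure M (B n)))) \<longlonglongrightarrow> 0"
    unfolding G_def[symmetric] alg[OF m] by simp
qed

section \<open>Independence of the initial law\<close>

text \<open>
  Absolute continuity of the integral along sets of vanishing measure, by truncating \<open>u\<close> at height \<open>k\<close>.
\<close>
lemma integral_over_vanishing_sets:
  fixes u :: "'a \<Rightarrow> real"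
  assumes u: "integrable M u" "AE x in M. 0 \<le> u x"
    and B: "\<And>n. B n \<in> sets M" "\<And>n. emeasure M (B n) < \<infinity>" "(\<lambda>n. measure M (B n)) \<longlonglongrightarrow> 0"
  shows "(\<lambda>n. \<integral>x. u x * indicator (B n) x \<partial>M) \<longlonglongrightarrow> 0"
proof (rule LIMSEQ_I)
  fix e :: real assume e: "0 < e"
  note [measurable] = borel_measurable_integrable[OF u(1)]
  have ui: "integrable M (\<lambda>x. max 0 (u x - real k))" for k :: nat
    by (rule Bochner_Integration.integrable_bound[OF u(1)]) auto
  have "(\<lambda>k. \<integral>x. max 0 (u x - real k) \<partial>M) \<longlonglongrightarrow> (\<integral>x. 0 \<partial>M)"
  proof (rule integral_dominated_convergence[where w="\<lambda>x. \<bar>u x\<bar>"])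
    show "AE x in M. (\<lambda>k. max 0 (u x - real k)) \<longlonglongrightarrow> 0"
    proof (rule AE_I2)
      fix x
      obtain K :: nat where "u x \<le> real K" using real_arch_simple by blast
      then have "eventually (\<lambda>k. max 0 (u x - real k) = 0) sequentially"
        unfolding eventually_sequentially by (intro exI[of _ K]) auto
      then show "(\<lambda>k. max 0 (u x - real k)) \<longlonglongrightarrow> 0" by (rule tendsto_eventually)
    qed
    show "integrable M (\<lambda>x. \<bar>u x\<bar>)" using u(1) by (rule integrable_abs)
  qed auto
  from LIMSEQ_D[OF this, of "e / 2"] e obtain k :: nat where "norm ((\<integral>x. max 0 (u x - real k) \<partial>M) - (\<integral>x. 0 \<partial>M)) < e / 2"
    by auto
  then have k: "(\<integral>x. max 0 (u x - real k) \<partial>M) < e / 2" by simp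
  have "(\<lambda>n. real k * measure M (B n)) \<longlonglongrightarrow> real k * 0" by (intro tendsto_mult tendsto_const B)
  from LIMSEQ_D[OF this, of "e / 2"] e obtain N where N: "\<And>n. N \<le> n \<Longrightarrow> real k * measure M (B n) < e / 2" by auto
  show "\<exists>N. \<forall>n\<ge>N. norm ((\<integral>x. u x * indicator (B n) x \<partial>M) - 0) < e"
  proof (intro exI[of _ N] allI impI)
    fix n assume n: "N \<le> n"
    note [measurable] = B(1)[of n]
    have iB: "integrable M (indicator (B n) :: 'a \<Rightarrow> real)" using B by (simp add: integrable_indicator_iff)
    have iuB: "integrable M (\<lambda>x. u x * indicator (B n) x)"
      by (rule integrable_mult_bounded[where C=1, OF u(1)]) (auto simp: indicator_def)
    have "0 \<le> (\<integral>x. u x * indicator (B n) x \<partial>M)"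
      by (rule integral_nonneg_AE) (use u(2) in \<open>auto elim!: eventually_mono\<close>)
    moreover have "(\<integral>x. u x * indicator (B n) x \<partial>M) \<le> (\<integral>x. max 0 (u x - real k) + real k * indicator (B n) x \<partial>M)"
      by (rule integral_mono[OF iuB Bochner_Integration.integrable_add[OF ui integrable_mult_right[OF iB]]])
         (auto simp: indicator_def)
    moreover have "\<dots> = (\<integral>x. max 0 (u x - real k) \<partial>M) + real k * measure M (B n)"
      using B(1)[of n] by (subst Bochner_Integration.integral_add[OF ui integrable_mult_right[OF iB]])
        (simp add: Int_absorb1 sets.sets_into_space)
    ultimately show "norm ((\<integral>x. u x * indicator (B n) x \<partial>M) - 0) < e" using k N[OF n] by simp
  qed
qed

text \<open>
  By \<open>lap_return_step\<close> the functional at \<open>x\<close> and at \<open>T x\<close> differ by a factor \<open>exp (- s * c n)\<close>, unless \<open>T x\<close>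
  lies in \<open>B n\<close>, which has small probability.
\<close>
lemma hitting_functional_asymptotically_invariant:
  fixes \<delta> :: "nat \<Rightarrow> real" and u :: "'a \<Rightarrow> real" and B :: "nat \<Rightarrow> 'a set"
    and c :: "nat \<Rightarrow> real" and d :: nat and s :: real
  defines "H \<equiv> \<lambda>n x. lap s (excess (Suc d) \<delta> (scaled_seq (c n) (return_seq T (B n) x)))"
  assumes B: "\<And>n. B n \<in> sets M" "\<And>n. emeasure M (B n) < \<infinity>" "(\<lambda>n. measure M (B n)) \<longlonglongrightarrow> 0"
    and c: "eventually (\<lambda>n. 0 < c n) sequentially" "c \<longlonglongrightarrow> 0"
    and \<delta>: "\<delta> 0 = 0" and s: "0 < s" and u: "integrable M u" "\<And>x. 0 \<le> u x"
  shows "(\<lambda>n. \<integral>x. u x * \<bar>H n (T x) - H n x\<bar> \<partial>M) \<longlonglongrightarrow> 0"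
proof (rule tendsto_sandwich[OF _ _ tendsto_const])
  have H01: "0 \<le> H n x" "H n x \<le> 1" for n x using s by (simp_all add: H_def)
  have Hm[measurable]: "H n \<in> borel_measurable M" for n unfolding H_def by (rule lap_return_measurable[OF B(1) s])
  show "eventually (\<lambda>n. 0 \<le> (\<integral>x. u x * \<bar>H n (T x) - H n x\<bar> \<partial>M)) sequentially"
    using u by (intro always_eventually allI Bochner_Integration.integral_nonneg) auto
  let ?w = "transfer M T u"
  show "eventually (\<lambda>n. (\<integral>x. u x * \<bar>H n (T x) - H n x\<bar> \<partial>M) \<le>
      (1 - exp (- s * c n)) * (\<integral>x. u x \<partial>M) + (\<integral>x. ?w x * indicator (B n) x \<partial>M)) sequentially"
    using c(1)
  proof eventually_elim
    case (elim n)
    let ?q = "exp (- s * c n)"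
    note [measurable] = B(1)[of n]
    have q: "0 < ?q" "?q \<le> 1" using s elim by auto
    have pt: "\<bar>H n (T x) - H n x\<bar> \<le> (1 - ?q) + indicator (B n) (T x)" for x
    proof (cases "T x \<in> B n")
      case True
      then have ind: "indicator (B n) (T x) = (1::real)" by simp
      show ?thesis unfolding ind using H01[of n x] H01[of n "T x"] q(2) by linarith
    next
      case False
      then have "H n x = ?q * H n (T x)"
        using lap_return_step[where \<delta>=\<delta> and T=T and A="B n" and x=x and d=d and s=s, OF \<delta> less_imp_le[OF elim]]
        by (simp add: H_def)
      then have "H n (T x) - H n x = (1 - ?q) * H n (T x)" by (simp add: algebra_simps)
      moreover have "(1 - ?q) * H n (T x) \<le> (1 - ?q) * 1" using q H01 by (intro mult_left_mono) auto
      moreover have "0 \<le> (1 - ?q) * H n (T x)" using q H01 by simp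
      ultimately show ?thesis using False by simp
    qed
    have i1: "integrable M (\<lambda>x. u x * \<bar>H n (T x) - H n x\<bar>)"
    proof (rule integrable_mult_bounded[where C=2, OF u(1)])
      show "AE x in M. \<bar>\<bar>H n (T x) - H n x\<bar>\<bar> \<le> 2"
      proof (rule AE_I2)
        fix x show "\<bar>\<bar>H n (T x) - H n x\<bar>\<bar> \<le> 2" using H01[of n x] H01[of n "T x"] by linarith
      qed
    qed measurable
    have i2: "integrable M (\<lambda>x. u x * (indicator (B n) (T x) :: real))"
      by (rule integrable_mult_bounded[where C=1, OF u(1)]) (auto simp: indicator_def)
    have i3: "integrable M (\<lambda>x. (1 - ?q) * u x)" by (rule integrable_mult_right[OF u(1)])
    have "(\<integral>x. u x * \<bar>H n (T x) - H n x\<bar> \<partial>M) \<le> (\<integral>x. (1 - ?q) * u x + u x * indicator (B n) (T x) \<partial>M)"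
    proof (rule integral_mono[OF i1 Bochner_Integration.integrable_add[OF i3 i2]])
      fix x
      have "u x * \<bar>H n (T x) - H n x\<bar> \<le> u x * ((1 - ?q) + indicator (B n) (T x))"
        using pt u(2) by (intro mult_left_mono) auto
      then show "u x * \<bar>H n (T x) - H n x\<bar> \<le> (1 - ?q) * u x + u x * indicator (B n) (T x)"
        by (simp only: distrib_left mult.commute[of "u x" "1 - ?q"])
    qed
    also have "\<dots> = (1 - ?q) * (\<integral>x. u x \<partial>M) + (\<integral>x. u x * indicator (B n) (T x) \<partial>M)"
      by (subst Bochner_Integration.integral_add[OF i3 i2]) simp
    also have "(\<integral>x. u x * indicator (B n) (T x) \<partial>M) = (\<integral>x. ?w x * indicator (B n) x \<partial>M)"
      by (rule transfer_integral[OF u(1), where C=1, symmetric]) (auto simp: indicator_def)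
    finally show ?case .
  qed
  have ex: "(\<lambda>n. exp (- s * c n)) \<longlonglongrightarrow> exp (- s * 0)" by (intro tendsto_intros c)
  have v: "(\<lambda>n. \<integral>x. ?w x * indicator (B n) x \<partial>M) \<longlonglongrightarrow> 0"
    by (intro integral_over_vanishing_sets B transfer_integrable transfer_nonneg u(1)) (simp add: u(2))
  have "(\<lambda>n. (1 - exp (- s * c n)) * (\<integral>x. u x \<partial>M) + (\<integral>x. ?w x * indicator (B n) x \<partial>M))
     \<longlonglongrightarrow> (1 - exp (- s * 0)) * (\<integral>x. u x \<partial>M) + 0"
    by (intro tendsto_add tendsto_mult tendsto_diff tendsto_const ex v)
  then show "(\<lambda>n. (1 - exp (- s * c n)) * (\<integral>x. u x \<partial>M) + (\<integral>x. ?w x * indicator (B n) x \<partial>M)) \<longlonglongrightarrow> 0" by simp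
qed

lemma absolutely_continuous_density:
  assumes \<nu>: "prob_space \<nu>" "sets \<nu> = sets M" "absolutely_continuous M \<nu>"
  obtains w :: "'a \<Rightarrow> real" where "integrable M w" "(\<integral>x. w x \<partial>M) = 1"
    "\<And>h :: 'a \<Rightarrow> real. h \<in> borel_measurable M \<Longrightarrow> (\<integral>x. h x \<partial>\<nu>) = (\<integral>x. w x * h x \<partial>M)"
proof -
  interpret \<nu>: prob_space \<nu> by (rule \<nu>)
  obtain w :: "'a \<Rightarrow> real" where w: "integrable M w" "\<And>x. 0 \<le> w x" and d: "density M (\<lambda>x. ennreal (w x)) = \<nu>"
    using finite_absolutely_continuous_real_density[OF \<nu>.finite_measure_axioms \<nu>(2,3)] by blast
  have h: "(\<integral>x. h x \<partial>\<nu>) = (\<integral>x. w x * h x \<partial>M)" if [measurable]: "h \<in> borel_measurable M" for h :: "'a \<Rightarrow> real"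
    unfolding d[symmetric] using w by (subst integral_density) auto
  show thesis
  proof (rule that[OF w(1) _ h])
    show "(\<integral>x. w x \<partial>M) = 1" using h[of "\<lambda>_. 1"] \<nu>.prob_space by simp
  qed
qed

lemma density_probability:
  fixes f :: "'a \<Rightarrow> real"
  assumes f: "integrable M f" "AE x in M. 0 \<le> f x" and m: "0 < (\<integral>x. f x \<partial>M)"
  obtains \<nu> where "prob_space \<nu>" "sets \<nu> = sets M" "absolutely_continuous M \<nu>"
    "\<And>h :: 'a \<Rightarrow> real. h \<in> borel_measurable M \<Longrightarrow> (\<integral>x. h x \<partial>\<nu>) = (1 / (\<integral>x. f x \<partial>M)) * (\<integral>x. f x * h x \<partial>M)"
proof -
  let ?m = "\<integral>x. f x \<partial>M"
  let ?\<nu> = "density M (\<lambda>x. ennreal (f x / ?m))"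
  note [measurable] = borel_measurable_integrable[OF f(1)]
  have nn: "AE x in M. 0 \<le> f x / ?m" using f(2) m by (auto elim!: eventually_mono)
  show thesis
  proof (rule that[of ?\<nu>])
    show "prob_space ?\<nu>"
    proof
      have "emeasure ?\<nu> (space ?\<nu>) = (\<integral>\<^sup>+x. ennreal (f x / ?m) \<partial>M)"
        by (simp add: emeasure_density cong: nn_integral_cong)
      also have "\<dots> = ennreal (\<integral>x. f x / ?m \<partial>M)" using f(1) nn by (intro nn_integral_eq_integral) auto
      also have "\<dots> = 1" using m by simp
      finally show "emeasure ?\<nu> (space ?\<nu>) = 1" .
    qed
    show "sets ?\<nu> = sets M" by simp
    show "absolutely_continuous M ?\<nu>" by (rule absolutely_continuousI_density) measurable
    fix h :: "'a \<Rightarrow> real" assume [measurable]: "h \<in> borel_measurable M"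
    have "(\<integral>x. h x \<partial>?\<nu>) = (\<integral>x. (f x / ?m) * h x \<partial>M)" using nn by (subst integral_density) auto
    also have "\<dots> = (\<integral>x. (1 / ?m) * (f x * h x) \<partial>M)" by simp
    also have "\<dots> = (1 / ?m) * (\<integral>x. f x * h x \<partial>M)" by (rule integral_mult_right_zero)
    finally show "(\<integral>x. h x \<partial>?\<nu>) = (1 / ?m) * (\<integral>x. f x * h x \<partial>M)" .
  qed
qed

section \<open>Limits of hitting and return laws\<close>

text \<open>
  Along every subsequence on which both laws converge, the limits satisfy the Laplace relation. If one
  side converges along the whole sequence, all subsequential limits of the other side solve the same
  relation and therefore coincide. The comparison of initial laws extends convergence from the density
  \<open>f\<close> to all absolutely continuous initial laws.
\<close>
lemma hitting_return_limits:
  fixes B :: "nat \<Rightarrow> 'a set" and b :: "real \<Rightarrow> real"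
  defines "\<Theta> \<equiv> \<lambda>n x. scaled_seq (scaling b (measure M (B n))) (return_seq T (B n) x)"
  defines "return_limit \<equiv> \<lambda>Q. process_law Q \<and> converges_in_law (\<lambda>n. uniform_measure M (B n)) \<Theta> Q"
  defines "hitting_limit \<equiv> \<lambda>P. process_law P \<and>
             (\<forall>\<nu>. prob_space \<nu> \<and> sets \<nu> = sets M \<and> absolutely_continuous M \<nu> \<longrightarrow> converges_in_law (\<lambda>n. \<nu>) \<Theta> P)"
  assumes ce: "conservative_ergodic M T" and \<alpha>: "0 < \<alpha>" "\<alpha> \<le> 1"
    and us: "uniform_set M T a Y" and rv: "regularly_varying a \<alpha>" and ai: "asymptotic_inverse a b"
    and B: "\<And>n. B n \<in> sets M" "\<And>n. 0 < emeasure M (B n)" "\<And>n. emeasure M (B n) < \<infinity>" "\<And>n. B n \<subseteq> Y"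
    and B0: "(\<lambda>n. measure M (B n)) \<longlonglongrightarrow> 0"
  shows "(\<exists>Q. return_limit Q) \<longleftrightarrow> (\<exists>P. hitting_limit P)"
    and "hitting_limit P \<Longrightarrow> return_limit Q \<Longrightarrow>
      monotone_process_law P \<and> monotone_process_law Q \<and> laplace_relation \<alpha> P Q"
proof -
  let ?U = "\<lambda>n. uniform_measure M (B n)"
  have Tm: "\<Theta> n \<in> borel_measurable M" for n unfolding \<Theta>_def by (rule scaled_return_measurable[OF B(1)])
  have mono: "\<Theta> n x \<in> monotone_seqs" for n x unfolding \<Theta>_def by (rule scaled_return_monotone)
  have meas: "\<Theta> n \<in> borel_measurable N" if "sets N = sets M" for n and N :: "'a measure"
    using Tm[of n] by (simp only: measurable_cong_sets[OF that refl])
  have Um: "\<Theta> n \<in> borel_measurable (?U n)" for n by (rule meas) simp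
  have Up: "prob_space (?U n)" for n using B(2,3)[of n] by (intro prob_space_uniform_measure) auto
  obtain f and A :: "nat \<Rightarrow> real" where f: "integrable M f" "AE x in M. 0 \<le> f x" "0 < (\<integral>x. f x \<partial>M)"
    and A: "\<And>k. 0 \<le> A k" "mono A" "regularly_varying A \<alpha>" "eventually (\<lambda>x. 0 < floor_ext A x) at_top"
    and Aa: "((\<lambda>x. floor_ext A x / floor_ext a x) \<longlongrightarrow> (\<integral>x. f x \<partial>M)) at_top"
    and apos: "eventually (\<lambda>x. 0 < floor_ext a x) at_top"
    and uni: "\<forall>\<eta>>0. \<exists>N. AE x in M. x \<in> Y \<longrightarrow> (\<forall>n\<ge>N. \<bar>(\<Sum>k<n. (transfer M T ^^ k) f x) - A n\<bar> \<le> \<eta> * A n)"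
    using uniform_set_comparison[OF us rv] by blast
  obtain \<nu>f where \<nu>f: "prob_space \<nu>f" "sets \<nu>f = sets M" "absolutely_continuous M \<nu>f"
    and \<nu>i: "\<And>h :: 'a \<Rightarrow> real. h \<in> borel_measurable M \<Longrightarrow> (\<integral>x. h x \<partial>\<nu>f) = (1 / (\<integral>x. f x \<partial>M)) * (\<integral>x. f x * h x \<partial>M)"
    using density_probability[OF f] by blast
  note asym = hitting_return_asymptotics[OF f A Aa apos uni \<alpha> ai B B0]
  have Hm: "(\<lambda>x. lap s (excess d \<delta> (\<Theta> n x))) \<in> borel_measurable M" if "0 < s" for s d \<delta> n
    unfolding \<Theta>_def by (rule lap_return_measurable[OF B(1) that])
  let ?\<kappa> = "\<lambda>s. Gamma (1 + \<alpha>) * s powr (- \<alpha>)"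
  have asym': "(\<lambda>n. (\<integral>x. lap s (excess (Suc d) \<delta> (\<Theta> n x)) \<partial>\<nu>f)
     - ?\<kappa> s * ((\<integral>x. lap s (excess d (\<lambda>i. \<delta> (Suc i)) (\<Theta> n x)) \<partial>?U n) - (\<integral>x. lap s (excess (Suc d) \<delta> (\<Theta> n x)) \<partial>?U n))) \<longlonglongrightarrow> 0"
    if "spread d \<delta>" "0 < s" for d \<delta> s
    unfolding \<nu>i[OF Hm[OF that(2)]] using asym(1)[OF that] by (simp only: \<Theta>_def)
  have related: "laplace_relation \<alpha> P Q"
    if r: "strict_mono r" and cP: "converges_in_law (\<lambda>n. \<nu>f) (\<lambda>n. \<Theta> (r n)) P"
      and cQ: "converges_in_law (\<lambda>n. ?U (r n)) (\<lambda>n. \<Theta> (r n)) Q" for r P Q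
    unfolding laplace_relation_def
  proof (intro allI impI)
    fix d \<delta> and s :: real assume "spread d \<delta> \<and> 0 < s"
    then have sp: "spread d \<delta>" and s: "0 < s" by auto
    have "(\<lambda>n. (\<integral>x. lap s (excess (Suc d) \<delta> (\<Theta> (r n) x)) \<partial>\<nu>f)
     - ?\<kappa> s * ((\<integral>x. lap s (excess d (\<lambda>i. \<delta> (Suc i)) (\<Theta> (r n) x)) \<partial>?U (r n)) - (\<integral>x. lap s (excess (Suc d) \<delta> (\<Theta> (r n) x)) \<partial>?U (r n))))
      \<longlonglongrightarrow> lap_excess P (Suc d) \<delta> s - ?\<kappa> s * (lap_excess Q d (\<lambda>i. \<delta> (Suc i)) s - lap_excess Q (Suc d) \<delta> s)"
      by (intro tendsto_diff tendsto_mult tendsto_const converges_in_law_lap_excess[OF cP s] converges_in_law_lap_excess[OF cQ s])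
    moreover have "(\<lambda>n. (\<integral>x. lap s (excess (Suc d) \<delta> (\<Theta> (r n) x)) \<partial>\<nu>f)
     - ?\<kappa> s * ((\<integral>x. lap s (excess d (\<lambda>i. \<delta> (Suc i)) (\<Theta> (r n) x)) \<partial>?U (r n)) - (\<integral>x. lap s (excess (Suc d) \<delta> (\<Theta> (r n) x)) \<partial>?U (r n)))) \<longlonglongrightarrow> 0"
      using LIMSEQ_subseq_LIMSEQ[OF asym'[OF sp s] r] by (simp add: o_def)
    ultimately show "lap_excess P (Suc d) \<delta> s = ?\<kappa> s * (lap_excess Q d (\<lambda>i. \<delta> (Suc i)) s - lap_excess Q (Suc d) \<delta> s)"
      using LIMSEQ_unique by fastforce
  qed
  have compare: "(\<lambda>n. (\<integral>x. lap s (excess (Suc d) \<delta> (\<Theta> n x)) \<partial>\<nu>) - (\<integral>x. lap s (excess (Suc d) \<delta> (\<Theta> n x)) \<partial>\<nu>f)) \<longlonglongrightarrow> 0"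
    if \<nu>: "prob_space \<nu>" "sets \<nu> = sets M" "absolutely_continuous M \<nu>" and sp: "spread d \<delta>" and s: "0 < s" for \<nu> d \<delta> s
  proof -
    obtain w :: "'a \<Rightarrow> real" where w: "integrable M w" "(\<integral>x. w x \<partial>M) = 1"
      "\<And>h :: 'a \<Rightarrow> real. h \<in> borel_measurable M \<Longrightarrow> (\<integral>x. h x \<partial>\<nu>) = (\<integral>x. w x * h x \<partial>M)"
      using absolutely_continuous_density[OF \<nu>] by blast
    let ?m = "\<integral>x. f x \<partial>M" and ?H = "\<lambda>n x. lap s (excess (Suc d) \<delta> (\<Theta> n x))"
    have H1: "\<bar>?H n x\<bar> \<le> 1" for n x using s by simp
    let ?v = "\<lambda>x. w x - (1 / ?m) * f x"
    have fi: "integrable M (\<lambda>x. (1 / ?m) * f x)" by (rule integrable_mult_right[OF f(1)])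
    have vi: "integrable M ?v" by (rule Bochner_Integration.integrable_diff[OF w(1) fi])
    have v0: "(\<integral>x. ?v x \<partial>M) = 0"
      using Bochner_Integration.integral_diff[OF w(1) fi] w(2) f(3) by simp
    have "\<delta> 0 = 0" using sp by (simp add: spread_def)
    note inv = hitting_functional_asymptotically_invariant[where \<delta>=\<delta> and d=d, OF B(1,3) B0 asym(2,3)[OF sp s] this s]
    have "(\<lambda>n. \<integral>x. ?v x * ?H n x \<partial>M) \<longlonglongrightarrow> 0"
      by (rule asymptotically_invariant_integral[OF ce Hm[OF s] H1 _ vi v0])
         (unfold \<Theta>_def, rule inv)
    moreover have "(\<integral>x. ?v x * ?H n x \<partial>M) = (\<integral>x. ?H n x \<partial>\<nu>) - (\<integral>x. ?H n x \<partial>\<nu>f)" for n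
    proof -
      have HA: "AE x in M. \<bar>?H n x\<bar> \<le> 1" using H1 by simp
      have "(\<integral>x. ?v x * ?H n x \<partial>M) = (\<integral>x. w x * ?H n x \<partial>M) - (\<integral>x. ((1 / ?m) * f x) * ?H n x \<partial>M)"
        unfolding left_diff_distrib
        by (rule Bochner_Integration.integral_diff[OF integrable_mult_bounded[OF w(1) Hm[OF s] HA] integrable_mult_bounded[OF fi Hm[OF s] HA]])
      also have "(\<integral>x. ((1 / ?m) * f x) * ?H n x \<partial>M) = (\<integral>x. ?H n x \<partial>\<nu>f)"
        unfolding \<nu>i[OF Hm[OF s]] mult.assoc by (rule integral_mult_right_zero)
      finally show ?thesis unfolding w(3)[OF Hm[OF s]] .
    qed
    ultimately show ?thesis by simp
  qed
  have mono_lim: "monotone_process_law R" if "converges_in_law N (\<lambda>n. \<Theta> (r n)) R" "process_law R" for N r R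
    by (rule limit_law_monotone[OF that]) (rule mono)
  have hit: "hitting_limit P \<Longrightarrow> converges_in_law (\<lambda>n. \<nu>f) \<Theta> P" for P
    unfolding hitting_limit_def using \<nu>f by blast
  show rel: "monotone_process_law P \<and> monotone_process_law Q \<and> laplace_relation \<alpha> P Q"
    if P: "hitting_limit P" and Q: "return_limit Q" for P Q
  proof (intro conjI)
    have cQ: "converges_in_law ?U \<Theta> Q" and pQ: "process_law Q" using Q by (auto simp: return_limit_def)
    have pP: "process_law P" using P by (auto simp: hitting_limit_def)
    show "monotone_process_law P" using mono_lim[of _ id P] hit[OF P] pP by simp
    show "monotone_process_law Q" using mono_lim[of _ id Q] cQ pQ by simp
    show "laplace_relation \<alpha> P Q" using related[of id P Q] hit[OF P] cQ strict_mono_id by simp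
  qed
  show "(\<exists>Q. return_limit Q) \<longleftrightarrow> (\<exists>P. hitting_limit P)"
  proof
    assume "\<exists>Q. return_limit Q"
    then obtain Q where pQ: "process_law Q" and cQ: "converges_in_law ?U \<Theta> Q" by (auto simp: return_limit_def)
    obtain r P where r: "strict_mono r" and pP: "process_law P" and cP: "converges_in_law (\<lambda>n. \<nu>f) (\<lambda>n. \<Theta> (r n)) P"
      using process_law_compactness[of "\<lambda>n. \<nu>f" \<Theta>] \<nu>f(1) meas[OF \<nu>f(2)] by blast
    have mP: "monotone_process_law P" by (rule mono_lim[OF cP pP])
    have relP: "laplace_relation \<alpha> P Q" by (rule related[OF r cP converges_in_law_subseq[OF cQ r]])
    have conv_f: "converges_in_law (\<lambda>n. \<nu>f) \<Theta> P"
    proof (rule converges_in_law_if_unique_limit)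
      fix q R assume q: "strict_mono q" and R: "process_law R" and cR: "converges_in_law (\<lambda>n. \<nu>f) (\<lambda>n. \<Theta> (q n)) R"
      have "laplace_relation \<alpha> R Q" by (rule related[OF q cR converges_in_law_subseq[OF cQ q]])
      then show "R = P" using laplace_relation_unique_hitting mono_lim[OF cR R] mP relP by blast
    qed (use \<nu>f meas in auto)
    have "converges_in_law (\<lambda>n. \<nu>) \<Theta> P"
      if \<nu>: "prob_space \<nu>" "sets \<nu> = sets M" "absolutely_continuous M \<nu>" for \<nu>
    proof (rule converges_in_law_if_unique_limit)
      fix q R assume q: "strict_mono q" and R: "process_law R" and cR: "converges_in_law (\<lambda>n. \<nu>) (\<lambda>n. \<Theta> (q n)) R"
      show "R = P"
      proof (rule monotone_law_eq_by_induction[OF mono_lim[OF cR R] mP])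
        fix d \<delta> and s :: real assume sp: "spread d \<delta>" and s: "0 < s"
        let ?H = "\<lambda>n x. lap s (excess (Suc d) \<delta> (\<Theta> n x))"
        have "(\<lambda>n. (\<integral>x. ?H (q n) x \<partial>\<nu>) - (\<integral>x. ?H (q n) x \<partial>\<nu>f)) \<longlonglongrightarrow> lap_excess R (Suc d) \<delta> s - lap_excess P (Suc d) \<delta> s"
          by (intro tendsto_diff converges_in_law_lap_excess[OF cR s]
              converges_in_law_lap_excess[OF converges_in_law_subseq[OF conv_f q] s])
        moreover have "(\<lambda>n. (\<integral>x. ?H (q n) x \<partial>\<nu>) - (\<integral>x. ?H (q n) x \<partial>\<nu>f)) \<longlonglongrightarrow> 0"
          using LIMSEQ_subseq_LIMSEQ[OF compare[OF \<nu> sp s] q] by (simp add: o_def)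
        ultimately show "lap_excess R (Suc d) \<delta> s = lap_excess P (Suc d) \<delta> s"
          using LIMSEQ_unique by fastforce
      qed
    qed (use \<nu> meas in auto)
    then show "\<exists>P. hitting_limit P" unfolding hitting_limit_def using pP by blast
  next
    assume "\<exists>P. hitting_limit P"
    then obtain P where P: "hitting_limit P" by blast
    note cP = hit[OF P]
    obtain r Q where r: "strict_mono r" and pQ: "process_law Q" and cQ: "converges_in_law (\<lambda>n. ?U (r n)) (\<lambda>n. \<Theta> (r n)) Q"
      using process_law_compactness[of ?U \<Theta>] Up Um by blast
    have mQ: "monotone_process_law Q" by (rule mono_lim[OF cQ pQ])
    have relQ: "laplace_relation \<alpha> P Q" by (rule related[OF r converges_in_law_subseq[OF cP r] cQ])
    have "converges_in_law ?U \<Theta> Q"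
    proof (rule converges_in_law_if_unique_limit)
      fix q R assume q: "strict_mono q" and R: "process_law R" and cR: "converges_in_law (\<lambda>n. ?U (q n)) (\<lambda>n. \<Theta> (q n)) R"
      have "laplace_relation \<alpha> P R" by (rule related[OF q converges_in_law_subseq[OF cP q] cR])
      then show "R = Q" using laplace_relation_unique_return[OF mono_lim[OF cR R] mQ _ relQ \<alpha>(1)] by blast
    qed (use Up Um in auto)
    then show "\<exists>Q. return_limit Q" unfolding return_limit_def using pQ by blast
  qed
qed

end

theorem theoremB:
  fixes M :: "'a measure" and T :: "'a \<Rightarrow> 'a" and Y :: "'a set" and B :: "nat \<Rightarrow> 'a set"
    and a :: "nat \<Rightarrow> real" and b :: "real \<Rightarrow> real" and \<alpha> :: real
  defines "\<Theta> \<equiv> \<lambda>n x. scaled_seq (scaling b (measure M (B n))) (return_seq T (B n) x)"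
  defines "return_limit \<equiv> \<lambda>Q. process_law Q \<and>
             converges_in_law (\<lambda>n. uniform_measure M (B n)) \<Theta> Q"
  defines "hitting_limit \<equiv> \<lambda>P. process_law P \<and>
             (\<forall>\<nu>. prob_space \<nu> \<and> sets \<nu> = sets M \<and> absolutely_continuous M \<nu> \<longrightarrow>
                converges_in_law (\<lambda>n. \<nu>) \<Theta> P)"
  shows
    "(sigma_finite_measure M \<and> emeasure M (space M) = \<infinity> \<and> mpt M T \<and>
      conservative_ergodic M T \<and> pointwise_dual_ergodic M T \<and>
      0 < \<alpha> \<and> \<alpha> \<le> 1 \<and>
      uniform_set M T a Y \<and> regularly_varying a \<alpha> \<and> asymptotic_inverse a b \<and>
      (\<forall>n. B n \<in> sets M \<and> 0 < emeasure M (B n) \<and> B n \<subseteq> Y) \<and>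
      (\<lambda>n. emeasure M (B n)) \<longlonglongrightarrow> 0
      \<longrightarrow>
      ((\<exists>Q. return_limit Q) \<longleftrightarrow> (\<exists>P. hitting_limit P)) \<and>
      (\<forall>P Q. hitting_limit P \<and> return_limit Q \<longrightarrow>
         hitting_return_relation \<alpha> P Q \<and>
         (\<forall>P'. monotone_process_law P' \<and> hitting_return_relation \<alpha> P' Q \<longleftrightarrow> P' = P) \<and>
         (\<forall>Q'. monotone_process_law Q' \<and> hitting_return_relation \<alpha> P Q' \<longleftrightarrow> Q' = Q)))
     \<and>
     (\<forall>\<beta>. 0 < \<beta> \<and> \<beta> \<le> 1 \<longrightarrow>
        (\<forall>P. monotone_process_law P \<and> hitting_return_relation \<beta> P P \<longleftrightarrow>
               P = FPP_law \<beta> (Gamma (1 + \<beta>))))"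
proof -
  have fixed: "\<forall>\<beta>. 0 < \<beta> \<and> \<beta> \<le> 1 \<longrightarrow>
      (\<forall>P. monotone_process_law P \<and> hitting_return_relation \<beta> P P \<longleftrightarrow> P = FPP_law \<beta> (Gamma (1 + \<beta>)))"
    using FPP_unique_fixed_point by blast
  have "((\<exists>Q. return_limit Q) \<longleftrightarrow> (\<exists>P. hitting_limit P)) \<and>
      (\<forall>P Q. hitting_limit P \<and> return_limit Q \<longrightarrow>
         hitting_return_relation \<alpha> P Q \<and>
         (\<forall>P'. monotone_process_law P' \<and> hitting_return_relation \<alpha> P' Q \<longleftrightarrow> P' = P) \<and>
         (\<forall>Q'. monotone_process_law Q' \<and> hitting_return_relation \<alpha> P Q' \<longleftrightarrow> Q' = Q))"
    if sf: "sigma_finite_measure M" and mp: "mpt M T" and ce: "conservative_ergodic M T"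
      and \<alpha>: "0 < \<alpha>" "\<alpha> \<le> 1" and us: "uniform_set M T a Y" and rv: "regularly_varying a \<alpha>"
      and ai: "asymptotic_inverse a b"
      and B: "\<And>n. B n \<in> sets M" "\<And>n. 0 < emeasure M (B n)" "\<And>n. B n \<subseteq> Y"
      and B0: "(\<lambda>n. emeasure M (B n)) \<longlonglongrightarrow> 0"
  proof -
    interpret sigma_finite_measure M by (rule sf)
    interpret mpt_system M T by unfold_locales (rule mp)
    have "eventually (\<lambda>n. emeasure M (B n) < \<top>) sequentially" by (rule order_tendstoD(2)[OF B0]) simp
    then obtain k where k: "\<And>n. k \<le> n \<Longrightarrow> emeasure M (B n) < \<infinity>"
      unfolding eventually_sequentially by auto
    \<comment> \<open>Only finitely many sets can have infinite measure; convergence in law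
      ignores them.\<close>
    let ?B = "\<lambda>n. B (n + k)"
    have fin: "emeasure M (?B n) < \<infinity>" for n by (rule k) simp
    have m0: "(\<lambda>n. measure M (?B n)) \<longlonglongrightarrow> 0"
      using tendsto_enn2real[of "\<lambda>n. emeasure M (?B n)" 0 sequentially] LIMSEQ_ignore_initial_segment[OF B0, of k]
      by (simp add: measure_def)
    have ret: "return_limit Q \<longleftrightarrow> process_law Q \<and>
        converges_in_law (\<lambda>n. uniform_measure M (?B n)) (\<lambda>n x. scaled_seq (scaling b (measure M (?B n))) (return_seq T (?B n) x)) Q" for Q
      unfolding return_limit_def \<Theta>_def
      using converges_in_law_shift[of "\<lambda>n. uniform_measure M (B n)" k "\<lambda>n x. scaled_seq (scaling b (measure M (B n))) (return_seq T (B n) x)" Q]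
      by simp
    have hit: "hitting_limit P \<longleftrightarrow> process_law P \<and>
        (\<forall>\<nu>. prob_space \<nu> \<and> sets \<nu> = sets M \<and> absolutely_continuous M \<nu> \<longrightarrow>
          converges_in_law (\<lambda>n. \<nu>) (\<lambda>n x. scaled_seq (scaling b (measure M (?B n))) (return_seq T (?B n) x)) P)" for P
      unfolding hitting_limit_def \<Theta>_def
      using converges_in_law_shift[of "\<lambda>n. \<nu>" k "\<lambda>n x. scaled_seq (scaling b (measure M (B n))) (return_seq T (B n) x)" P for \<nu>]
      by simp
    note limits = hitting_return_limits[where B="?B", OF ce \<alpha> us rv ai B(1) B(2) fin B(3) m0, folded ret hit]
    have law: "process_law R" if "monotone_process_law R" for R
      using that by (simp add: monotone_process_law_def)
    show ?thesis
    proof (intro conjI allI impI)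
      show "(\<exists>Q. return_limit Q) \<longleftrightarrow> (\<exists>P. hitting_limit P)" by (rule limits(1))
      fix P Q assume "hitting_limit P \<and> return_limit Q"
      then have mP: "monotone_process_law P" and mQ: "monotone_process_law Q" and rel: "laplace_relation \<alpha> P Q"
        using limits(2) by blast+
      note iff = hitting_return_relation_iff_laplace[OF _ _ \<alpha>(1)]
      show hr: "hitting_return_relation \<alpha> P Q" using iff[OF law[OF mP] law[OF mQ]] rel by blast
      show "monotone_process_law P' \<and> hitting_return_relation \<alpha> P' Q \<longleftrightarrow> P' = P" for P'
        using iff[OF law law[OF mQ], of P'] laplace_relation_unique_hitting[OF _ mP _ rel, of P'] mP hr by blast
      show "monotone_process_law Q' \<and> hitting_return_relation \<alpha> P Q' \<longleftrightarrow> Q' = Q" for Q'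
        using iff[OF law[OF mP] law, of Q'] laplace_relation_unique_return[OF _ mQ _ rel \<alpha>(1), of Q'] mQ hr by blast
    qed
  qed
  with fixed show ?thesis by blast
qed

end
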